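(* Let $n\ge2$ and let $N$ be a simply connected $(n-1)$-manifold. (a) Let $\phi:N\to\mathbb{CP}^{n-1}$ be a minimal Lagrangian immersion and $\tilde\phi:N\to\mathbb{S}^{2n-1}$ the horizontal lift of $\phi$ with respect to the Hopf fibration $\mathbb{S}^{2n-1}\to\mathbb{CP}^{n-1}$. Then $$\Phi:\mathbb{R}^+\times N\to\mathbb{CH}^n,\qquad \Phi(s,x)=[(\sinh s\,\tilde\phi(x),\cosh s)],$$ is a minimal Lagrangian immersion in $\mathbb{CH}^n$. (b) Let $\psi:N\to\mathbb{CH}^{n-1}$ be a minimal Lagrangian immersion and $\tilde\psi:N\to\mathbb{H}^{2n-1}_1$ the horizontal lift of $\psi$ with respect to the Hopf fibration $\mathbb{H}^{2n-1}_1\to\mathbb{CH}^{n-1}$. Then $$\Psi:\mathbb{R}\times N\to\mathbb{CH}^n,\qquad \Psi(s,x)=[(\sinh s,\cosh s\,\tilde\psi(x))],$$ is a minimal Lagrangian immersion in $\mathbb{CH}^n$. (c) Let $\eta:N\to\mathbb{C}^{n-1}$ be a minimal Lagrangian immersion and let $f:N\to\mathbb{C}$ satisfy $\Re f=|\eta|^2$ and $v(\Im f)=2\langle\eta_*v,J\eta\rangle$ for any vector $v$ tangent to $N$. Then $$\Upsilon:\mathbb{R}\times N\to\mathbb{CH}^n,\qquad \Upsilon(s,x)=\left[e^s\left(\eta(x),\tfrac{f(x)}{2},\tfrac{f(x)}{2}\right)+(0,-\sinh s,\cosh s)\right],$$ is a minimal Lagrangian immersion in $\mathbb{CH}^n$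.
   Context: For each $m$, on $\mathbb{C}^{m+1}$ consider $(z,w)=\sum_{i=1}^m z_i\bar w_i-z_{m+1}\bar w_{m+1}$, and let $\mathbb{H}^{2m+1}_1=\{z: (z,z)=-1\}$ with the metric induced by $\Re(\,,)$. $\mathbb{CH}^m=\mathbb{H}^{2m+1}_1/\mathbb{S}^1$, with Hopf projection $z\mapsto[z]$, has the metric making this projection a pseudo-Riemannian submersion (constant holomorphic sectional curvature $-4$) and the induced complex structure. $\mathbb{CP}^m=\mathbb{S}^{2m+1}/\mathbb{S}^1$ has the Fubini–Study metric of constant holomorphic sectional curvature $4$ and Hopf fibration $\mathbb{S}^{2m+1}\to\mathbb{CP}^m$. An immersion of an $m$-manifold in $\mathbb{CH}^m$, $\mathbb{CP}^m$ or $\mathbb{C}^m$ is Lagrangian if the Kähler two-form pulls back to $0$, and minimal if its mean curvature vanishes. A Lagrangian immersion of a simply connected manifold in $\mathbb{CH}^m$ (resp. $\mathbb{CP}^m$) has a lift to $\mathbb{H}^{2m+1}_1$ (resp. $\mathbb{S}^{2m+1}$) that is horizontal, i.e. whose differential takes values orthogonal to the fibres of the Hopf fibration; it is unique up to multiplication by a unit complex constant. In (c), $J$ is multiplication by $i$ and $\langle,\rangle$ the Euclidean metric on $\mathbb{C}^{n-1}$. *)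

theory Defs
  imports "HOL-Analysis.Analysis"
begin

subsection \<open>Smooth manifolds\<close>

text \<open>A chart is a pair \<open>(U, c)\<close> of its domain and its coordinate map. The model space is a
  Euclidean space \<open>'e\<close>, so the dimension of the manifold is \<open>DIM('e)\<close>. A chart is only
  meaningful on its domain \<open>U\<close>.\<close>

type_synonym ('p, 'e) chart = "'p set \<times> ('p \<Rightarrow> 'e)"

text \<open>Class \<open>C\<^sup>k\<close> and \<open>C\<^sup>\<infinity>\<close>, meant for open \<open>S\<close>.\<close>

fun Ck_on :: "nat \<Rightarrow> 'e::euclidean_space set \<Rightarrow> ('e \<Rightarrow> 'f::euclidean_space) \<Rightarrow> bool" where
  "Ck_on 0 S f \<longleftrightarrow> continuous_on S f"
| "Ck_on (Suc k) S f \<longleftrightarrow> (\<forall>x\<in>S. f differentiable (at x)) \<and>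
     (\<forall>v. Ck_on k S (\<lambda>x. frechet_derivative f (at x) v))"

definition smooth_on :: "'e::euclidean_space set \<Rightarrow> ('e \<Rightarrow> 'f::euclidean_space) \<Rightarrow> bool" where
  "smooth_on S f \<longleftrightarrow> (\<forall>k. Ck_on k S f)"

definition coord_inv :: "('p, 'e) chart \<Rightarrow> 'e \<Rightarrow> 'p" where
  "coord_inv \<kappa> = the_inv_into (fst \<kappa>) (snd \<kappa>)"

definition coord_rep :: "('p, 'e) chart \<Rightarrow> ('q, 'f) chart \<Rightarrow> ('p \<Rightarrow> 'q) \<Rightarrow> 'e \<Rightarrow> 'f" where
  "coord_rep \<kappa> \<mu> F = snd \<mu> \<circ> F \<circ> coord_inv \<kappa>"

text \<open>Hausdorffness and second countability of \<open>N\<close> come from the type class of the points.\<close>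

definition smooth_manifold ::
    "'p::{t2_space,second_countable_topology} set \<Rightarrow> ('p, 'e::euclidean_space) chart set \<Rightarrow> bool" where
  "smooth_manifold N A \<longleftrightarrow>
     \<Union> (fst ` A) = N \<and>
     (\<forall>(U, c)\<in>A. openin (top_of_set N) U \<and> open (c ` U) \<and> (\<exists>c'. homeomorphism U (c ` U) c c')) \<and>
     (\<forall>\<kappa>\<in>A. \<forall>\<mu>\<in>A. smooth_on (snd \<kappa> ` (fst \<kappa> \<inter> fst \<mu>)) (coord_rep \<kappa> \<mu> id))"

definition open_atlas :: "'e set \<Rightarrow> ('e, 'e) chart set" where
  "open_atlas S = {(S, id)}"

definition prod_atlas ::
    "('p, 'e) chart set \<Rightarrow> ('q, 'f) chart set \<Rightarrow> ('p \<times> 'q, 'e \<times> 'f) chart set" where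
  "prod_atlas A B = {(U \<times> V, map_prod c d) | U c V d. (U, c) \<in> A \<and> (V, d) \<in> B}"

text \<open>The openness requirement, over all charts, is the continuity of \<open>F\<close>.\<close>

definition smooth_map ::
    "('p, 'e::euclidean_space) chart set \<Rightarrow> ('q, 'f::euclidean_space) chart set \<Rightarrow> ('p \<Rightarrow> 'q) \<Rightarrow> bool" where
  "smooth_map A B F \<longleftrightarrow>
     (\<forall>x\<in>\<Union> (fst ` A). F x \<in> \<Union> (fst ` B)) \<and>
     (\<forall>\<kappa>\<in>A. \<forall>\<mu>\<in>B. open (snd \<kappa> ` (fst \<kappa> \<inter> F -` fst \<mu>)) \<and>
        smooth_on (snd \<kappa> ` (fst \<kappa> \<inter> F -` fst \<mu>)) (coord_rep \<kappa> \<mu> F))"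

subsection \<open>Riemannian geometry of immersions, in coordinates\<close>

text \<open>A metric on an open set of \<open>'f\<close> is given as \<open>G w u v\<close>, with \<open>w\<close> the base point and
  \<open>u\<close>, \<open>v\<close> tangent vectors. \<open>christoffel G w u v\<close> is the vector with components
  \<open>\<Gamma>\<^sub>i\<^sub>j\<^sup>k u\<^sup>i v\<^sup>j\<close> of the Levi-Civita connection of \<open>G\<close>.\<close>

definition christoffel ::
    "('f::euclidean_space \<Rightarrow> 'f \<Rightarrow> 'f \<Rightarrow> real) \<Rightarrow> 'f \<Rightarrow> 'f \<Rightarrow> 'f \<Rightarrow> 'f" where
  "christoffel G w u v = (THE a. \<forall>z. G w a z =
     (frechet_derivative (\<lambda>y. G y v z) (at w) u
      + frechet_derivative (\<lambda>y. G y u z) (at w) v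
      - frechet_derivative (\<lambda>y. G y u v) (at w) z) / 2)"

definition pullback_metric ::
    "('f::euclidean_space \<Rightarrow> 'f \<Rightarrow> 'f \<Rightarrow> real) \<Rightarrow> ('e::euclidean_space \<Rightarrow> 'f) \<Rightarrow> 'e \<Rightarrow> 'e \<Rightarrow> 'e \<Rightarrow> real" where
  "pullback_metric G f p u v =
     G (f p) (frechet_derivative f (at p) u) (frechet_derivative f (at p) v)"

text \<open>The covariant derivative along \<open>f\<close>, in the direction of the constant field \<open>u\<close>, of the
  image under \<open>df\<close> of the constant field \<open>v\<close>.\<close>

definition cov_hessian ::
    "('f::euclidean_space \<Rightarrow> 'f \<Rightarrow> 'f \<Rightarrow> real) \<Rightarrow> ('e::euclidean_space \<Rightarrow> 'f) \<Rightarrow> 'e \<Rightarrow> 'e \<Rightarrow> 'e \<Rightarrow> 'f" where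
  "cov_hessian G f p u v =
     frechet_derivative (\<lambda>q. frechet_derivative f (at q) v) (at p) u
     + christoffel G (f p) (frechet_derivative f (at p) u) (frechet_derivative f (at p) v)"

definition normal_part ::
    "('f::euclidean_space \<Rightarrow> 'f \<Rightarrow> 'f \<Rightarrow> real) \<Rightarrow> ('e::euclidean_space \<Rightarrow> 'f) \<Rightarrow> 'e \<Rightarrow> 'f \<Rightarrow> 'f" where
  "normal_part G f p a = (THE b.
     (\<exists>t. a = b + frechet_derivative f (at p) t) \<and>
     (\<forall>t. G (f p) b (frechet_derivative f (at p) t) = 0))"

definition second_fundamental_form ::
    "('f::euclidean_space \<Rightarrow> 'f \<Rightarrow> 'f \<Rightarrow> real) \<Rightarrow> ('e::euclidean_space \<Rightarrow> 'f) \<Rightarrow> 'e \<Rightarrow> 'e \<Rightarrow> 'e \<Rightarrow> 'f" where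
  "second_fundamental_form G f p u v = normal_part G f p (cov_hessian G f p u v)"

text \<open>An orthonormal frame for the inner product \<open>g\<close> is indexed by the standard basis.\<close>

definition orthonormal_frame :: "('e::euclidean_space \<Rightarrow> 'e \<Rightarrow> real) \<Rightarrow> ('e \<Rightarrow> 'e) \<Rightarrow> bool" where
  "orthonormal_frame g E \<longleftrightarrow>
     (\<forall>b\<in>Basis. \<forall>b'\<in>Basis. g (E b) (E b') = (if b = b' then 1 else 0))"

definition mean_curvature ::
    "('f::euclidean_space \<Rightarrow> 'f \<Rightarrow> 'f \<Rightarrow> real) \<Rightarrow> ('e::euclidean_space \<Rightarrow> 'f) \<Rightarrow> 'e \<Rightarrow> 'f" where
  "mean_curvature G f p =
     (let E = (SOME E. orthonormal_frame (pullback_metric G f p) E)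
      in (\<Sum>b\<in>Basis. second_fundamental_form G f p (E b) (E b)) /\<^sub>R real DIM('e))"

text \<open>A target space: an atlas and, in each of its charts, the coordinate expressions of the metric
  and of the complex structure (the first argument after the chart is the base point).\<close>

record ('q, 'f) hermitian_manifold =
  charts :: "('q, 'f) chart set"
  metric :: "('q, 'f) chart \<Rightarrow> 'f \<Rightarrow> 'f \<Rightarrow> 'f \<Rightarrow> real"
  cstruct :: "('q, 'f) chart \<Rightarrow> 'f \<Rightarrow> 'f \<Rightarrow> 'f"

definition kahler_form ::
    "('q, 'f) hermitian_manifold \<Rightarrow> ('q, 'f) chart \<Rightarrow> 'f \<Rightarrow> 'f \<Rightarrow> 'f \<Rightarrow> real" where
  "kahler_form K \<mu> w u v = metric K \<mu> w (cstruct K \<mu> w u) v"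

definition immersion ::
    "('p, 'e::euclidean_space) chart set \<Rightarrow> ('q, 'f::euclidean_space) chart set \<Rightarrow> ('p \<Rightarrow> 'q) \<Rightarrow> bool" where
  "immersion A B F \<longleftrightarrow> smooth_map A B F \<and>
     (\<forall>\<kappa>\<in>A. \<forall>\<mu>\<in>B. \<forall>x\<in>fst \<kappa> \<inter> F -` fst \<mu>.
        inj (frechet_derivative (coord_rep \<kappa> \<mu> F) (at (snd \<kappa> x))))"

definition lagrangian_immersion ::
    "('p, 'e::euclidean_space) chart set \<Rightarrow> ('q, 'f::euclidean_space) hermitian_manifold \<Rightarrow> ('p \<Rightarrow> 'q) \<Rightarrow> bool" where
  "lagrangian_immersion A K F \<longleftrightarrow> immersion A (charts K) F \<and> DIM('f) = 2 * DIM('e) \<and>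
     (\<forall>\<kappa>\<in>A. \<forall>\<mu>\<in>charts K. \<forall>x\<in>fst \<kappa> \<inter> F -` fst \<mu>. \<forall>u v.
        kahler_form K \<mu> (snd \<mu> (F x))
          (frechet_derivative (coord_rep \<kappa> \<mu> F) (at (snd \<kappa> x)) u)
          (frechet_derivative (coord_rep \<kappa> \<mu> F) (at (snd \<kappa> x)) v) = 0)"

definition minimal_immersion ::
    "('p, 'e::euclidean_space) chart set \<Rightarrow> ('q, 'f::euclidean_space) hermitian_manifold \<Rightarrow> ('p \<Rightarrow> 'q) \<Rightarrow> bool" where
  "minimal_immersion A K F \<longleftrightarrow> immersion A (charts K) F \<and>
     (\<forall>\<kappa>\<in>A. \<forall>\<mu>\<in>charts K. \<forall>x\<in>fst \<kappa> \<inter> F -` fst \<mu>.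
        mean_curvature (metric K \<mu>) (coord_rep \<kappa> \<mu> F) (snd \<kappa> x) = 0)"

definition minimal_lagrangian_immersion ::
    "('p, 'e::euclidean_space) chart set \<Rightarrow> ('q, 'f::euclidean_space) hermitian_manifold \<Rightarrow> ('p \<Rightarrow> 'q) \<Rightarrow> bool" where
  "minimal_lagrangian_immersion A K F \<longleftrightarrow> lagrangian_immersion A K F \<and> minimal_immersion A K F"

subsection \<open>Complex Euclidean, projective and hyperbolic space\<close>

definition complex_euclidean :: "(complex^'m, complex^'m) hermitian_manifold" where
  "complex_euclidean = \<lparr>charts = open_atlas UNIV, metric = (\<lambda>_ _. inner), cstruct = (\<lambda>_ _ u. \<i> *s u)\<rparr>"

text \<open>\<open>\<complex>\<^sup>m\<^sup>+\<^sup>1\<close> is \<open>complex^('m option)\<close> with \<open>CARD('m) = m\<close>; the coordinate \<open>None\<close> is the last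
  one, carrying the minus sign of the Lorentzian form.\<close>

definition herm_pos :: "complex^'k \<Rightarrow> complex^'k \<Rightarrow> complex" where
  "herm_pos z w = (\<Sum>i\<in>UNIV. z $ i * cnj (w $ i))"

definition herm_lor :: "complex^('m::finite option) \<Rightarrow> complex^('m option) \<Rightarrow> complex" where
  "herm_lor z w = (\<Sum>i\<in>UNIV. z $ Some i * cnj (w $ Some i)) - z $ None * cnj (w $ None)"

definition unit_sphere :: "(complex^'k) set" where
  "unit_sphere = {z. herm_pos z z = 1}"

definition anti_de_sitter :: "(complex^('m::finite option)) set" where
  "anti_de_sitter = {z. herm_lor z z = -1}"

text \<open>\<open>hopf z\<close> is the point \<open>[z]\<close>, the orbit of \<open>z\<close> under the circle action.\<close>

definition hopf :: "complex^'k \<Rightarrow> (complex^'k) set" where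
  "hopf z = {a *s z | a. norm a = 1}"

text \<open>Homogeneous coordinates divided by the one with index \<open>\<sigma> None\<close>; \<open>\<sigma>\<close> is a permutation of
  the indices.\<close>

definition affine_coord ::
    "('m::finite option \<Rightarrow> 'm option) \<Rightarrow> (complex^('m option)) set \<Rightarrow> complex^'m" where
  "affine_coord \<sigma> p = (let z = (SOME z. z \<in> p) in \<chi> i. z $ \<sigma> (Some i) / z $ \<sigma> None)"

definition affine_chart ::
    "(complex^('m::finite option)) set \<Rightarrow> ('m option \<Rightarrow> 'm option) \<Rightarrow>
     ((complex^('m option)) set, complex^'m) chart" where
  "affine_chart Q \<sigma> = (hopf ` {z\<in>Q. z $ \<sigma> None \<noteq> 0}, affine_coord \<sigma>)"

text \<open>For \<open>Q\<close> one of the two quadrics, with hermitian form \<open>h\<close>: the vectors tangent to \<open>Q\<close> at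
  \<open>z\<close> and orthogonal to the fibre of the Hopf projection, whose tangent space at \<open>z\<close> is spanned
  by \<open>\<i> z\<close>.\<close>

definition horizontal ::
    "(complex^'k \<Rightarrow> complex^'k \<Rightarrow> complex) \<Rightarrow> complex^'k \<Rightarrow> complex^'k \<Rightarrow> bool" where
  "horizontal h z X \<longleftrightarrow> Re (h X z) = 0 \<and> Re (h X (\<i> *s z)) = 0"

text \<open>The differential of the Hopf projection in the chart \<open>\<mu>\<close>. The formula \<open>hopf z\<close> makes sense
  off the quadric as well, so \<open>snd \<mu> \<circ> hopf\<close> is differentiated as a map on an open subset of
  the ambient space; it is applied to tangent vectors of the quadric only.\<close>

definition d_hopf ::
    "((complex^'k) set, complex^'m) chart \<Rightarrow> complex^'k \<Rightarrow> complex^'k \<Rightarrow> complex^'m" where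
  "d_hopf \<mu> z X = frechet_derivative (snd \<mu> \<circ> hopf) (at z) X"

text \<open>The metric and complex structure on the quotient: the differential of the Hopf projection
  is isometric and complex linear on horizontal vectors.\<close>

definition quotient_metric ::
    "(complex^'k) set \<Rightarrow> (complex^'k \<Rightarrow> complex^'k \<Rightarrow> complex) \<Rightarrow>
     ((complex^'k) set, complex^'m) chart \<Rightarrow> complex^'m \<Rightarrow> complex^'m \<Rightarrow> complex^'m \<Rightarrow> real" where
  "quotient_metric Q h \<mu> w u v = (THE r. \<forall>z X Y.
     z \<in> Q \<and> hopf z \<in> fst \<mu> \<and> snd \<mu> (hopf z) = w \<and> horizontal h z X \<and> horizontal h z Y \<and>
     d_hopf \<mu> z X = u \<and> d_hopf \<mu> z Y = v \<longrightarrow> r = Re (h X Y))"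

definition quotient_cstruct ::
    "(complex^'k) set \<Rightarrow> (complex^'k \<Rightarrow> complex^'k \<Rightarrow> complex) \<Rightarrow>
     ((complex^'k) set, complex^'m) chart \<Rightarrow> complex^'m \<Rightarrow> complex^'m \<Rightarrow> complex^'m" where
  "quotient_cstruct Q h \<mu> w u = (THE u'. \<forall>z X.
     z \<in> Q \<and> hopf z \<in> fst \<mu> \<and> snd \<mu> (hopf z) = w \<and> horizontal h z X \<and>
     d_hopf \<mu> z X = u \<longrightarrow> u' = d_hopf \<mu> z (\<i> *s X))"

lemma affine_coord_hopf: "affine_coord \<sigma> (hopf z) = (\<chi> i. z $ \<sigma> (Some i) / z $ \<sigma> None)"
proof -
  have "1 *s z \<in> hopf z" unfolding hopf_def by (auto intro!: exI[of _ 1])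
  hence "(SOME y. y \<in> hopf z) \<in> hopf z" by (rule someI)
  then obtain a where a: "(SOME y. y \<in> hopf z) = a *s z" "norm a = 1" unfolding hopf_def by blast
  from a(2) have "a \<noteq> 0" by auto
  thus ?thesis unfolding affine_coord_def Let_def a(1) by (auto simp: vec_eq_iff)
qed

lemma d_hopf_affine_chart:
  fixes \<sigma> :: "'a::finite option \<Rightarrow> 'a option"
  assumes "z $ \<sigma> None \<noteq> 0"
  shows "d_hopf (affine_chart Q \<sigma>) z X =
    (\<chi> i. X $ \<sigma> (Some i) / z $ \<sigma> None - z $ \<sigma> (Some i) * X $ \<sigma> None / (z $ \<sigma> None)\<^sup>2)"
proof -
  have e: "snd (affine_chart Q \<sigma>) \<circ> hopf = (\<lambda>z. \<chi> i. z $ \<sigma> (Some i) / z $ \<sigma> None)"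
    by (simp add: affine_chart_def fun_eq_iff affine_coord_hopf)
  have c: "((\<lambda>z. z $ \<sigma> (Some i) / z $ \<sigma> None) has_derivative
     (\<lambda>X. X $ \<sigma> (Some i) / z $ \<sigma> None - z $ \<sigma> (Some i) * X $ \<sigma> None / (z $ \<sigma> None)\<^sup>2)) (at z)" for i
  proof -
    have n: "((\<lambda>z. z $ k) has_derivative (\<lambda>X. X $ k)) (at z)" for k
      by (rule bounded_linear_imp_has_derivative[OF bounded_linear_vec_nth])
    show ?thesis
      by (rule has_derivative_eq_rhs[OF has_derivative_divide'[OF n n assms]])
         (use assms in \<open>simp add: fun_eq_iff field_simps power2_eq_square\<close>)
  qed
  have "((\<lambda>z. \<chi> i. z $ \<sigma> (Some i) / z $ \<sigma> None) has_derivative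
     (\<lambda>X. \<chi> i. X $ \<sigma> (Some i) / z $ \<sigma> None - z $ \<sigma> (Some i) * X $ \<sigma> None / (z $ \<sigma> None)\<^sup>2)) (at z)"
  proof (subst has_derivative_componentwise_within, intro ballI)
    fix b :: "complex^'a"
    assume "b \<in> Basis"
    then obtain i u where b: "b = axis i u" by (auto simp: Basis_vec_def)
    show "((\<lambda>x. (\<chi> i. x $ \<sigma> (Some i) / x $ \<sigma> None) \<bullet> b) has_derivative
      (\<lambda>x. (\<chi> i. x $ \<sigma> (Some i) / z $ \<sigma> None - z $ \<sigma> (Some i) * x $ \<sigma> None / (z $ \<sigma> None)\<^sup>2) \<bullet> b)) (at z)"
      unfolding b inner_axis vec_lambda_beta by (rule has_derivative_inner_left[OF c])
  qed
  from frechet_derivative_at[OF this] show ?thesis unfolding d_hopf_def e by (rule fun_cong[OF sym])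
qed

lemma quotient_rule_aux:
  fixes a p :: complex
  assumes "x / p - w * y / p\<^sup>2 = x' / (a * p) - a * w * y' / (a * p)\<^sup>2" "p \<noteq> 0" "a \<noteq> 0"
  shows "x' - a * x = (y' - a * y) / p * w"
proof -
  have "a * p * (x / p - w * y / p\<^sup>2) = a * x - a * w * y / p"
    using assms by (simp add: field_simps power2_eq_square)
  moreover have "a * p * (x' / (a * p) - a * w * y' / (a * p)\<^sup>2) = x' - w * y' / p"
    using assms by (simp add: field_simps power2_eq_square)
  ultimately have "a * x - a * w * y / p = x' - w * y' / p" using assms(1) by simp
  thus ?thesis using assms(2) by (simp add: diff_divide_distrib left_diff_distrib) (simp add: algebra_simps)
qed

lemma quotient_lifts:
  fixes h :: "complex^('m::finite option) \<Rightarrow> complex^('m option) \<Rightarrow> complex"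
  assumes h: "\<And>x y w. h (x - y) w = h x w - h y w" "\<And>a x w. h (a *s x) w = a * h x w"
      "\<And>a x w. h x (a *s w) = cnj a * h x w"
    and Q: "Q = {z. h z z = e}" "e \<noteq> 0" and s: "bij \<sigma>"
    and z: "z \<in> Q" "hopf z \<in> fst (affine_chart Q \<sigma>)"
    and z': "z' \<in> Q" "hopf z' \<in> fst (affine_chart Q \<sigma>)"
    and eq: "snd (affine_chart Q \<sigma>) (hopf z) = snd (affine_chart Q \<sigma>) (hopf z')"
  shows "\<exists>a. norm a = 1 \<and> z' = a *s z \<and> z $ \<sigma> None \<noteq> 0 \<and>
     (\<forall>X X'. horizontal h z X \<longrightarrow> horizontal h z' X' \<longrightarrow>
        d_hopf (affine_chart Q \<sigma>) z X = d_hopf (affine_chart Q \<sigma>) z' X' \<longrightarrow> X' = a *s X)"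
proof -
  have nz: "y $ \<sigma> None \<noteq> 0" if y: "hopf y \<in> fst (affine_chart Q \<sigma>)" for y
  proof -
    from y obtain u where u: "hopf y = hopf u" "u $ \<sigma> None \<noteq> 0" unfolding affine_chart_def by auto
    have "1 *s u \<in> hopf u" unfolding hopf_def by (auto intro!: exI[of _ 1])
    hence "u \<in> hopf y" using u by simp
    then obtain a where "u = a *s y" unfolding hopf_def by auto
    thus ?thesis using u by auto
  qed
  note nz1 = nz[OF z(2)] and nz2 = nz[OF z'(2)]
  define a where "a = z' $ \<sigma> None / z $ \<sigma> None"
  have all: "(\<forall>j. P j) \<longleftrightarrow> P (\<sigma> None) \<and> (\<forall>i. P (\<sigma> (Some i)))" for P
    using s by (metis bij_pointE not_None_eq)
  have za: "z' = a *s z"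
    unfolding vec_eq_iff
    apply (subst all)
    using eq nz1 nz2 by (auto simp: affine_chart_def affine_coord_hopf vec_eq_iff a_def field_simps)
  have "e = a * cnj a * e" using z(1) z'(1) h za Q(1) by (auto simp: mult.commute)
  hence "a * cnj a = 1" using Q(2) by simp
  hence na: "norm a = 1"
    by (metis complex_mod_mult_cnj norm_one real_sqrt_abs real_sqrt_one abs_norm_cancel)
  have "X' = a *s X" if H: "horizontal h z X" "horizontal h z' X'"
    and d: "d_hopf (affine_chart Q \<sigma>) z X = d_hopf (affine_chart Q \<sigma>) z' X'" for X X'
  proof -
    have i1: "h X z = 0" using H(1) unfolding horizontal_def h(3) by (auto simp: complex_eq_iff)
    have i2: "h X' z' = 0" using H(2) unfolding horizontal_def h(3) by (auto simp: complex_eq_iff)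
    have a0: "a \<noteq> 0" using na by auto
    define Y where "Y = X' - a *s X"
    define b where "b = Y $ \<sigma> None / z $ \<sigma> None"
    have hY: "h Y z = 0" using i1 i2 a0 unfolding Y_def h za by simp
    have "Y = b *s z"
      unfolding vec_eq_iff
    proof (subst all, intro conjI allI)
      show "Y $ \<sigma> None = (b *s z) $ \<sigma> None" using nz1 by (simp add: b_def)
      fix i
      have "X $ \<sigma> (Some i) / z $ \<sigma> None - z $ \<sigma> (Some i) * X $ \<sigma> None / (z $ \<sigma> None)\<^sup>2 =
         X' $ \<sigma> (Some i) / z' $ \<sigma> None - z' $ \<sigma> (Some i) * X' $ \<sigma> None / (z' $ \<sigma> None)\<^sup>2"
        using d unfolding d_hopf_affine_chart[of z \<sigma> Q, OF nz1] d_hopf_affine_chart[of z' \<sigma> Q, OF nz2]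
        by (auto simp: vec_eq_iff)
      from quotient_rule_aux[OF this[unfolded za vector_smult_component] nz1 a0]
      show "Y $ \<sigma> (Some i) = (b *s z) $ \<sigma> (Some i)" unfolding Y_def b_def by simp
    qed
    hence "b = 0" using hY z(1) Q h by auto
    thus ?thesis using \<open>Y = b *s z\<close> Y_def by simp
  qed
  thus ?thesis using na za nz1 by blast
qed

text \<open>The two definite descriptions are well defined: the Hopf projection is isometric and
  complex linear on horizontal vectors.\<close>

lemma quotient_metric_d_hopf:
  fixes h :: "complex^('m::finite option) \<Rightarrow> complex^('m option) \<Rightarrow> complex"
  assumes h: "\<And>x y w. h (x - y) w = h x w - h y w" "\<And>a x w. h (a *s x) w = a * h x w"
      "\<And>a x w. h x (a *s w) = cnj a * h x w"
    and Q: "Q = {z. h z z = e}" "e \<noteq> 0" and s: "bij \<sigma>"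
    and z: "z \<in> Q" "hopf z \<in> fst (affine_chart Q \<sigma>)" and H: "horizontal h z X" "horizontal h z Y"
  defines "\<mu> \<equiv> affine_chart Q \<sigma>"
  shows "quotient_metric Q h \<mu> (snd \<mu> (hopf z)) (d_hopf \<mu> z X) (d_hopf \<mu> z Y) = Re (h X Y)"
    and "quotient_cstruct Q h \<mu> (snd \<mu> (hopf z)) (d_hopf \<mu> z X) = d_hopf \<mu> z (\<i> *s X)"
proof -
  have key: "\<exists>a. norm a = 1 \<and> z' = a *s z \<and> z $ \<sigma> None \<noteq> 0 \<and>
     (\<forall>X X'. horizontal h z X \<longrightarrow> horizontal h z' X' \<longrightarrow> d_hopf \<mu> z X = d_hopf \<mu> z' X' \<longrightarrow> X' = a *s X)"
    if "z' \<in> Q" "hopf z' \<in> fst \<mu>" "snd \<mu> (hopf z') = snd \<mu> (hopf z)" for z'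
    unfolding \<mu>_def
    by (rule quotient_lifts[OF h Q s z]) (use that in \<open>auto simp: \<mu>_def\<close>)
  show "quotient_metric Q h \<mu> (snd \<mu> (hopf z)) (d_hopf \<mu> z X) (d_hopf \<mu> z Y) = Re (h X Y)"
    unfolding quotient_metric_def
  proof (rule the_equality)
    show "\<forall>z' X' Y'. z' \<in> Q \<and> hopf z' \<in> fst \<mu> \<and> snd \<mu> (hopf z') = snd \<mu> (hopf z) \<and>
       horizontal h z' X' \<and> horizontal h z' Y' \<and>
       d_hopf \<mu> z' X' = d_hopf \<mu> z X \<and> d_hopf \<mu> z' Y' = d_hopf \<mu> z Y \<longrightarrow> Re (h X Y) = Re (h X' Y')"
    proof (intro allI impI, elim conjE)
      fix z' X' Y'
      assume A: "z' \<in> Q" "hopf z' \<in> fst \<mu>" "snd \<mu> (hopf z') = snd \<mu> (hopf z)"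
        "horizontal h z' X'" "horizontal h z' Y'"
        "d_hopf \<mu> z' X' = d_hopf \<mu> z X" "d_hopf \<mu> z' Y' = d_hopf \<mu> z Y"
      obtain a where "norm a = 1" "X' = a *s X" "Y' = a *s Y"
        using key[OF A(1-3)] A H by metis
      moreover have "cnj a * a = 1" using \<open>norm a = 1\<close>
        by (metis complex_norm_square mult.commute of_real_1 one_power2)
      ultimately show "Re (h X Y) = Re (h X' Y')" by (simp add: h mult.assoc[symmetric])
    qed
  next
    fix r assume "\<forall>z' X' Y'. z' \<in> Q \<and> hopf z' \<in> fst \<mu> \<and> snd \<mu> (hopf z') = snd \<mu> (hopf z) \<and>
       horizontal h z' X' \<and> horizontal h z' Y' \<and>
       d_hopf \<mu> z' X' = d_hopf \<mu> z X \<and> d_hopf \<mu> z' Y' = d_hopf \<mu> z Y \<longrightarrow> r = Re (h X' Y')"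
    thus "r = Re (h X Y)" using z H unfolding \<mu>_def by blast
  qed
  show "quotient_cstruct Q h \<mu> (snd \<mu> (hopf z)) (d_hopf \<mu> z X) = d_hopf \<mu> z (\<i> *s X)"
    unfolding quotient_cstruct_def
  proof (rule the_equality)
    show "\<forall>z' X'. z' \<in> Q \<and> hopf z' \<in> fst \<mu> \<and> snd \<mu> (hopf z') = snd \<mu> (hopf z) \<and>
       horizontal h z' X' \<and> d_hopf \<mu> z' X' = d_hopf \<mu> z X \<longrightarrow>
       d_hopf \<mu> z (\<i> *s X) = d_hopf \<mu> z' (\<i> *s X')"
    proof (intro allI impI, elim conjE)
      fix z' X'
      assume A: "z' \<in> Q" "hopf z' \<in> fst \<mu>" "snd \<mu> (hopf z') = snd \<mu> (hopf z)"
        "horizontal h z' X'" "d_hopf \<mu> z' X' = d_hopf \<mu> z X"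
      obtain a where a: "norm a = 1" "z' = a *s z" "X' = a *s X" "z $ \<sigma> None \<noteq> 0"
        using key[OF A(1-3)] A H by metis
      hence "a \<noteq> 0" by auto
      thus "d_hopf \<mu> z (\<i> *s X) = d_hopf \<mu> z' (\<i> *s X')" using a(4) unfolding a(2,3) \<mu>_def
        by (simp add: d_hopf_affine_chart vec_eq_iff field_simps power2_eq_square)
    qed
  next
    fix r assume "\<forall>z' X'. z' \<in> Q \<and> hopf z' \<in> fst \<mu> \<and> snd \<mu> (hopf z') = snd \<mu> (hopf z) \<and>
       horizontal h z' X' \<and> d_hopf \<mu> z' X' = d_hopf \<mu> z X \<longrightarrow> r = d_hopf \<mu> z' (\<i> *s X')"
    thus "r = d_hopf \<mu> z (\<i> *s X)" using z H unfolding \<mu>_def by blast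
  qed
qed

definition complex_projective :: "((complex^('m::finite option)) set, complex^'m) hermitian_manifold" where
  "complex_projective =
     \<lparr>charts = {affine_chart unit_sphere \<sigma> | \<sigma>. bij \<sigma>},
      metric = quotient_metric unit_sphere herm_pos,
      cstruct = quotient_cstruct unit_sphere herm_pos\<rparr>"

text \<open>The last coordinate never vanishes on \<open>anti_de_sitter\<close>, so a single chart suffices.\<close>

definition complex_hyperbolic :: "((complex^('m::finite option)) set, complex^'m) hermitian_manifold" where
  "complex_hyperbolic =
     \<lparr>charts = {affine_chart anti_de_sitter id},
      metric = quotient_metric anti_de_sitter herm_lor,
      cstruct = quotient_cstruct anti_de_sitter herm_lor\<rparr>"

definition horizontal_lift ::
    "('p, 'e::euclidean_space) chart set \<Rightarrow> (complex^'k) set \<Rightarrow>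
     (complex^'k \<Rightarrow> complex^'k \<Rightarrow> complex) \<Rightarrow> ('p \<Rightarrow> (complex^'k) set) \<Rightarrow> ('p \<Rightarrow> complex^'k) \<Rightarrow> bool" where
  "horizontal_lift A Q h F G \<longleftrightarrow>
     smooth_map A (open_atlas UNIV) G \<and>
     (\<forall>x\<in>\<Union> (fst ` A). G x \<in> Q \<and> hopf (G x) = F x) \<and>
     (\<forall>\<kappa>\<in>A. \<forall>x\<in>fst \<kappa>. \<forall>v.
        horizontal h (G x) (frechet_derivative (G \<circ> coord_inv \<kappa>) (at (snd \<kappa> x)) v))"

subsection \<open>Assembling coordinate vectors\<close>

text \<open>\<open>append_coord z a\<close> is \<open>(z, a)\<close>. \<open>cons_coord a z\<close> is \<open>(a, z)\<close>, where the last coordinate of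
  \<open>z\<close> stays the last one: the new coordinate gets the index \<open>Some None\<close> (the index types are
  unordered, so its position among the coordinates other than the last one is only a label).\<close>

definition append_coord :: "complex^('k::finite) \<Rightarrow> complex \<Rightarrow> complex^('k option)" where
  "append_coord z a = (\<chi> j. case j of None \<Rightarrow> a | Some i \<Rightarrow> z $ i)"

definition cons_coord :: "complex \<Rightarrow> complex^('m::finite option) \<Rightarrow> complex^('m option option)" where
  "cons_coord a z = (\<chi> j. case j of
     None \<Rightarrow> z $ None
   | Some None \<Rightarrow> a
   | Some (Some i) \<Rightarrow> z $ Some i)"

end

theory Submission
  imports Defs
begin

text \<open>
  Minimality can be read off a horizontal lift \<open>g\<close> to the quadric: the covariant Hessian of the
  projected map is the projection of the ordinary second derivative of \<open>g\<close>, and the normal bundle of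
  a Lagrangian immersion is \<open>J\<close> applied to the tangent bundle. So the mean curvature vanishes iff the
  trace of the cubic form \<open>Im h(D\<^sup>2g(u,v), Dg(t))\<close> over the first two arguments does.
  In all three cases the map has the horizontal lift \<open>l(s) \<Theta>(x) + c(s)\<close> with \<open>l'' = l\<close> and
  \<open>c'' = c\<close>. The second derivative in the direction of \<open>s\<close> is the lift itself, which is
  \<open>h\<close>-orthogonal to its tangent vectors, so that this direction contributes nothing; the other
  directions contribute a multiple of the trace of the cubic form of \<open>\<Theta>\<close>, which is that of
  the given immersion of \<open>N\<close>.
\<close>

subsection \<open>Calculus of \<open>C\<^sup>k\<close> maps\<close>

text \<open>The definitions are coordinate expressions built from \<open>THE\<close> and
  \<open>SOME\<close>: Christoffel symbols, normal part, frame, and the quotient metric itself. A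
  lift says nothing about them until they are evaluated. The one explicit computation needed is the
  Fubini-Study connection in an affine chart; its Christoffel terms are exactly the corrections that
  arise when second derivatives of quotients of coordinates are expressed through the lift. The
  equations \<open>l'' = l\<close> and \<open>c'' = c\<close> are the geodesic equation: for fixed
  \<open>x\<close> the lift is a unit-speed horizontal geodesic of anti-de Sitter space. The cases
  differ in the fixed vector to which the directions of \<open>N\<close> are orthogonal: timelike in
  (a), spacelike in (b), null in (c). In (c) the form degenerates along that vector, and
  \<open>f\<close> is the component along it that horizontality forces on the lift.\<close>

lemma Ck_on_cong:
  assumes "open S" "\<And>x. x \<in> S \<Longrightarrow> f x = g x" "Ck_on k S f"
  shows "Ck_on k S g"
  using assms(2,3)
proof (induction k arbitrary: f g)
  case 0
  then show ?case using continuous_on_cong[of S S f g] by simp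
next
  case (Suc k)
  have dif: "f differentiable (at x)" if "x \<in> S" for x using Suc.prems that by simp
  have eq: "frechet_derivative f (at x) = frechet_derivative g (at x)" if "x \<in> S" for x
    by (rule frechet_derivative_transform_within_open[OF dif[OF that] \<open>open S\<close> that]) (use Suc.prems in auto)
  have "g differentiable (at x)" if "x \<in> S" for x
    using has_derivative_transform_within_open[OF _ \<open>open S\<close> that, of f _ UNIV g] dif[OF that] Suc.prems
    unfolding differentiable_def by auto
  moreover have "Ck_on k S (\<lambda>x. frechet_derivative g (at x) v)" for v
    by (rule Suc.IH[of "\<lambda>x. frechet_derivative f (at x) v"]) (use Suc.prems eq in auto)
  ultimately show ?case by simp
qed

text \<open>\<open>frechet_derivative\<close> is a choice, whereas the calculus rules deliver
  explicit derivatives. This lets any explicit \<open>f'\<close> stand in for it; every closure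
  property below goes through here.\<close>

lemma Ck_on_SucI:
  assumes "open S"
    and d: "\<And>x. x \<in> S \<Longrightarrow> (f has_derivative f' x) (at x)"
    and c: "\<And>v. Ck_on k S (\<lambda>x. f' x v)"
  shows "Ck_on (Suc k) S f"
proof -
  have "f differentiable (at x)" if "x \<in> S" for x
    using d[OF that] unfolding differentiable_def by blast
  moreover have "Ck_on k S (\<lambda>x. frechet_derivative f (at x) v)" for v
    by (rule Ck_on_cong[OF assms(1) _ c[of v]]) (metis d frechet_derivative_at)
  ultimately show ?thesis by simp
qed

lemma Ck_on_SucD:
  assumes "Ck_on (Suc k) S f"
  shows "\<And>x. x \<in> S \<Longrightarrow> (f has_derivative frechet_derivative f (at x)) (at x)"
    and "\<And>v. Ck_on k S (\<lambda>x. frechet_derivative f (at x) v)"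
  using assms by (auto simp: frechet_derivative_works)

lemma Ck_on_lower: "Ck_on (Suc k) S f \<Longrightarrow> Ck_on k S f"
proof (induction k arbitrary: f)
  case 0
  then show ?case
    by (auto intro!: differentiable_imp_continuous_on simp: differentiable_on_def differentiable_at_withinI)
next
  case (Suc k)
  have "Ck_on k S (\<lambda>x. frechet_derivative f (at x) v)" for v
    by (rule Suc.IH) (use Suc.prems in simp)
  then show ?case using Suc.prems by simp
qed

lemma Ck_on_add:
  assumes "open S" "Ck_on k S f" "Ck_on k S g"
  shows "Ck_on k S (\<lambda>x. f x + g x)"
  using assms(2,3)
proof (induction k arbitrary: f g)
  case 0
  then show ?case by (simp add: continuous_on_add)
next
  case (Suc k)
  show ?case
    by (rule Ck_on_SucI[OF assms(1) has_derivative_add[OF Ck_on_SucD(1)[OF Suc.prems(1)] Ck_on_SucD(1)[OF Suc.prems(2)]]])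
      (assumption | rule Suc.IH[OF Ck_on_SucD(2)[OF Suc.prems(1)] Ck_on_SucD(2)[OF Suc.prems(2)]])+
qed

text \<open>One product rule for real and complex scalar multiplication and for Hermitian forms.
  Each term of the derivative pairs a derivative with an undifferentiated factor, and
  \<open>Ck_on_lower\<close> brings that factor down to the order of the induction
  hypothesis.\<close>

lemma Ck_on_bilinear:
  assumes "bounded_bilinear pr" "open S" "Ck_on k S f" "Ck_on k S g"
  shows "Ck_on k S (\<lambda>x. pr (f x) (g x))"
  using assms(3,4)
proof (induction k arbitrary: f g)
  case 0
  then show ?case using bounded_bilinear.continuous_on[OF assms(1)] by simp
next
  case (Suc k)
  note f = Ck_on_SucD[OF Suc.prems(1)] Ck_on_lower[OF Suc.prems(1)]
  note g = Ck_on_SucD[OF Suc.prems(2)] Ck_on_lower[OF Suc.prems(2)]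
  show ?case
    by (rule Ck_on_SucI[OF assms(2) bounded_bilinear.FDERIV[OF assms(1) f(1) g(1)]])
      (assumption | rule Ck_on_add[OF assms(2) Suc.IH[OF f(3) g(2)] Suc.IH[OF f(2) g(3)]])+
qed

lemma Ck_on_linear_compose:
  assumes "bounded_linear L" "open S" "Ck_on k S f"
  shows "Ck_on k S (\<lambda>x. L (f x))"
  using assms(3)
proof (induction k arbitrary: f)
  case 0
  then show ?case using bounded_linear.continuous_on[OF assms(1)] by simp
next
  case (Suc k)
  note f = Ck_on_SucD[OF Suc.prems(1)]
  show ?case
    by (rule Ck_on_SucI[OF assms(2) bounded_linear.has_derivative[OF assms(1) f(1)]])
      (assumption | rule Suc.IH[OF f(2)])+
qed

text \<open>Precomposition occurs only with inclusions of open subsets and projections of a product.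
  These are linear, so the inner map contributes only the constant vector \<open>L v\<close> to the
  derivative and no higher chain rule is involved.\<close>

lemma Ck_on_compose_linear:
  assumes "bounded_linear L" "open S" "L ` S \<subseteq> T" "Ck_on k T f"
  shows "Ck_on k S (\<lambda>x. f (L x))"
  using assms(4)
proof (induction k arbitrary: f)
  case 0
  have "continuous_on S L" using assms(1) by (simp add: linear_continuous_on)
  then show ?case using 0 continuous_on_compose2[of T f S L] assms(3) by simp
next
  case (Suc k)
  note f = Ck_on_SucD[OF Suc.prems(1)]
  have "((\<lambda>x. f (L x)) has_derivative (\<lambda>v. frechet_derivative f (at (L x)) (L v))) (at x)" if "x \<in> S" for x
    by (rule has_derivative_compose[OF bounded_linear_imp_has_derivative[OF assms(1)] f(1)])
      (use that assms(3) in auto)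
  then show ?case
    by (rule Ck_on_SucI[OF assms(2)]) (assumption | rule Suc.IH[OF f(2)])+
qed

lemma Ck_on_inverse:
  fixes f :: "'e::euclidean_space \<Rightarrow> complex"
  assumes "open S" "Ck_on k S f" "\<And>x. x \<in> S \<Longrightarrow> f x \<noteq> 0"
  shows "Ck_on k S (\<lambda>x. inverse (f x))"
  using assms(2)
proof (induction k)
  case 0
  then show ?case using assms(3) by (auto intro!: continuous_on_inverse)
next
  case (Suc k)
  note f = Ck_on_SucD[OF Suc.prems(1)] Ck_on_lower[OF Suc.prems(1)]
  have c: "Ck_on k S (\<lambda>x. - (inverse (f x) * frechet_derivative f (at x) v * inverse (f x)))" for v
    by (rule Ck_on_linear_compose[OF bounded_linear_minus[OF bounded_linear_ident] assms(1)
          Ck_on_bilinear[OF bounded_bilinear_mult assms(1)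
            Ck_on_bilinear[OF bounded_bilinear_mult assms(1) Suc.IH[OF f(3)] f(2)] Suc.IH[OF f(3)]]])
  show ?case
    by (rule Ck_on_SucI[OF assms(1) Deriv.has_derivative_inverse[OF assms(3) f(1)]])
      (assumption | rule c)+
qed

lemma Ck_on_exp: "Ck_on k UNIV (exp :: real \<Rightarrow> real)"
proof (induction k)
  case 0
  then show ?case by (simp add: continuous_on_exp)
next
  case (Suc k)
  show ?case
  proof (rule Ck_on_SucI)
    show "(exp has_derivative (\<lambda>v. v * exp x)) (at x)" for x :: real
      by (auto intro!: derivative_eq_intros)
    show "Ck_on k UNIV (\<lambda>x::real. v * exp x)" for v
      by (rule Ck_on_linear_compose[OF bounded_linear_mult_right _ Suc.IH]) simp
  qed simp
qed

text \<open>Each function is the derivative of the other, so the two inductions have to run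
  together.\<close>

lemma Ck_on_sinh_cosh: "Ck_on k UNIV (sinh :: real \<Rightarrow> real) \<and> Ck_on k UNIV (cosh :: real \<Rightarrow> real)"
proof (induction k)
  case 0
  then show ?case by (simp add: continuous_on_sinh continuous_on_cosh)
next
  case (Suc k)
  have d: "(sinh has_derivative (\<lambda>v. v * cosh x)) (at x)" "(cosh has_derivative (\<lambda>v. v * sinh x)) (at x)" for x :: real
    by (auto intro!: derivative_eq_intros)
  have c: "Ck_on k UNIV (\<lambda>x::real. v * sinh x)" "Ck_on k UNIV (\<lambda>x::real. v * cosh x)" for v
    using Suc by (blast intro: Ck_on_linear_compose[OF bounded_linear_mult_right open_UNIV])+
  show ?case
    by (intro conjI; rule Ck_on_SucI[OF open_UNIV]; rule d c)
qed

section \<open>Second derivatives of smooth maps\<close>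

lemma
  assumes "smooth_on W F" "q \<in> W"
  shows smooth_on_has_derivative: "(F has_derivative frechet_derivative F (at q)) (at q)"
    and smooth_on_has_derivative2: "((\<lambda>p. frechet_derivative F (at p) v) has_derivative
      (\<lambda>u. frechet_derivative (\<lambda>p. frechet_derivative F (at p) v) (at q) u)) (at q)"
proof -
  have "Ck_on (Suc (Suc 0)) W F" using assms(1) unfolding smooth_on_def by blast
  note F = Ck_on_SucD[OF this]
  show "(F has_derivative frechet_derivative F (at q)) (at q)" using F(1) assms(2) .
  show "((\<lambda>p. frechet_derivative F (at p) v) has_derivative
      (\<lambda>u. frechet_derivative (\<lambda>p. frechet_derivative F (at p) v) (at q) u)) (at q)"
    using Ck_on_SucD(1)[OF F(2) assms(2)] .
qed

text \<open>Linearity in \<open>u\<close> is that of a derivative. The vector \<open>v\<close> sits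
  inside the function being differentiated, so linearity in \<open>v\<close> comes from linearity of
  the first derivative at all points near \<open>q\<close>. Bilinearity is what makes traces
  independent of the frame.\<close>

lemma smooth_on_bilinear_second_derivative:
  fixes F :: "'e::euclidean_space \<Rightarrow> 'f::euclidean_space"
  assumes W: "open W" "smooth_on W F" "q \<in> W"
  shows "bilinear (\<lambda>u v. frechet_derivative (\<lambda>p. frechet_derivative F (at p) v) (at q) u)"
proof -
  let ?D = "\<lambda>q. frechet_derivative F (at q)"
  let ?DD = "\<lambda>u v. frechet_derivative (\<lambda>p. ?D p v) (at q) u"
  note d = smooth_on_has_derivative[OF W(2)]
  note dd = smooth_on_has_derivative2[OF W(2,3)]
  have "linear (\<lambda>u. ?DD u v)" for v using has_derivative_linear[OF dd] .
  moreover have "linear (\<lambda>v. ?DD u v)" for u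
  proof (rule linearI)
    fix v w c
    have "((\<lambda>p. ?D p (v + w)) has_derivative (\<lambda>u. ?DD u v + ?DD u w)) (at q)"
      by (rule has_derivative_transform_within_open[OF has_derivative_add[OF dd dd] W(1,3)])
        (simp add: linear_add[OF has_derivative_linear[OF d]])
    then show "?DD u (v + w) = ?DD u v + ?DD u w" by (rule fun_cong[OF has_derivative_unique[OF dd]])
    have "((\<lambda>p. ?D p (c *\<^sub>R v)) has_derivative (\<lambda>u. c *\<^sub>R ?DD u v)) (at q)"
      by (rule has_derivative_transform_within_open[OF has_derivative_scaleR_right[OF dd] W(1,3)])
        (simp add: linear_scale[OF has_derivative_linear[OF d]])
    then show "?DD u (c *\<^sub>R v) = c *\<^sub>R ?DD u v" by (rule fun_cong[OF has_derivative_unique[OF dd]])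
  qed
  ultimately show ?thesis unfolding bilinear_def by blast
qed

subsection \<open>Mean curvature of Lagrangian immersions\<close>

lemma linear_inj_eq_dim_surj:
  fixes f :: "'a::euclidean_space \<Rightarrow> 'b::euclidean_space"
  assumes "linear f" "inj f" "DIM('a) = DIM('b)"
  shows "surj f"
proof -
  have "dim (range f) = DIM('b)" using dim_image_eq[OF assms(1), of UNIV] assms by simp
  then have "span (range f) = UNIV" by (simp add: dim_eq_full)
  moreover have "subspace (range f)" using assms(1) by (simp add: linear_subspace_image)
  ultimately show ?thesis by (metis span_eq_iff)
qed

lemma bilinear_sum_left: "bilinear g \<Longrightarrow> g (\<Sum>i\<in>I. f i) y = (\<Sum>i\<in>I. g (f i) y)"
  using linear_sum[of "\<lambda>x. g x y" f I] by (simp add: bilinear_def)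

text \<open>Pairing with the frame recovers the coefficients of \<open>T y\<close>, so
  \<open>T\<close> is injective; the frame is indexed by \<open>Basis\<close>, so the dimensions
  agree and \<open>T\<close> is onto.\<close>

lemma orthonormal_frame_expansion:
  assumes "bilinear g" "orthonormal_frame g E"
  shows "x = (\<Sum>b\<in>Basis. g x (E b) *\<^sub>R E b)"
proof -
  define T where "T = (\<lambda>y::'a. \<Sum>b\<in>Basis. (y \<bullet> b) *\<^sub>R E b)"
  have lin: "linear T"
    by (rule linearI) (simp_all add: T_def inner_left_distrib scaleR_left_distrib sum.distrib scaleR_right.sum)
  have coord: "g (T y) (E b) = y \<bullet> b" if b: "b \<in> Basis" for y b
  proof -
    have "g (T y) (E b) = (\<Sum>c\<in>Basis. (y \<bullet> c) * g (E c) (E b))"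
      unfolding T_def by (simp add: bilinear_sum_left[OF assms(1)] bilinear_lmul[OF assms(1)])
    also have "\<dots> = (\<Sum>c\<in>Basis. (y \<bullet> c) * (if c = b then 1 else 0))"
      using assms(2) b by (auto simp: orthonormal_frame_def intro!: sum.cong)
    finally show ?thesis using b by (simp add: if_distrib cong: if_cong)
  qed
  have "inj T"
  proof (rule injI)
    fix x y assume "T x = T y"
    then have "x \<bullet> b = y \<bullet> b" if "b \<in> Basis" for b using coord[OF that] by metis
    then show "x = y" by (rule euclidean_eqI)
  qed
  then obtain y where "x = T y" using linear_inj_eq_dim_surj[OF lin] by (metis surjD)
  then show ?thesis using coord by (simp add: T_def)
qed

text \<open>\<open>mean_curvature\<close> uses a frame picked by \<open>SOME\<close>; this allows
  any convenient frame instead. Expand \<open>E'\<close> in \<open>E\<close> and sum over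
  \<open>E'\<close> first: the coefficients collapse to \<open>g (E c) (E d)\<close>.\<close>

lemma orthonormal_frame_trace:
  fixes B :: "'a::euclidean_space \<Rightarrow> 'a \<Rightarrow> real"
  assumes g: "bilinear g" "\<And>x y. g x y = g y x" and B: "bilinear B"
    and E: "orthonormal_frame g E" and E': "orthonormal_frame g E'"
  shows "(\<Sum>b\<in>Basis. B (E' b) (E' b)) = (\<Sum>b\<in>Basis. B (E b) (E b))"
proof -
  have "B (E' b) (E' b) = (\<Sum>c\<in>Basis. \<Sum>d\<in>Basis. g (E' b) (E c) * (g (E' b) (E d) * B (E c) (E d)))" for b
  proof -
    have "B (E' b) (E' b) = B (\<Sum>c\<in>Basis. g (E' b) (E c) *\<^sub>R E c) (\<Sum>d\<in>Basis. g (E' b) (E d) *\<^sub>R E d)"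
      using orthonormal_frame_expansion[OF g(1) E] by metis
    also have "\<dots> = (\<Sum>c\<in>Basis. \<Sum>d\<in>Basis. g (E' b) (E c) * (g (E' b) (E d) * B (E c) (E d)))"
      unfolding bilinear_sum[OF B] sum.cartesian_product[symmetric]
      by (simp add: bilinear_lmul[OF B] bilinear_rmul[OF B] mult.left_commute)
    finally show ?thesis .
  qed
  then have "(\<Sum>b\<in>Basis. B (E' b) (E' b)) =
      (\<Sum>b\<in>Basis. \<Sum>c\<in>Basis. \<Sum>d\<in>Basis. g (E' b) (E c) * (g (E' b) (E d) * B (E c) (E d)))"
    by simp
  also have "\<dots> = (\<Sum>c\<in>Basis. \<Sum>d\<in>Basis. \<Sum>b\<in>Basis. g (E' b) (E c) * (g (E' b) (E d) * B (E c) (E d)))"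
    by (subst sum.swap) (intro sum.cong refl sum.swap)
  also have "\<dots> = (\<Sum>c\<in>Basis. \<Sum>d\<in>Basis. g (E c) (E d) * B (E c) (E d))"
  proof (intro sum.cong refl)
    fix c d :: 'a
    have "g (E c) (E d) = g (\<Sum>b\<in>Basis. g (E c) (E' b) *\<^sub>R E' b) (E d)"
      using orthonormal_frame_expansion[OF g(1) E'] by metis
    also have "\<dots> = (\<Sum>b\<in>Basis. g (E' b) (E c) * g (E' b) (E d))"
      by (simp add: bilinear_sum_left[OF g(1)] bilinear_lmul[OF g(1)] g(2)[of "E c"])
    finally show "(\<Sum>b\<in>Basis. g (E' b) (E c) * (g (E' b) (E d) * B (E c) (E d))) = g (E c) (E d) * B (E c) (E d)"
      by (simp add: sum_distrib_right mult.assoc)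
  qed
  also have "\<dots> = (\<Sum>c\<in>Basis. \<Sum>d\<in>Basis. if c = d then B (E c) (E d) else 0)"
    by (intro sum.cong refl) (use E in \<open>auto simp: orthonormal_frame_def\<close>)
  finally show ?thesis by simp
qed

text \<open>Gram-Schmidt, with \<open>Basis\<close> serving only as index set. While an index is
  left over, the vectors found so far are fewer than the dimension, hence do not span.\<close>

lemma orthonormal_frame_exists:
  fixes g :: "'a::euclidean_space \<Rightarrow> 'a \<Rightarrow> real"
  assumes g: "bilinear g" "\<And>x y. g x y = g y x" and pos: "\<And>x. x \<noteq> 0 \<Longrightarrow> g x x > 0"
  shows "\<exists>E. orthonormal_frame g E"
proof -
  have "\<exists>E. \<forall>b\<in>S. \<forall>c\<in>S. g (E b) (E c) = (if b = c then 1 else 0)" if "finite S" "S \<subseteq> Basis" for S :: "'a set"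
    using that
  proof (induction S)
    case empty
    then show ?case by simp
  next
    case (insert a S)
    then obtain E where E: "\<forall>b\<in>S. \<forall>c\<in>S. g (E b) (E c) = (if b = c then 1 else 0)" by auto
    have "card S < DIM('a)"
      using card_mono[OF finite_Basis insert(4)] insert(1,2) by simp
    moreover have "dim (E ` S) \<le> card S"
      using dim_le_card'[of "E ` S"] card_image_le[OF insert(1), of E] insert(1) by auto
    ultimately have "span (E ` S) \<noteq> UNIV" by (metis dim_UNIV dim_span not_less)
    then obtain x where x: "x \<notin> span (E ` S)" by auto
    define y where "y = x - (\<Sum>b\<in>S. g x (E b) *\<^sub>R E b)"
    have "(\<Sum>b\<in>S. g x (E b) *\<^sub>R E b) \<in> span (E ` S)"
      by (intro span_sum span_scale span_base) auto
    then have "y \<noteq> 0" using x unfolding y_def by auto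
    then have gy: "g y y > 0" by (rule pos)
    have orth: "g y (E c) = 0" if c: "c \<in> S" for c
    proof -
      have "g y (E c) = g x (E c) - (\<Sum>b\<in>S. g x (E b) * g (E b) (E c))"
        unfolding y_def by (simp add: bilinear_lsub[OF g(1)] bilinear_sum_left[OF g(1)] bilinear_lmul[OF g(1)])
      also have "(\<Sum>b\<in>S. g x (E b) * g (E b) (E c)) = (\<Sum>b\<in>S. if b = c then g x (E b) else 0)"
        by (intro sum.cong refl) (use E c in auto)
      finally show ?thesis using c insert(1) by simp
    qed
    define F where "F = E(a := y /\<^sub>R sqrt (g y y))"
    have "g (y /\<^sub>R sqrt (g y y)) (y /\<^sub>R sqrt (g y y)) = 1"
      using gy by (simp add: bilinear_lmul[OF g(1)] bilinear_rmul[OF g(1)] field_simps)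
    moreover have "g (y /\<^sub>R sqrt (g y y)) (E c) = 0" "g (E c) (y /\<^sub>R sqrt (g y y)) = 0" if "c \<in> S" for c
      using orth[OF that] g(2)[of "E c" y] by (simp_all add: bilinear_lmul[OF g(1)] bilinear_rmul[OF g(1)])
    ultimately have "\<forall>b\<in>insert a S. \<forall>c\<in>insert a S. g (F b) (F c) = (if b = c then 1 else 0)"
      using E insert(2) unfolding F_def by auto
    then show ?case by blast
  qed
  from this[OF finite_Basis subset_refl] show ?thesis unfolding orthonormal_frame_def .
qed

lemma mean_curvature_lagrangian_eq_0_iff:
  fixes G :: "'f::euclidean_space \<Rightarrow> 'f \<Rightarrow> 'f \<Rightarrow> real" and f :: "'e::euclidean_space \<Rightarrow> 'f"
  defines "L \<equiv> \<lambda>p. frechet_derivative f (at p)"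
  assumes L: "linear (L p)" "inj (L p)" and dim: "DIM('f) = 2 * DIM('e)"
    and G: "bilinear (G (f p))" "\<And>x y. G (f p) x y = G (f p) y x" "\<And>x. x \<noteq> 0 \<Longrightarrow> G (f p) x x > 0"
    and J: "linear J" "\<And>x y. G (f p) (J x) (J y) = G (f p) x y"
    and lagr: "\<And>u v. G (f p) (J (L p u)) (L p v) = 0"
    and H: "bilinear (cov_hessian G f p)"
    and E: "orthonormal_frame (pullback_metric G f p) E"
  shows "mean_curvature G f p = 0 \<longleftrightarrow> (\<forall>t. (\<Sum>b\<in>Basis. G (f p) (cov_hessian G f p (E b) (E b)) (J (L p t))) = 0)"
proof -
  let ?G = "G (f p)" and ?L = "L p" and ?H = "cov_hessian G f p"
  have lagr': "?G (?L u) (J (?L v)) = 0" for u v using lagr G(2) by metis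
  have zero: "x = 0" if "?G x x = 0" for x using G(3)[of x] that by fastforce
  have L0: "?L t = 0 \<longleftrightarrow> t = 0" for t using L by (metis inj_eq linear_0)
  define M where "M = (\<lambda>(s, t). ?L s + J (?L t))"
  have "linear M" unfolding M_def
    by (rule linearI) (auto simp: linear_add[OF L(1)] linear_add[OF J(1)] linear_scale[OF L(1)]
        linear_scale[OF J(1)] scaleR_right_distrib)
  moreover have "inj M"
  \<comment> \<open>Pairing a relation \<open>?L s + J (?L t) = 0\<close> with either summand kills
    the other one by the Lagrangian condition.\<close>
  proof (rule linear_injective_0[OF \<open>linear M\<close>, THEN iffD2], intro allI impI)
    fix q assume "M q = 0"
    then obtain s t where q: "q = (s, t)" and st: "?L s + J (?L t) = 0" by (cases q) (auto simp: M_def)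
    have "?G (?L s + J (?L t)) (?L s) = 0" "?G (?L s + J (?L t)) (J (?L t)) = 0"
      unfolding st using bilinear_lzero[OF G(1)] by auto
    then have "?G (?L s) (?L s) = 0" "?G (?L t) (?L t) = 0"
      using lagr lagr' by (simp_all add: bilinear_ladd[OF G(1)] J(2))
    then show "q = 0" using zero L0 q by (auto simp: zero_prod_def)
  qed
  ultimately have "surj M" by (rule linear_inj_eq_dim_surj) (simp add: dim)
  then have decomp: "\<exists>s t. a = ?L s + J (?L t)" for a
    unfolding surj_def M_def by (metis case_prod_conv surj_pair)
  have normal: "normal_part G f p (?L s + J (?L t)) = J (?L t)" for s t
    unfolding normal_part_def
  proof (rule the_equality)
    show "(\<exists>t'. ?L s + J (?L t) = J (?L t) + frechet_derivative f (at p) t') \<and>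
        (\<forall>t'. ?G (J (?L t)) (frechet_derivative f (at p) t') = 0)"
      using lagr by (auto simp: L_def add.commute)
    fix b assume b: "(\<exists>t'. ?L s + J (?L t) = b + frechet_derivative f (at p) t') \<and>
        (\<forall>t'. ?G b (frechet_derivative f (at p) t') = 0)"
    then obtain t' where t': "?L s + J (?L t) = b + ?L t'" unfolding L_def by auto
    have d: "b - J (?L t) = ?L (s - t')" using t' by (simp add: linear_diff[OF L(1)] algebra_simps)
    have "?G (b - J (?L t)) (?L (s - t')) = 0"
      using b lagr by (simp add: bilinear_lsub[OF G(1)] L_def)
    then show "b = J (?L t)" using zero unfolding d by (metis d eq_iff_diff_eq_0)
  qed
  have normal_inner: "?G (normal_part G f p a) (J (?L t)) = ?G a (J (?L t))" for a t
    using decomp[of a] lagr' by (auto simp: normal bilinear_ladd[OF G(1)])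
  define E' where "E' = (SOME E. orthonormal_frame (pullback_metric G f p) E)"
  have E': "orthonormal_frame (pullback_metric G f p) E'"
    unfolding E'_def using someI[of "orthonormal_frame (pullback_metric G f p)", OF E] by simp
  define \<nu> where "\<nu> = (\<Sum>b\<in>Basis. normal_part G f p (?H (E' b) (E' b)))"
  have "mean_curvature G f p = \<nu> /\<^sub>R real DIM('e)"
    unfolding mean_curvature_def second_fundamental_form_def Let_def \<nu>_def E'_def ..
  then have mc: "mean_curvature G f p = 0 \<longleftrightarrow> \<nu> = 0" by simp
  have \<nu>: "?G \<nu> (J (?L t)) = (\<Sum>b\<in>Basis. ?G (?H (E b) (E b)) (J (?L t)))" for t
  proof -
    have "?G \<nu> (J (?L t)) = (\<Sum>b\<in>Basis. ?G (?H (E' b) (E' b)) (J (?L t)))"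
      unfolding \<nu>_def by (simp add: bilinear_sum_left[OF G(1)] normal_inner)
    also have "\<dots> = (\<Sum>b\<in>Basis. ?G (?H (E b) (E b)) (J (?L t)))"
    proof (rule orthonormal_frame_trace[where B = "\<lambda>u v. ?G (?H u v) (J (?L t))", OF _ _ _ E E'])
      show "bilinear (pullback_metric G f p)"
        using G(1) L(1) linear_compose[OF L(1), unfolded o_def]
        unfolding bilinear_def pullback_metric_def L_def by blast
      show "pullback_metric G f p x y = pullback_metric G f p y x" for x y
        unfolding pullback_metric_def by (rule G(2))
      show "bilinear (\<lambda>u v. ?G (?H u v) (J (?L t)))"
        using G(1) H linear_compose[unfolded o_def, of _ "\<lambda>x. ?G x (J (?L t))"]
        unfolding bilinear_def by blast
    qed
    finally show ?thesis .
  qed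
  \<comment> \<open>With \<open>\<nu>\<close> itself of the form \<open>J (?L t)\<close>, testing
    against all such vectors includes testing \<open>\<nu>\<close> against itself.\<close>
  have "\<exists>t. \<nu> = J (?L t)"
  proof -
    have "\<forall>b. \<exists>s t. ?H (E' b) (E' b) = ?L s + J (?L t)" using decomp by blast
    then obtain s t where st: "\<And>b. ?H (E' b) (E' b) = ?L (s b) + J (?L (t b))" by metis
    have "\<nu> = (\<Sum>b\<in>Basis. J (?L (t b)))" unfolding \<nu>_def st normal ..
    also have "\<dots> = J (?L (\<Sum>b\<in>Basis. t b))" by (simp add: linear_sum[OF L(1)] linear_sum[OF J(1)])
    finally show ?thesis ..
  qed
  then have "\<nu> = 0 \<longleftrightarrow> (\<forall>t. ?G \<nu> (J (?L t)) = 0)"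
    using zero bilinear_lzero[OF G(1)] by metis
  then show ?thesis unfolding mc \<nu> .
qed

subsection \<open>Projectivized hermitian quadrics\<close>

lemma bounded_bilinear_vector_smult: "bounded_bilinear (\<lambda>(a::complex) (x::complex^'n). a *s x)"
  unfolding bilinear_conv_bounded_bilinear[symmetric] bilinear_def
  by (auto intro!: linearI simp: vec_eq_iff algebra_simps)

lemma vector_smult_of_real: "complex_of_real r *s x = r *\<^sub>R x"
  by (simp add: vec_eq_iff) (simp add: scaleR_conv_of_real)

text \<open>Both quadrics at once: \<open>e = 1\<close> for the sphere, \<open>e = -1\<close> for anti-de Sitter space. As
  \<open>e\<^sup>2 = 1\<close>, division by \<open>h z z = e\<close> is written below as multiplication by \<open>e\<close>.\<close>

locale hermitian_quadric =
  fixes h :: "complex^('m::finite option) \<Rightarrow> complex^('m option) \<Rightarrow> complex"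
    and Q :: "(complex^('m option)) set" and e :: real and \<sigma> :: "'m option \<Rightarrow> 'm option"
  assumes h_add: "h (x + y) w = h x w + h y w"
    and h_scale: "h (a *s x) w = a * h x w"
    and h_commute: "h y x = cnj (h x y)"
    and Q: "Q = {z. h z z = complex_of_real e}"
    and e: "e * e = 1"
    and h_pos: "\<lbrakk>h z z = complex_of_real e; h X z = 0; X \<noteq> 0\<rbrakk> \<Longrightarrow> Re (h X X) > 0"
    and bij: "bij \<sigma>"
begin

lemma e_nonzero: "e \<noteq> 0" using e by auto

lemma h_add_right: "h w (x + y) = h w x + h w y"
  by (metis complex_cnj_add h_add h_commute)

lemma h_scale_right: "h w (a *s x) = cnj a * h w x"
  by (metis complex_cnj_mult h_scale h_commute)

lemma h_diff: "h (x - y) w = h x w - h y w"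
  using h_add[of "x - y" y w] by simp

lemma h_diff_right: "h w (x - y) = h w x - h w y"
  using h_add_right[of w "x - y" y] by simp

lemma h_scaleR: "h (r *\<^sub>R x) w = r *\<^sub>R h x w" "h w (r *\<^sub>R x) = r *\<^sub>R h w x"
  unfolding vector_smult_of_real[symmetric] h_scale h_scale_right by (simp_all add: scaleR_conv_of_real)

lemmas h_simps = h_add h_add_right h_diff h_diff_right h_scale h_scale_right h_scaleR

lemma bounded_bilinear_h: "bounded_bilinear h"
  unfolding bilinear_conv_bounded_bilinear[symmetric] bilinear_def
  by (auto intro!: linearI simp: h_simps)

lemma h_zero: "h 0 w = 0" "h w 0 = 0"
  using bounded_bilinear.zero_left[OF bounded_bilinear_h] bounded_bilinear.zero_right[OF bounded_bilinear_h] by auto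

lemma horizontal_iff: "horizontal h z X \<longleftrightarrow> h X z = 0"
  unfolding horizontal_def h_scale_right by (auto simp: complex_eq_iff)

lemma Q_D: "z \<in> Q \<Longrightarrow> h z z = complex_of_real e" by (simp add: Q)

lemma vec_eq_chartI:
  assumes "x $ \<sigma> None = y $ \<sigma> None" "\<And>i. x $ \<sigma> (Some i) = y $ \<sigma> (Some i)"
  shows "x = y"
  unfolding vec_eq_iff using assms bij by (metis bij_pointE not_None_eq)

section \<open>Affine charts and horizontal lifts of tangent vectors\<close>

definition incl :: "complex^'m \<Rightarrow> complex^('m option)" where
  "incl u = (\<chi> j. case inv \<sigma> j of None \<Rightarrow> 0 | Some i \<Rightarrow> u $ i)"

text \<open>The affine section of the projection, normalised at the coordinate
  \<open>\<sigma> None\<close>, with derivative \<open>incl\<close>. It need not lie on the quadric;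
  a positive rescaling puts it there when the form has the right sign.\<close>

definition homog :: "complex^'m \<Rightarrow> complex^('m option)" where
  "homog w = axis (\<sigma> None) 1 + incl w"

lemma incl_nth [simp]: "incl u $ \<sigma> None = 0" "incl u $ \<sigma> (Some i) = u $ i"
  using bij by (simp_all add: incl_def inv_f_f bij_is_inj)

lemma homog_nth [simp]: "homog u $ \<sigma> None = 1" "homog u $ \<sigma> (Some i) = u $ i"
  using bij by (simp_all add: homog_def axis_def inj_eq bij_is_inj)

lemma incl_linear: "incl (u + v) = incl u + incl v" "incl (a *s u) = a *s incl u" "incl (r *\<^sub>R u) = r *\<^sub>R incl u"
  by (rule vec_eq_chartI; simp)+

lemma bounded_linear_incl: "bounded_linear incl"
  unfolding linear_conv_bounded_linear[symmetric] by (rule linearI) (auto simp: incl_linear)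

text \<open>The differential of the projection divides by \<open>z $ \<sigma> None\<close>, which
  the outer factor undoes. The subtracted multiple of \<open>z\<close> is the projection onto the
  complex line of \<open>z\<close>, which that differential kills.\<close>

definition hor_lift :: "complex^('m option) \<Rightarrow> complex^'m \<Rightarrow> complex^('m option)" where
  "hor_lift z u = z $ \<sigma> None *s (incl u - (h (incl u) z * complex_of_real e) *s z)"

lemma of_real_e_square: "complex_of_real e * complex_of_real e = 1"
  by (metis e of_real_1 of_real_mult)

lemma hor_lift_horizontal: "z \<in> Q \<Longrightarrow> h (hor_lift z u) z = 0"
  unfolding hor_lift_def h_simps by (simp add: Q_D mult.assoc of_real_e_square)

lemma d_hopf_hor_lift: "z $ \<sigma> None \<noteq> 0 \<Longrightarrow> d_hopf (affine_chart Q \<sigma>) z (hor_lift z u) = u"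
  unfolding hor_lift_def by (simp add: d_hopf_affine_chart vec_eq_iff field_simps power2_eq_square)

lemma hor_lift_linear: "hor_lift z (u + v) = hor_lift z u + hor_lift z v" "hor_lift z (a *s u) = a *s hor_lift z u"
  "hor_lift z (r *\<^sub>R u) = r *\<^sub>R hor_lift z u"
  unfolding vector_smult_of_real[symmetric] hor_lift_def incl_linear h_simps
  by (simp_all add: vec_eq_iff algebra_simps)

lemma hor_lift_eq_0: "z $ \<sigma> None \<noteq> 0 \<Longrightarrow> hor_lift z u = 0 \<longleftrightarrow> u = 0"
proof
  assume "z $ \<sigma> None \<noteq> 0" "hor_lift z u = 0"
  then show "u = 0" using d_hopf_hor_lift[of z u] d_hopf_hor_lift[of z 0]
    by (metis hor_lift_linear(3) scaleR_zero_left)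
next
  show "u = 0 \<Longrightarrow> hor_lift z u = 0" using hor_lift_linear(3)[of z 0 u] by simp
qed

lemma hopf_in_chart: "\<lbrakk>z \<in> Q; z $ \<sigma> None \<noteq> 0\<rbrakk> \<Longrightarrow> hopf z \<in> fst (affine_chart Q \<sigma>)"
  by (auto simp: affine_chart_def)

lemma chart_hopf: "snd (affine_chart Q \<sigma>) (hopf z) = (\<chi> i. z $ \<sigma> (Some i) / z $ \<sigma> None)"
  by (simp add: affine_chart_def affine_coord_hopf)

lemma homog_chart: "z $ \<sigma> None \<noteq> 0 \<Longrightarrow> z = z $ \<sigma> None *s homog (snd (affine_chart Q \<sigma>) (hopf z))"
  by (rule vec_eq_chartI) (simp_all add: chart_hopf)

lemma
  assumes z: "z \<in> Q" "z $ \<sigma> None \<noteq> 0"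
  shows metric_d_hopf: "\<lbrakk>h X z = 0; h Y z = 0\<rbrakk> \<Longrightarrow> quotient_metric Q h (affine_chart Q \<sigma>)
      (snd (affine_chart Q \<sigma>) (hopf z)) (d_hopf (affine_chart Q \<sigma>) z X) (d_hopf (affine_chart Q \<sigma>) z Y) = Re (h X Y)"
    and cstruct_d_hopf: "h X z = 0 \<Longrightarrow> quotient_cstruct Q h (affine_chart Q \<sigma>)
      (snd (affine_chart Q \<sigma>) (hopf z)) (d_hopf (affine_chart Q \<sigma>) z X) = d_hopf (affine_chart Q \<sigma>) z (\<i> *s X)"
proof -
  note * = h_diff h_scale h_scale_right Q _ bij z(1) hopf_in_chart[OF z]
  show "\<lbrakk>h X z = 0; h Y z = 0\<rbrakk> \<Longrightarrow> quotient_metric Q h (affine_chart Q \<sigma>)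
      (snd (affine_chart Q \<sigma>) (hopf z)) (d_hopf (affine_chart Q \<sigma>) z X) (d_hopf (affine_chart Q \<sigma>) z Y) = Re (h X Y)"
    by (rule quotient_metric_d_hopf(1)[OF *]) (simp_all add: horizontal_iff e_nonzero)
  show "h X z = 0 \<Longrightarrow> quotient_cstruct Q h (affine_chart Q \<sigma>)
      (snd (affine_chart Q \<sigma>) (hopf z)) (d_hopf (affine_chart Q \<sigma>) z X) = d_hopf (affine_chart Q \<sigma>) z (\<i> *s X)"
    by (rule quotient_metric_d_hopf(2)[OF *, of X X]) (simp_all add: horizontal_iff e_nonzero)
qed

lemma metric_hor_lift:
  assumes z: "z \<in> Q" "z $ \<sigma> None \<noteq> 0"
  shows "quotient_metric Q h (affine_chart Q \<sigma>) (snd (affine_chart Q \<sigma>) (hopf z)) u v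
    = Re (h (hor_lift z u) (hor_lift z v))"
  using metric_d_hopf[OF z hor_lift_horizontal[OF z(1)] hor_lift_horizontal[OF z(1)], of u v]
  by (simp add: d_hopf_hor_lift[OF z(2)])

text \<open>\<open>hor_lift z\<close> is an injective complex-linear map into the complement of
  \<open>z\<close>, on which \<open>h_pos\<close> makes even the Lorentzian form definite.\<close>

lemma metric_inner_product:
  assumes z: "z \<in> Q" "z $ \<sigma> None \<noteq> 0"
  defines "G \<equiv> quotient_metric Q h (affine_chart Q \<sigma>) (snd (affine_chart Q \<sigma>) (hopf z))"
  shows "bilinear G" "\<And>u v. G u v = G v u" "\<And>u. u \<noteq> 0 \<Longrightarrow> G u u > 0" "\<And>u v. G (\<i> *s u) (\<i> *s v) = G u v"
proof -
  have G: "G = (\<lambda>u v. Re (h (hor_lift z u) (hor_lift z v)))"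
    unfolding G_def by (intro ext metric_hor_lift z)
  show "bilinear G" unfolding G bilinear_def by (auto intro!: linearI simp: hor_lift_linear h_simps)
  show "G u v = G v u" for u v unfolding G by (subst h_commute) simp
  show "u \<noteq> 0 \<Longrightarrow> G u u > 0" for u unfolding G
    using h_pos[OF Q_D[OF z(1)] hor_lift_horizontal[OF z(1)]] by (simp add: hor_lift_eq_0[OF z(2)])
  show "G (\<i> *s u) (\<i> *s v) = G u v" for u v unfolding G hor_lift_linear h_simps by simp
qed

end

text \<open>The Koszul formula for the metric
  \<open>G(u,v) = e Re (h(u,v)/r - h(u,w) h(w,v)/r\<^sup>2)\<close>, \<open>r = h(w,w)\<close>, in homogeneous coordinates \<open>w\<close>,
  with Christoffel symbol \<open>\<Gamma>(u,v) = -(h(u,w) v + h(v,w) u)/r\<close>. Here \<open>a\<close>, \<open>b\<close>, \<open>c\<close> stand for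
  \<open>h(u,w)\<close>, \<open>h(v,w)\<close>, \<open>h(t,w)\<close> and \<open>B1\<close>, \<open>B2\<close>, \<open>B3\<close> for \<open>h(u,t)\<close>, \<open>h(v,t)\<close>, \<open>h(u,v)\<close>.\<close>

lemma fubini_study_christoffel_identity:
  fixes a b c B1 B2 B3 :: complex and r e :: real
  assumes "r \<noteq> 0"
  shows "e * (Re ((-1/r) *\<^sub>R (a * B2 + b * B1)) / r - Re ((-1/r) *\<^sub>R (2 * a * b) * cnj c) / r\<^sup>2) =
    (e * (- Re B2 * (2 * Re a) / r\<^sup>2 - Re (cnj B3 * cnj c + b * cnj (cnj B1)) / r\<^sup>2 + Re (b * cnj c) * (4 * Re a) / r^3)
   + e * (- Re B1 * (2 * Re b) / r\<^sup>2 - Re (B3 * cnj c + a * cnj (cnj B2)) / r\<^sup>2 + Re (a * cnj c) * (4 * Re b) / r^3)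
   - e * (- Re B3 * (2 * Re c) / r\<^sup>2 - Re (B1 * cnj b + a * cnj B2) / r\<^sup>2 + Re (a * cnj b) * (4 * Re c) / r^3)) / 2"
  using assms by (simp add: field_simps power2_eq_square power3_eq_cube)

text \<open>The shape of the metric coefficients in homogeneous coordinates: \<open>R\<close> is the
  form on \<open>homog y\<close>, \<open>k\<close> the constant product of the two vectors, and
  \<open>N\<close> the product of their components along \<open>homog y\<close>.\<close>

lemma has_derivative_quotient_difference:
  fixes R N :: "'a::real_normed_vector \<Rightarrow> real"
  assumes R: "(R has_derivative R') (at w)" and N: "(N has_derivative N') (at w)" and r: "R w \<noteq> 0"
  shows "((\<lambda>y. e * (k / R y - N y / (R y)\<^sup>2)) has_derivative
    (\<lambda>t. e * (- k * R' t / (R w)\<^sup>2 - N' t / (R w)\<^sup>2 + N w * (2 * R' t) / (R w)^3))) (at w)"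
proof -
  have RR: "R w * R w \<noteq> 0" using r by simp
  show ?thesis
    unfolding power2_eq_square
    by (rule has_derivative_eq_rhs[OF has_derivative_mult_right[OF has_derivative_diff[OF
        has_derivative_divide'[OF has_derivative_const R r]
        has_derivative_divide'[OF N has_derivative_mult[OF R R] RR]]]])
      (use r in \<open>simp add: fun_eq_iff divide_simps power3_eq_cube\<close>, simp add: algebra_simps)
qed

context hermitian_quadric
begin

lemma h_self: "h z z = complex_of_real (Re (h z z))"
  using h_commute[of z z] by (simp add: complex_eq_iff)

text \<open>The metric is computed at the rescaled section. The sign condition describes the points
  covered by the chart: all of them for the sphere, the unit ball for anti-de Sitter space with
  \<open>\<sigma> = id\<close>.\<close>

lemma metric_homog:
  assumes "e * Re (h (homog w) (homog w)) > 0"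
  defines "r \<equiv> Re (h (homog w) (homog w))" and "\<alpha> \<equiv> \<lambda>u. h (incl u) (homog w)"
  shows "quotient_metric Q h (affine_chart Q \<sigma>) w u v =
      e * (Re (h (incl u) (incl v)) / r - Re (\<alpha> u * cnj (\<alpha> v)) / r\<^sup>2)"
    and "\<exists>z. z \<in> Q \<and> z $ \<sigma> None \<noteq> 0 \<and> snd (affine_chart Q \<sigma>) (hopf z) = w"
proof -
  have r: "e * r > 0" "r \<noteq> 0" using assms by auto
  \<comment> \<open>The form takes the value \<open>c * c * r\<close> on \<open>z\<close>, which has
    to be \<open>e\<close>; since \<open>1 / e = e\<close>, this asks for
    \<open>c * c = e / r\<close>.\<close>
  define c where "c = 1 / sqrt (e * r)"
  define z where "z = complex_of_real c *s homog w"
  have e_inv: "1 / e = e" using e e_nonzero by (metis nonzero_eq_divide_eq)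
  have "c \<noteq> 0" using r(2) e_nonzero by (simp add: c_def)
  moreover have "c * c = (1 / e) / r" using r(1) by (simp add: c_def)
  ultimately have c: "c \<noteq> 0" "c * c = e / r" unfolding e_inv by auto
  have hs: "h (homog w) (homog w) = complex_of_real r" unfolding r_def by (rule h_self)
  have "h z z = complex_of_real (c * c * r)"
    unfolding z_def h_simps hs by simp
  then have zQ: "z \<in> Q" unfolding Q c(2) using r by simp
  have zN: "z $ \<sigma> None \<noteq> 0" using c by (simp add: z_def)
  have zw: "snd (affine_chart Q \<sigma>) (hopf z) = w"
    using c by (simp add: chart_hopf z_def vec_eq_iff)
  show "\<exists>z. z \<in> Q \<and> z $ \<sigma> None \<noteq> 0 \<and> snd (affine_chart Q \<sigma>) (hopf z) = w"
    using zQ zN zw by blast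
  have lift: "hor_lift z u = c *\<^sub>R (incl u - (\<alpha> u / r) *s homog w)" for u
  proof -
    have "h (incl u) z * e *s z = (\<alpha> u * (c * c * e)) *s homog w"
      by (simp add: z_def h_simps \<alpha>_def vector_smult_assoc mult.assoc)
    also have "c * c * e = 1 / r" using e e_nonzero unfolding c(2) by simp
    finally have eq: "h (incl u) z * e *s z = (\<alpha> u * (1 / r)) *s homog w" .
    have "z $ \<sigma> None = of_real c" by (simp add: z_def)
    then show ?thesis unfolding hor_lift_def eq by (simp only: vector_smult_of_real) simp
  qed
  have "h (hor_lift z u) (hor_lift z v) = of_real (c * c) * (h (incl u) (incl v) - \<alpha> u * cnj (\<alpha> v) / r)"
  proof -
    have al: "h (incl u) (homog w) = \<alpha> u" for u by (simp add: \<alpha>_def)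
    have hv: "h (homog w) (incl v) = cnj (\<alpha> v)" unfolding \<alpha>_def by (rule h_commute)
    show ?thesis unfolding lift h_simps hv hs using r(2)
      by (simp add: al scaleR_conv_of_real field_simps)
  qed
  then have "Re (h (hor_lift z u) (hor_lift z v)) = e / r * (Re (h (incl u) (incl v)) - Re (\<alpha> u * cnj (\<alpha> v)) / r)"
    unfolding c(2) by simp
  then show "quotient_metric Q h (affine_chart Q \<sigma>) w u v =
      e * (Re (h (incl u) (incl v)) / r - Re (\<alpha> u * cnj (\<alpha> v)) / r\<^sup>2)"
    using metric_hor_lift[OF zQ zN, of u v] r(2) unfolding zw by (simp add: field_simps power2_eq_square)
qed

lemma homog_has_derivative [derivative_intros]: "(homog has_derivative incl) (at w)"
  unfolding homog_def
  using has_derivative_add[OF has_derivative_const bounded_linear_imp_has_derivative[OF bounded_linear_incl]]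
  by simp

text \<open>The formula of \<open>metric_homog\<close> is available only where the sign condition
  holds. That set is open, so differentiating the formula at \<open>w\<close> differentiates the
  metric.\<close>

lemma metric_frechet_derivative:
  assumes "e * Re (h (homog w) (homog w)) > 0"
  defines "r \<equiv> Re (h (homog w) (homog w))" and "\<alpha> \<equiv> \<lambda>u. h (incl u) (homog w)"
  shows "frechet_derivative (\<lambda>y. quotient_metric Q h (affine_chart Q \<sigma>) y u v) (at w) t =
     e * (- Re (h (incl u) (incl v)) * (2 * Re (\<alpha> t)) / r\<^sup>2
       - Re (h (incl u) (incl t) * cnj (\<alpha> v) + \<alpha> u * cnj (h (incl v) (incl t))) / r\<^sup>2
       + Re (\<alpha> u * cnj (\<alpha> v)) * (4 * Re (\<alpha> t)) / r^3)"
proof -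
  define R where "R = (\<lambda>y. Re (h (homog y) (homog y)))"
  define al where "al = (\<lambda>u y. h (incl u) (homog y))"
  have rw: "R w = r" "al u w = \<alpha> u" for u by (simp_all add: R_def r_def al_def \<alpha>_def)
  have dR: "(R has_derivative (\<lambda>t. 2 * Re (\<alpha> t))) (at w)"
  proof -
    have "(R has_derivative (\<lambda>t. Re (h (homog w) (incl t) + h (incl t) (homog w)))) (at w)"
      unfolding R_def
      by (rule has_derivative_Re[OF bounded_bilinear.FDERIV[OF bounded_bilinear_h homog_has_derivative homog_has_derivative]])
    moreover have "Re (h (homog w) (incl t)) = Re (\<alpha> t)" for t
      unfolding \<alpha>_def by (subst h_commute) simp
    ultimately show ?thesis by (simp add: \<alpha>_def)
  qed
  have dal: "(al u has_derivative (\<lambda>t. h (incl u) (incl t))) (at w)" for u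
    unfolding al_def
    by (rule bounded_linear.has_derivative[OF bounded_bilinear.bounded_linear_right[OF bounded_bilinear_h] homog_has_derivative])
  have contR: "continuous_on UNIV R"
  proof -
    have "continuous_on UNIV homog"
      unfolding homog_def by (intro continuous_on_add continuous_on_const linear_continuous_on[OF bounded_linear_incl])
    from continuous_on_Re[OF bounded_bilinear.continuous_on[OF bounded_bilinear_h this this]]
    show ?thesis unfolding R_def .
  qed
  have op: "open {y. e * R y > 0}"
    by (rule open_Collect_less[OF continuous_on_const continuous_on_mult_left[OF contR]])
  have r: "r \<noteq> 0" using assms(1) by (auto simp: r_def)
  have dN: "((\<lambda>y. Re (al u y * cnj (al v y))) has_derivative
      (\<lambda>t. Re (\<alpha> u * cnj (h (incl v) (incl t)) + h (incl u) (incl t) * cnj (\<alpha> v)))) (at w)"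
    using has_derivative_Re[OF has_derivative_mult[OF dal has_derivative_cnj[OF dal]], of u v] by (simp only: rw)
  have "R w \<noteq> 0" using r rw by simp
  from has_derivative_quotient_difference[OF dR dN this, of e "Re (h (incl u) (incl v))"]
  have "((\<lambda>y. e * (Re (h (incl u) (incl v)) / R y - Re (al u y * cnj (al v y)) / (R y)\<^sup>2)) has_derivative
     (\<lambda>t. e * (- Re (h (incl u) (incl v)) * (2 * Re (\<alpha> t)) / r\<^sup>2
       - Re (h (incl u) (incl t) * cnj (\<alpha> v) + \<alpha> u * cnj (h (incl v) (incl t))) / r\<^sup>2
       + Re (\<alpha> u * cnj (\<alpha> v)) * (4 * Re (\<alpha> t)) / r^3))) (at w)"
    by (simp add: rw add.commute)
  then have "((\<lambda>y. quotient_metric Q h (affine_chart Q \<sigma>) y u v) has_derivative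
     (\<lambda>t. e * (- Re (h (incl u) (incl v)) * (2 * Re (\<alpha> t)) / r\<^sup>2
       - Re (h (incl u) (incl t) * cnj (\<alpha> v) + \<alpha> u * cnj (h (incl v) (incl t))) / r\<^sup>2
       + Re (\<alpha> u * cnj (\<alpha> v)) * (4 * Re (\<alpha> t)) / r^3))) (at w)"
    by (rule has_derivative_transform_within_open[OF _ op])
      (use assms(1) metric_homog(1)[of _ u v] in \<open>simp_all add: R_def al_def\<close>)
  from fun_cong[OF frechet_derivative_at[OF this, symmetric]] show ?thesis .
qed

text \<open>The definite description requires existence, which is the algebraic Koszul identity, and
  uniqueness, which is nondegeneracy of the metric at \<open>w\<close>.\<close>

lemma christoffel_metric:
  assumes "e * Re (h (homog w) (homog w)) > 0"
  defines "r \<equiv> Re (h (homog w) (homog w))" and "\<alpha> \<equiv> \<lambda>u. h (incl u) (homog w)"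
  shows "christoffel (quotient_metric Q h (affine_chart Q \<sigma>)) w u v = (- 1 / r) *\<^sub>R (\<alpha> u *s v + \<alpha> v *s u)"
  unfolding christoffel_def
proof (rule the_equality)
  let ?G = "quotient_metric Q h (affine_chart Q \<sigma>)"
  let ?\<Gamma> = "(- 1 / r) *\<^sub>R (\<alpha> u *s v + \<alpha> v *s u)"
  have r: "r \<noteq> 0" using assms(1) by (auto simp: r_def)
  have al: "h (incl u) (homog w) = \<alpha> u" for u by (simp add: \<alpha>_def)
  note D = metric_frechet_derivative[OF assms(1), folded r_def, unfolded al]
  show eq: "\<forall>z. ?G w ?\<Gamma> z = (frechet_derivative (\<lambda>y. ?G y v z) (at w) u
      + frechet_derivative (\<lambda>y. ?G y u z) (at w) v - frechet_derivative (\<lambda>y. ?G y u v) (at w) z) / 2"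
  proof
    fix z
    have b: "h (incl ?\<Gamma>) (incl z) = (-1/r) *\<^sub>R (\<alpha> u * h (incl v) (incl z) + \<alpha> v * h (incl u) (incl z))"
      by (simp only: incl_linear h_simps)
    have a: "\<alpha> ?\<Gamma> = (-1/r) *\<^sub>R (2 * \<alpha> u * \<alpha> v)"
      unfolding \<alpha>_def incl_linear h_simps by simp
    have c: "h (incl v) (incl u) = cnj (h (incl u) (incl v))" "h (incl z) (incl u) = cnj (h (incl u) (incl z))"
      "h (incl z) (incl v) = cnj (h (incl v) (incl z))"
      by (rule h_commute)+
    show "?G w ?\<Gamma> z = (frechet_derivative (\<lambda>y. ?G y v z) (at w) u
      + frechet_derivative (\<lambda>y. ?G y u z) (at w) v - frechet_derivative (\<lambda>y. ?G y u v) (at w) z) / 2"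
      unfolding metric_homog(1)[OF assms(1), folded r_def, unfolded al] a b D c
      by (rule fubini_study_christoffel_identity[OF r])
  qed
  fix x assume x: "\<forall>z. ?G w x z = (frechet_derivative (\<lambda>y. ?G y v z) (at w) u
      + frechet_derivative (\<lambda>y. ?G y u z) (at w) v - frechet_derivative (\<lambda>y. ?G y u v) (at w) z) / 2"
  have xz: "?G w x z = ?G w ?\<Gamma> z" for z using x[rule_format, of z] eq[rule_format, of z] by (simp only:)
  \<comment> \<open>Positive definiteness is known at projections of points of the quadric, so
    \<open>w\<close> is represented by one before the difference of two solutions is paired with
    itself.\<close>
  obtain z0 where z0: "z0 \<in> Q" "z0 $ \<sigma> None \<noteq> 0" "snd (affine_chart Q \<sigma>) (hopf z0) = w"
    using metric_homog(2)[OF assms(1)] by blast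
  note G = metric_inner_product[OF z0(1,2), unfolded z0(3)]
  have "?G w (x - ?\<Gamma>) (x - ?\<Gamma>) = 0" unfolding bilinear_lsub[OF G(1)] xz by simp
  then show "x = ?\<Gamma>" using G(3)[of "x - ?\<Gamma>"] by (metis less_irrefl right_minus_eq)
qed

end

subsection \<open>Horizontal lifts\<close>

text \<open>A map \<open>f\<close> in an affine chart together with a horizontal lift
  \<open>g\<close>. The setting is used in both directions: to extract the trace condition from a
  given minimal immersion, and to prove minimality of the warped products.\<close>

locale horizontal_map = hermitian_quadric h Q e \<sigma>
  for h :: "complex^('m::finite option) \<Rightarrow> complex^('m option) \<Rightarrow> complex" and Q e \<sigma> +
  fixes W :: "'e::euclidean_space set" and g :: "'e \<Rightarrow> complex^('m option)" and f :: "'e \<Rightarrow> complex^'m"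
  assumes open_W: "open W" and smooth_g: "smooth_on W g"
    and in_Q: "q \<in> W \<Longrightarrow> g q \<in> Q" and nz: "q \<in> W \<Longrightarrow> g q $ \<sigma> None \<noteq> 0"
    and horizontal_g: "q \<in> W \<Longrightarrow> h (frechet_derivative g (at q) v) (g q) = 0"
    and f: "q \<in> W \<Longrightarrow> f q = snd (affine_chart Q \<sigma>) (hopf (g q))"
begin

abbreviation "Dg q \<equiv> frechet_derivative g (at q)"
abbreviation "DDg q u v \<equiv> frechet_derivative (\<lambda>p. Dg p v) (at q) u"
abbreviation "Df q \<equiv> frechet_derivative f (at q)"
abbreviation "DDf q u v \<equiv> frechet_derivative (\<lambda>p. Df p v) (at q) u"
abbreviation "P x \<equiv> (\<chi> i. x $ \<sigma> (Some i)) :: complex^'m"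
abbreviation "dh \<equiv> d_hopf (affine_chart Q \<sigma>)"
abbreviation "G \<equiv> quotient_metric Q h (affine_chart Q \<sigma>)"

lemma bounded_linear_P: "bounded_linear (\<lambda>x::complex^('m option). P x)"
  unfolding linear_conv_bounded_linear[symmetric] by (rule linearI) (auto simp: vec_eq_iff)

lemma smooth_f: "smooth_on W f"
  unfolding smooth_on_def
proof
  fix k
  have g: "Ck_on k W g" using smooth_g by (simp add: smooth_on_def)
  have "Ck_on k W (\<lambda>q. inverse (g q $ \<sigma> None) *s P (g q))"
    by (rule Ck_on_bilinear[OF bounded_bilinear_vector_smult open_W
          Ck_on_inverse[OF open_W Ck_on_linear_compose[OF bounded_linear_vec_nth open_W g] nz]
          Ck_on_linear_compose[OF bounded_linear_P open_W g]])
  then show "Ck_on k W f"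
    by (rule Ck_on_cong[OF open_W, rotated]) (simp add: f chart_hopf vec_eq_iff field_simps)
qed

lemmas g_d = smooth_on_has_derivative[OF smooth_g] smooth_on_has_derivative2[OF smooth_g]
lemmas f_d = smooth_on_has_derivative[OF smooth_f] smooth_on_has_derivative2[OF smooth_f]

lemma P_g: "q \<in> W \<Longrightarrow> P (g q) = g q $ \<sigma> None *s f q"
  using nz[of q] by (simp add: f chart_hopf vec_eq_iff)

text \<open>Differentiating the product \<open>P_g\<close> instead of the quotient that defines
  \<open>f\<close> keeps denominators away; differentiating once more gives
  \<open>P_DDg\<close>.\<close>

lemma P_Dg:
  assumes q: "q \<in> W"
  shows "P (Dg q v) = g q $ \<sigma> None *s Df q v + Dg q v $ \<sigma> None *s f q"
proof -
  have "((\<lambda>q. P (g q)) has_derivative (\<lambda>v. P (Dg q v))) (at q)"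
    by (rule bounded_linear.has_derivative[OF bounded_linear_P g_d(1)[OF q]])
  moreover have "((\<lambda>q. P (g q)) has_derivative (\<lambda>v. g q $ \<sigma> None *s Df q v + Dg q v $ \<sigma> None *s f q)) (at q)"
    by (rule has_derivative_transform_within_open[OF bounded_bilinear.FDERIV[OF bounded_bilinear_vector_smult
          bounded_linear.has_derivative[OF bounded_linear_vec_nth g_d(1)[OF q]] f_d(1)[OF q]] open_W q])
      (simp add: P_g)
  ultimately show ?thesis by (rule fun_cong[OF has_derivative_unique])
qed

lemma Df_eq:
  assumes q: "q \<in> W"
  shows "Df q v = dh (g q) (Dg q v)"
proof -
  have "Dg q v $ \<sigma> (Some i) = g q $ \<sigma> None * Df q v $ i + Dg q v $ \<sigma> None * f q $ i" for i
    using P_Dg[OF q, of v] by (simp add: vec_eq_iff)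
  moreover have "g q $ \<sigma> (Some i) = g q $ \<sigma> None * f q $ i" for i
    using P_g[OF q] by (simp add: vec_eq_iff)
  ultimately show ?thesis using nz[OF q]
    by (simp add: d_hopf_affine_chart vec_eq_iff field_simps power2_eq_square)
qed

lemma P_DDg:
  assumes q: "q \<in> W"
  shows "P (DDg q u v) = g q $ \<sigma> None *s DDf q u v + Dg q u $ \<sigma> None *s Df q v
    + (Dg q v $ \<sigma> None *s Df q u + DDg q u v $ \<sigma> None *s f q)"
proof -
  have "((\<lambda>q. P (Dg q v)) has_derivative (\<lambda>u. P (DDg q u v))) (at q)"
    by (rule bounded_linear.has_derivative[OF bounded_linear_P g_d(2)[OF q]])
  moreover have "((\<lambda>q. P (Dg q v)) has_derivative (\<lambda>u. g q $ \<sigma> None *s DDf q u v + Dg q u $ \<sigma> None *s Df q v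
    + (Dg q v $ \<sigma> None *s Df q u + DDg q u v $ \<sigma> None *s f q))) (at q)"
    by (rule has_derivative_transform_within_open[OF has_derivative_add[OF
          bounded_bilinear.FDERIV[OF bounded_bilinear_vector_smult
            bounded_linear.has_derivative[OF bounded_linear_vec_nth g_d(1)[OF q]] f_d(2)[OF q]]
          bounded_bilinear.FDERIV[OF bounded_bilinear_vector_smult
            bounded_linear.has_derivative[OF bounded_linear_vec_nth g_d(2)[OF q]] f_d(1)[OF q]]] open_W q])
      (simp add: P_Dg)
  ultimately show ?thesis by (rule fun_cong[OF has_derivative_unique])
qed

text \<open>The subtracted terms carry the logarithmic derivative of the coordinate
  \<open>\<sigma> None\<close> of the lift. They reflect the choice of affine chart and are what the
  Christoffel symbols cancel.\<close>

lemma DDf_eq: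
  assumes q: "q \<in> W"
  shows "DDf q u v = dh (g q) (DDg q u v) - ((Dg q u $ \<sigma> None / g q $ \<sigma> None) *s Df q v
    + (Dg q v $ \<sigma> None / g q $ \<sigma> None) *s Df q u)"
proof -
  have "DDg q u v $ \<sigma> (Some i) = g q $ \<sigma> None * DDf q u v $ i + Dg q u $ \<sigma> None * Df q v $ i
    + (Dg q v $ \<sigma> None * Df q u $ i + DDg q u v $ \<sigma> None * f q $ i)" for i
    using P_DDg[OF q, where u = u and v = v] by (simp add: vec_eq_iff)
  moreover have "g q $ \<sigma> (Some i) = g q $ \<sigma> None * f q $ i" for i
    using P_g[OF q] by (simp add: vec_eq_iff)
  ultimately show ?thesis using nz[OF q]
    by (simp add: d_hopf_affine_chart vec_eq_iff field_simps power2_eq_square)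
qed

lemma homog_f: "q \<in> W \<Longrightarrow> g q = g q $ \<sigma> None *s homog (f q)"
  using homog_chart[OF nz] f by simp

text \<open>Horizontality expresses the component of \<open>Df q u\<close> along the homogeneous
  point by the logarithmic derivative of the coordinate \<open>\<sigma> None\<close>. With this the
  Christoffel term becomes exactly the correction in \<open>DDf_eq\<close>.\<close>

lemma cov_hessian_eq:
  assumes q: "q \<in> W"
  shows "cov_hessian G f q u v = dh (g q) (DDg q u v)"
proof -
  define a where "a = g q $ \<sigma> None"
  define r where "r = Re (h (homog (f q)) (homog (f q)))"
  have a: "a \<noteq> 0" "g q = a *s homog (f q)" using nz[OF q] homog_f[OF q] by (simp_all add: a_def)
  have hr: "h (homog (f q)) (homog (f q)) = of_real r" unfolding r_def by (rule h_self)
  \<comment> \<open>Rescaling by \<open>a\<close> changes the value of the form by the positive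
    factor \<open>(cmod a)\<^sup>2\<close>; this gives the sign condition of
    \<open>christoffel_metric\<close>.\<close>
  have "of_real e = a * (cnj a * h (homog (f q)) (homog (f q)))"
    using Q_D[OF in_Q[OF q]] unfolding a(2) h_scale h_scale_right by (simp add: mult.left_commute)
  also have "\<dots> = of_real ((cmod a)\<^sup>2 * r)"
    unfolding hr of_real_mult complex_norm_square by (simp only: mult.assoc)
  finally have "e = (cmod a)\<^sup>2 * r" by (simp only: of_real_eq_iff)
  then have "e * r * (cmod a)\<^sup>2 = 1" using e by (metis mult.assoc mult.commute)
  then have er: "e * r > 0" using a(1) zero_less_mult_pos2[of "e * r" "(cmod a)\<^sup>2"] by simp
  then have r0: "r \<noteq> 0" by auto
  have alpha: "h (incl (Df q u)) (homog (f q)) = - (r * (Dg q u $ \<sigma> None / a))" for u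
  proof -
    have "Dg q u = Dg q u $ \<sigma> None *s homog (f q) + a *s incl (Df q u)"
      using P_Dg[OF q, of u] by (intro vec_eq_chartI) (simp_all add: vec_eq_iff a_def)
    then have "0 = h (Dg q u $ \<sigma> None *s homog (f q) + a *s incl (Df q u)) (a *s homog (f q))"
      using horizontal_g[OF q, of u] a(2) by metis
    also have "\<dots> = cnj a * (Dg q u $ \<sigma> None * r + a * h (incl (Df q u)) (homog (f q)))"
      unfolding h_simps hr by (simp add: algebra_simps)
    finally have "Dg q u $ \<sigma> None * r + a * h (incl (Df q u)) (homog (f q)) = 0" using a(1) by simp
    then have "a * h (incl (Df q u)) (homog (f q)) = - (Dg q u $ \<sigma> None * r)"
      by (simp add: add_eq_0_iff)
    then show ?thesis using a(1) by (simp add: field_simps)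
  qed
  have "christoffel G (f q) (Df q u) (Df q v) = (- 1 / r) *\<^sub>R
      ((- (r * (Dg q u $ \<sigma> None / a))) *s Df q v + (- (r * (Dg q v $ \<sigma> None / a))) *s Df q u)"
    using christoffel_metric[OF er[unfolded r_def], of "Df q u" "Df q v", folded r_def] unfolding alpha .
  also have "\<dots> = (Dg q u $ \<sigma> None / a) *s Df q v + (Dg q v $ \<sigma> None / a) *s Df q u"
    using r0 unfolding vector_smult_of_real[symmetric] by (simp add: vec_eq_iff field_simps)
  finally show ?thesis unfolding cov_hessian_def DDf_eq[OF q] a_def by simp
qed

text \<open>One horizontal argument is enough: the component of \<open>X\<close> along the complex
  line of \<open>g q\<close> is killed by \<open>dh\<close> and is orthogonal to \<open>Y\<close>.
  This matters because the second derivative of the lift is not horizontal.\<close>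

lemma metric_dh:
  assumes q: "q \<in> W" and Y: "h Y (g q) = 0"
  shows "G (f q) (dh (g q) X) (dh (g q) Y) = Re (h X Y)"
proof -
  define X' where "X' = X - (h X (g q) * e) *s g q"
  have "h X' (g q) = 0"
    unfolding X'_def h_simps Q_D[OF in_Q[OF q]] by (simp add: mult.assoc of_real_e_square)
  moreover have "h (g q) Y = 0" using Y by (subst h_commute) simp
  then have "h X' Y = h X Y" unfolding X'_def h_simps by simp
  moreover have "dh (g q) X' = dh (g q) X"
    using nz[OF q] unfolding X'_def by (simp add: d_hopf_affine_chart vec_eq_iff field_simps power2_eq_square)
  ultimately show ?thesis using metric_d_hopf[OF in_Q[OF q] nz[OF q], of X' Y] Y f[OF q] by simp
qed

lemma dh_scale: "q \<in> W \<Longrightarrow> dh (g q) (a *s X) = a *s dh (g q) X"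
  by (simp add: d_hopf_affine_chart nz vec_eq_iff field_simps)

lemma metric_Df: "q \<in> W \<Longrightarrow> G (f q) (Df q u) (Df q v) = Re (h (Dg q u) (Dg q v))"
  by (simp add: Df_eq metric_dh horizontal_g)

lemma metric_i_Df: "q \<in> W \<Longrightarrow> G (f q) (\<i> *s Df q u) (Df q v) = - Im (h (Dg q u) (Dg q v))"
  using metric_dh[OF _ horizontal_g, of q "\<i> *s Dg q u" v]
  by (simp add: Df_eq dh_scale h_scale)

lemma cstruct_Df: "q \<in> W \<Longrightarrow> quotient_cstruct Q h (affine_chart Q \<sigma>) (f q) (Df q u) = \<i> *s Df q u"
  using cstruct_d_hopf[OF in_Q nz horizontal_g, of q] f[of q]
  by (simp add: Df_eq dh_scale)

lemma G_inner:
  assumes q: "q \<in> W"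
  shows "bilinear (G (f q))" "G (f q) x y = G (f q) y x" "x \<noteq> 0 \<Longrightarrow> G (f q) x x > 0"
    "G (f q) (\<i> *s x) (\<i> *s y) = G (f q) x y"
  using metric_inner_product[OF in_Q[OF q] nz[OF q]] f[OF q] by auto

text \<open>The quotient metric is positive definite, so \<open>Df q u\<close> vanishes exactly when
  its length, computed on the lift, does.\<close>

lemma inj_Df_iff:
  assumes q: "q \<in> W"
  shows "inj (Df q) \<longleftrightarrow> (\<forall>u. u \<noteq> 0 \<longrightarrow> Re (h (Dg q u) (Dg q u)) > 0)"
proof -
  have l: "linear (Df q)" using has_derivative_linear[OF f_d(1)[OF q]] .
  have "Df q u = 0 \<longleftrightarrow> \<not> Re (h (Dg q u) (Dg q u)) > 0" for u
    using G_inner(3)[OF q, of "Df q u"] metric_Df[OF q, of u u] bilinear_lzero[OF G_inner(1)[OF q]] by auto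
  then show ?thesis unfolding linear_injective_0[OF l] by blast
qed

text \<open>The general criterion with multiplication by \<open>\<i>\<close> as \<open>J\<close>.
  Moving \<open>\<i>\<close> out of the second argument of \<open>h\<close> turns the real part that
  defines the metric into an imaginary part.\<close>

lemma mean_curvature_eq_0_iff:
  assumes q: "q \<in> W" and inj: "inj (Df q)" and dim: "DIM('e) = CARD('m)"
    and isotropic: "\<And>u v. Im (h (Dg q u) (Dg q v)) = 0"
    and E: "orthonormal_frame (\<lambda>u v. Re (h (Dg q u) (Dg q v))) E"
  shows "mean_curvature G f q = 0 \<longleftrightarrow> (\<forall>t. (\<Sum>b\<in>Basis. Im (h (DDg q (E b) (E b)) (Dg q t))) = 0)"
proof -
  have l: "linear (Df q)" using has_derivative_linear[OF f_d(1)[OF q]] .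
  have pb: "pullback_metric G f q = (\<lambda>u v. Re (h (Dg q u) (Dg q v)))"
    by (simp add: pullback_metric_def metric_Df[OF q] fun_eq_iff)
  have "bilinear (cov_hessian G f q)"
  proof -
    have dl: "linear (dh (g q))"
      unfolding vector_smult_of_real[symmetric] linear_iff dh_scale[OF q]
      by (simp add: d_hopf_affine_chart nz[OF q] vec_eq_iff field_simps)
    have "linear (\<lambda>u. dh (g q) (DDg q u v))" "linear (\<lambda>v. dh (g q) (DDg q u v))" for u v
      using smooth_on_bilinear_second_derivative[OF open_W smooth_g q] linear_compose[OF _ dl, unfolded o_def]
      unfolding bilinear_def by blast+
    then show ?thesis unfolding bilinear_def cov_hessian_eq[OF q] by blast
  qed
  moreover have "linear (\<lambda>u::complex^'m. \<i> *s u)"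
    by (rule linearI) (simp_all add: vec_eq_iff algebra_simps)
  ultimately have "mean_curvature G f q = 0 \<longleftrightarrow>
     (\<forall>t. (\<Sum>b\<in>Basis. G (f q) (cov_hessian G f q (E b) (E b)) (\<i> *s Df q t)) = 0)"
    using l inj dim metric_i_Df[OF q] isotropic G_inner[OF q] E[folded pb]
    by (intro mean_curvature_lagrangian_eq_0_iff) auto
  moreover have "G (f q) (cov_hessian G f q u v) (\<i> *s Df q t) = Im (h (DDg q u v) (Dg q t))" for u v t
  proof -
    have "h (\<i> *s Dg q t) (g q) = 0" by (simp add: h_scale horizontal_g[OF q])
    from metric_dh[OF q this, of "DDg q u v"] show ?thesis
      by (simp add: cov_hessian_eq[OF q] Df_eq[OF q] dh_scale[OF q] h_scale_right)
  qed
  ultimately show ?thesis by simp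
qed

end

section \<open>The sphere and anti-de Sitter space as Hermitian quadrics\<close>

lemma hermitian_quadric_pos:
  assumes "bij \<sigma>"
  shows "hermitian_quadric herm_pos (unit_sphere :: (complex^('m::finite option)) set) 1 \<sigma>"
proof
  fix x y w z X :: "complex^('m option)" and a :: complex
  show "herm_pos (x + y) w = herm_pos x w + herm_pos y w"
    by (simp add: herm_pos_def algebra_simps sum.distrib)
  show "herm_pos (a *s x) w = a * herm_pos x w"
    by (simp add: herm_pos_def sum_distrib_left mult.assoc)
  show "herm_pos y x = cnj (herm_pos x y)"
    by (simp add: herm_pos_def mult.commute)
  show "unit_sphere = {z :: complex^('m option). herm_pos z z = complex_of_real 1}"
    by (simp add: unit_sphere_def)
  assume "X \<noteq> 0"
  then obtain i where i: "X $ i \<noteq> 0" by (auto simp: vec_eq_iff)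
  have "herm_pos X X = complex_of_real (\<Sum>i\<in>UNIV. (cmod (X $ i))\<^sup>2)"
    by (simp add: herm_pos_def complex_norm_square[symmetric] del: of_real_power)
  moreover have "(\<Sum>i\<in>UNIV. (cmod (X $ i))\<^sup>2) > 0"
    by (rule sum_pos2[of _ i]) (use i in auto)
  ultimately show "Re (herm_pos X X) > 0" by simp
qed (use assms in simp_all)

text \<open>Positivity on the complement of \<open>z\<close> is the reversed Cauchy-Schwarz
  inequality. Orthogonality bounds the last coordinate of \<open>X\<close> by Cauchy-Schwarz in the
  other coordinates, and \<open>B\<close>, the square length of \<open>z\<close> in those, is one
  less than the square modulus of \<open>z $ None\<close>.\<close>

lemma hermitian_quadric_lor:
  assumes "bij \<sigma>"
  shows "hermitian_quadric herm_lor (anti_de_sitter :: (complex^('m::finite option)) set) (-1) \<sigma>"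
proof
  fix x y w z X :: "complex^('m option)" and a :: complex
  show "herm_lor (x + y) w = herm_lor x w + herm_lor y w"
    by (simp add: herm_lor_def algebra_simps sum.distrib)
  show "herm_lor (a *s x) w = a * herm_lor x w"
    by (simp add: herm_lor_def sum_distrib_left algebra_simps)
  show "herm_lor y x = cnj (herm_lor x y)"
    by (simp add: herm_lor_def mult.commute)
  show "anti_de_sitter = {z :: complex^('m option). herm_lor z z = complex_of_real (- 1)}"
    by (simp add: anti_de_sitter_def)
  have self: "herm_lor x x = complex_of_real ((\<Sum>i\<in>UNIV. (cmod (x $ Some i))\<^sup>2) - (cmod (x $ None))\<^sup>2)" for x :: "complex^('m option)"
    by (simp add: herm_lor_def complex_norm_square[symmetric] del: of_real_power)
  assume z: "herm_lor z z = complex_of_real (- 1)" and Xz: "herm_lor X z = 0" and X: "X \<noteq> 0"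
  define A where "A = (\<Sum>i\<in>UNIV. (cmod (X $ Some i))\<^sup>2)"
  define B where "B = (\<Sum>i\<in>UNIV. (cmod (z $ Some i))\<^sup>2)"
  have B: "B = (cmod (z $ None))\<^sup>2 - 1"
    using z unfolding self B_def of_real_eq_iff by linarith
  have "cmod (X $ None) * cmod (z $ None) = cmod (\<Sum>i\<in>UNIV. X $ Some i * cnj (z $ Some i))"
    using Xz by (simp add: herm_lor_def norm_mult)
  also have "\<dots> \<le> (\<Sum>i\<in>UNIV. cmod (X $ Some i) * cmod (z $ Some i))"
    using norm_sum[of "\<lambda>i. X $ Some i * cnj (z $ Some i)" UNIV] by (simp add: norm_mult)
  finally have "(cmod (X $ None) * cmod (z $ None))\<^sup>2 \<le> (\<Sum>i\<in>UNIV. cmod (X $ Some i) * cmod (z $ Some i))\<^sup>2"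
    by (rule power_mono) simp
  also have "\<dots> \<le> A * B" unfolding A_def B_def by (rule Cauchy_Schwarz_ineq_sum)
  finally have ineq: "(cmod (X $ None))\<^sup>2 * (cmod (z $ None))\<^sup>2 \<le> A * (cmod (z $ None))\<^sup>2 - A"
    unfolding B by (simp add: power_mult_distrib right_diff_distrib)
  have B0: "B \<ge> 0" unfolding B_def by (simp add: sum_nonneg)
  then have z0: "(cmod (z $ None))\<^sup>2 > 0" using B by linarith
  \<comment> \<open>The strict inequality comes from the term \<open>- A\<close> in
    \<open>ineq\<close>. If \<open>A\<close> were zero, the last coordinate of \<open>X\<close>
    would vanish as well.\<close>
  have "A > 0"
  proof (rule ccontr)
    assume "\<not> A > 0"
    moreover have A0: "A \<ge> 0" unfolding A_def by (simp add: sum_nonneg)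
    ultimately have A: "A = 0" by simp
    then have "\<forall>i. X $ Some i = 0" unfolding A_def by (simp add: sum_nonneg_eq_0_iff)
    moreover have "(cmod (X $ None))\<^sup>2 * (cmod (z $ None))\<^sup>2 = 0"
      by (rule order_antisym) (use ineq A in simp_all)
    then have "X $ None = 0" using z0 by simp
    ultimately have "X = 0" unfolding vec_eq_iff by (metis not_None_eq zero_index)
    then show False using X by simp
  qed
  then have "(cmod (X $ None))\<^sup>2 * (cmod (z $ None))\<^sup>2 < A * (cmod (z $ None))\<^sup>2"
    using ineq by linarith
  then have "(cmod (X $ None))\<^sup>2 < A" using z0 by simp
  then show "Re (herm_lor X X) > 0" unfolding self A_def by simp
qed (use assms in simp_all)

text \<open>The condition that a lift projects to a minimal Lagrangian immersion at \<open>p\<close>, without reference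
  to charts of the target. It makes sense for maps such as \<open>\<Theta>\<close> that do not take values in a quadric.\<close>

definition isotropic_minimal_at ::
    "(complex^'k \<Rightarrow> complex^'k \<Rightarrow> complex) \<Rightarrow> ('e::euclidean_space \<Rightarrow> complex^('k::finite)) \<Rightarrow> 'e \<Rightarrow> bool" where
  "isotropic_minimal_at h \<theta> p \<longleftrightarrow>
     (let D = frechet_derivative \<theta> (at p);
          DD = (\<lambda>u v. frechet_derivative (\<lambda>q. frechet_derivative \<theta> (at q) v) (at p) u)
      in (\<forall>u v. Im (h (D u) (D v)) = 0) \<and> (\<forall>u. u \<noteq> 0 \<longrightarrow> Re (h (D u) (D u)) > 0) \<and>
        (\<exists>E. orthonormal_frame (\<lambda>u v. Re (h (D u) (D v))) E \<and>
          (\<forall>t. (\<Sum>b\<in>Basis. Im (h (DD (E b) (E b)) (D t))) = 0)))"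

section \<open>From minimal Lagrangian immersions to the trace condition\<close>

lemma smooth_on_subset: "\<lbrakk>smooth_on S f; open T; T \<subseteq> S\<rbrakk> \<Longrightarrow> smooth_on T f"
  unfolding smooth_on_def using Ck_on_compose_linear[OF bounded_linear_ident, of T S _ f] by auto

lemma
  assumes "bounded_linear L" "open W" "smooth_on W F" "p \<in> W"
  shows frechet_derivative_linear_compose:
      "frechet_derivative (\<lambda>q. L (F q)) (at p) u = L (frechet_derivative F (at p) u)"
    and frechet_derivative2_linear_compose:
      "frechet_derivative (\<lambda>q. frechet_derivative (\<lambda>q. L (F q)) (at q) v) (at p) u =
       L (frechet_derivative (\<lambda>q. frechet_derivative F (at q) v) (at p) u)"
proof -
  have D: "frechet_derivative (\<lambda>q. L (F q)) (at p) u = L (frechet_derivative F (at p) u)" if "p \<in> W" for p u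
    by (rule fun_cong[OF frechet_derivative_at[symmetric]],
        rule bounded_linear.has_derivative[OF assms(1) smooth_on_has_derivative[OF assms(3) that]])
  show "frechet_derivative (\<lambda>q. L (F q)) (at p) u = L (frechet_derivative F (at p) u)"
    by (rule D[OF assms(4)])
  have "((\<lambda>q. frechet_derivative (\<lambda>q. L (F q)) (at q) v) has_derivative
      (\<lambda>u. L (frechet_derivative (\<lambda>q. frechet_derivative F (at q) v) (at p) u))) (at p)"
    by (rule has_derivative_transform_within_open[OF
          bounded_linear.has_derivative[OF assms(1) smooth_on_has_derivative2[OF assms(3,4)]] assms(2,4)])
      (simp add: D)
  from fun_cong[OF frechet_derivative_at[OF this, symmetric]]
  show "frechet_derivative (\<lambda>q. frechet_derivative (\<lambda>q. L (F q)) (at q) v) (at p) u =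
       L (frechet_derivative (\<lambda>q. frechet_derivative F (at q) v) (at p) u)" .
qed

text \<open>Derivatives pass through linear maps, so the condition depends only on the form pulled
  back to the space of \<open>\<zeta>\<close>. It can therefore be carried between images of one map
  under different linear maps, such as \<open>\<eta>\<close> and its embedding with \<open>f\<close>
  in case (c).\<close>

lemma isotropic_minimal_at_linear_image:
  assumes W: "open W" "smooth_on W \<zeta>" "p \<in> W" and L: "bounded_linear L" and L': "bounded_linear L'"
    and h: "\<And>x y. h' (L' x) (L' y) = h (L x) (L y)"
    and m: "isotropic_minimal_at h (\<lambda>q. L (\<zeta> q)) p"
  shows "isotropic_minimal_at h' (\<lambda>q. L' (\<zeta> q)) p"
  using m unfolding isotropic_minimal_at_def Let_def
    frechet_derivative_linear_compose[OF L W] frechet_derivative_linear_compose[OF L' W]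
    frechet_derivative2_linear_compose[OF L W] frechet_derivative2_linear_compose[OF L' W] h .

lemma
  assumes "smooth_manifold N A" "\<kappa> \<in> A"
  shows open_chart_image: "open (snd \<kappa> ` fst \<kappa>)" and inj_on_chart: "inj_on (snd \<kappa>) (fst \<kappa>)"
    and coord_inv_chart: "x \<in> fst \<kappa> \<Longrightarrow> coord_inv \<kappa> (snd \<kappa> x) = x"
proof -
  obtain U c where \<kappa>: "\<kappa> = (U, c)" by (cases \<kappa>)
  have c: "open (c ` U)" "\<exists>c'. homeomorphism U (c ` U) c c'"
    using assms unfolding smooth_manifold_def \<kappa> by auto
  show "open (snd \<kappa> ` fst \<kappa>)" using c(1) by (simp add: \<kappa>)
  show inj: "inj_on (snd \<kappa>) (fst \<kappa>)" using c(2) unfolding \<kappa> by (metis fst_conv homeomorphism_apply1 inj_onI snd_conv)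
  show "x \<in> fst \<kappa> \<Longrightarrow> coord_inv \<kappa> (snd \<kappa> x) = x"
    unfolding coord_inv_def by (rule the_inv_into_f_f[OF inj])
qed

lemma smooth_map_euclidean:
  assumes "smooth_map A (open_atlas UNIV) F" "\<kappa> \<in> A"
  shows "smooth_on (snd \<kappa> ` fst \<kappa>) (\<lambda>q. F (coord_inv \<kappa> q))"
  using assms unfolding smooth_map_def open_atlas_def coord_rep_def by (auto simp: o_def)

lemma smooth_on_continuous: "smooth_on S f \<Longrightarrow> continuous_on S f"
  unfolding smooth_on_def by (metis Ck_on.simps(1))

context hermitian_quadric
begin

text \<open>Undoes the encoding of the hypotheses in (a) and (b): metric and complex structure of
  the projective or hyperbolic target are evaluated on the lift, and Gram-Schmidt supplies the
  frame.\<close>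

lemma isotropic_minimal_lift:
  fixes A :: "('p::{t2_space,second_countable_topology}, 'e::euclidean_space) chart set"
  assumes N: "smooth_manifold N A"
    and \<phi>: "minimal_lagrangian_immersion A K \<phi>" "horizontal_lift A Q h \<phi> \<phi>'"
    and K: "affine_chart Q \<sigma> \<in> charts K" "metric K = quotient_metric Q h" "cstruct K = quotient_cstruct Q h"
    and x: "\<kappa> \<in> A" "x \<in> fst \<kappa>" "\<phi>' x $ \<sigma> None \<noteq> 0"
  shows "isotropic_minimal_at h (\<lambda>q. \<phi>' (coord_inv \<kappa> q)) (snd \<kappa> x)"
proof -
  let ?\<theta> = "\<lambda>q. \<phi>' (coord_inv \<kappa> q)" and ?\<mu> = "affine_chart Q \<sigma>"
  let ?f = "coord_rep \<kappa> ?\<mu> \<phi>" and ?p = "snd \<kappa> x"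
  note inv = coord_inv_chart[OF N x(1)]
  have sm: "smooth_on (snd \<kappa> ` fst \<kappa>) ?\<theta>"
    using smooth_map_euclidean x(1) \<phi>(2) unfolding horizontal_lift_def by blast
  \<comment> \<open>Only here does the image lie in the affine chart of \<open>\<sigma>\<close>; the
    hypothesis on \<open>\<phi>' x\<close> puts the given point inside.\<close>
  define W where "W = snd \<kappa> ` fst \<kappa> \<inter> (\<lambda>q. ?\<theta> q $ \<sigma> None) -` (- {0})"
  have W: "open W"
    unfolding W_def
    by (rule continuous_open_preimage[OF continuous_on_component[OF smooth_on_continuous[OF sm]] open_chart_image[OF N x(1)]]) auto
  have U: "fst \<kappa> \<subseteq> \<Union> (fst ` A)" using x(1) by auto
  interpret horizontal_map h Q e \<sigma> W ?\<theta> ?f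
  proof
    show "open W" by (rule W)
    show "smooth_on W ?\<theta>" by (rule smooth_on_subset[OF sm W]) (auto simp: W_def)
    fix q assume q: "q \<in> W"
    then obtain y where y: "y \<in> fst \<kappa>" "q = snd \<kappa> y" by (auto simp: W_def)
    show "?\<theta> q \<in> Q" using \<phi>(2) y U inv unfolding horizontal_lift_def by auto
    show "?\<theta> q $ \<sigma> None \<noteq> 0" using q by (auto simp: W_def)
    show "h (frechet_derivative ?\<theta> (at q) v) (?\<theta> q) = 0" for v
      using \<phi>(2) y x(1) inv unfolding horizontal_lift_def horizontal_iff by (auto simp: o_def)
    show "?f q = snd ?\<mu> (hopf (?\<theta> q))"
      using \<phi>(2) y U inv unfolding horizontal_lift_def coord_rep_def by auto
  qed
  have p: "?p \<in> W" using x inv by (auto simp: W_def)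
  have "\<phi>' x \<in> Q" "\<phi> x = hopf (\<phi>' x)" using \<phi>(2) x U unfolding horizontal_lift_def by auto
  then have x\<mu>: "x \<in> fst \<kappa> \<inter> \<phi> -` fst ?\<mu>" using hopf_in_chart x by auto
  have fx: "?f ?p = snd ?\<mu> (\<phi> x)" by (simp add: coord_rep_def inv[OF x(2)])
  have dim: "DIM(complex^'m) = 2 * DIM('e)" and inj: "inj (Df ?p)"
    and kf: "kahler_form K ?\<mu> (?f ?p) (Df ?p u) (Df ?p v) = 0"
    and mc: "mean_curvature (metric K ?\<mu>) ?f ?p = 0" for u v
    using \<phi>(1) x(1) K(1) x\<mu> fx
    unfolding minimal_lagrangian_immersion_def lagrangian_immersion_def immersion_def minimal_immersion_def by auto
  have iso: "Im (h (Dg ?p u) (Dg ?p v)) = 0" for u v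
    using kf[of u v] unfolding kahler_form_def K(2,3) cstruct_Df[OF p] metric_i_Df[OF p] by simp
  have pos: "\<forall>u. u \<noteq> 0 \<longrightarrow> Re (h (Dg ?p u) (Dg ?p u)) > 0" using inj inj_Df_iff[OF p] by simp
  have lin: "linear (Dg ?p)" using has_derivative_linear[OF g_d(1)[OF p]] .
  have "\<exists>E. orthonormal_frame (\<lambda>u v. Re (h (Dg ?p u) (Dg ?p v))) E"
  proof (rule orthonormal_frame_exists)
    show "bilinear (\<lambda>u v. Re (h (Dg ?p u) (Dg ?p v)))"
      unfolding bilinear_def by (auto intro!: linearI simp: linear_add[OF lin] linear_scale[OF lin] h_simps)
    show "Re (h (Dg ?p u) (Dg ?p v)) = Re (h (Dg ?p v) (Dg ?p u))" for u v by (subst h_commute) simp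
  qed (use pos in simp)
  then obtain E where E: "orthonormal_frame (\<lambda>u v. Re (h (Dg ?p u) (Dg ?p v))) E" ..
  have "DIM('e) = CARD('m)" using dim by simp
  from mean_curvature_eq_0_iff[OF p inj this iso E] mc
  have "\<forall>t. (\<Sum>b\<in>Basis. Im (h (DDg ?p (E b) (E b)) (Dg ?p t))) = 0" unfolding K(2) by simp
  then show ?thesis unfolding isotropic_minimal_at_def Let_def using iso pos E by blast
qed

end

text \<open>In flat space the immersion plays the role of its own lift: the Christoffel symbols
  vanish, and the real and imaginary parts of \<open>herm_pos\<close> are the metric and its pairing
  with \<open>\<i>\<close>.\<close>

lemma isotropic_minimal_flat:
  fixes A :: "('p::{t2_space,second_countable_topology}, 'e::euclidean_space) chart set" and \<eta> :: "'p \<Rightarrow> complex^'m"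
  assumes N: "smooth_manifold N A"
    and \<eta>: "minimal_lagrangian_immersion A complex_euclidean \<eta>"
    and x: "\<kappa> \<in> A" "x \<in> fst \<kappa>"
  shows "isotropic_minimal_at herm_pos (\<lambda>q. \<eta> (coord_inv \<kappa> q)) (snd \<kappa> x)"
proof -
  let ?\<mu> = "(UNIV, id) :: (complex^'m, complex^'m) chart"
  let ?f = "\<lambda>q. \<eta> (coord_inv \<kappa> q)" and ?p = "snd \<kappa> x" and ?G = "\<lambda>_. inner :: complex^'m \<Rightarrow> complex^'m \<Rightarrow> real"
  let ?D = "frechet_derivative ?f (at ?p)"
  let ?DD = "\<lambda>u v. frechet_derivative (\<lambda>q. frechet_derivative ?f (at q) v) (at ?p) u"
  have ch: "charts complex_euclidean = {?\<mu>}" by (simp add: complex_euclidean_def open_atlas_def)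
  have f: "coord_rep \<kappa> ?\<mu> \<eta> = ?f" by (simp add: coord_rep_def fun_eq_iff)
  have "smooth_map A (open_atlas UNIV) \<eta>"
    using \<eta> unfolding minimal_lagrangian_immersion_def minimal_immersion_def immersion_def
    by (simp add: complex_euclidean_def)
  then have sm: "smooth_on (snd \<kappa> ` fst \<kappa>) ?f" using x(1) by (rule smooth_map_euclidean)
  have p: "?p \<in> snd \<kappa> ` fst \<kappa>" using x(2) by simp
  note W = open_chart_image[OF N x(1)]
  have dim: "DIM(complex^'m) = 2 * DIM('e)" and inj: "inj ?D"
    and lagr: "inner (\<i> *s ?D u) (?D v) = 0" and mc: "mean_curvature ?G ?f ?p = 0" for u v
    using \<eta> x f
    unfolding minimal_lagrangian_immersion_def lagrangian_immersion_def immersion_def minimal_immersion_def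
      kahler_form_def ch by (auto simp: complex_euclidean_def)
  have inner: "Re (herm_pos a b) = inner a b" "Im (herm_pos a b) = inner a (\<i> *s b)" for a b :: "complex^'m"
    by (simp_all add: herm_pos_def inner_vec_def inner_complex_def algebra_simps)
  have J: "inner (\<i> *s a) (\<i> *s b) = inner a b" for a b :: "complex^'m"
    by (simp add: inner_vec_def inner_complex_def add.commute)
  have iso: "Im (herm_pos (?D u) (?D v)) = 0" for u v
    using lagr[of v u] by (simp add: inner inner_commute)
  have lin: "linear ?D" using has_derivative_linear[OF smooth_on_has_derivative[OF sm p]] .
  have pos: "\<forall>u. u \<noteq> 0 \<longrightarrow> Re (herm_pos (?D u) (?D u)) > 0"
    using inj linear_injective_0[OF lin] unfolding inner by auto
  \<comment> \<open>A constant metric makes the Koszul right-hand side zero; nondegeneracy then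
    selects the zero vector.\<close>
  have "christoffel ?G w u v = 0" for w u v
  proof -
    have "frechet_derivative (\<lambda>y. inner (a::complex^'m) b) (at w) = (\<lambda>_. 0)" for a b
      using frechet_derivative_at[OF has_derivative_const] by metis
    moreover have "(THE a. \<forall>z. inner a z = 0) = (0::complex^'m)"
      by (rule the_equality) (auto intro: inner_eq_zero_iff[THEN iffD1])
    ultimately show ?thesis unfolding christoffel_def by simp
  qed
  then have cov: "cov_hessian ?G ?f ?p = ?DD" by (simp add: cov_hessian_def fun_eq_iff)
  have bil: "bilinear (inner :: complex^'m \<Rightarrow> _)"
    by (simp add: bilinear_conv_bounded_bilinear bounded_bilinear_inner)
  have bilD: "bilinear (\<lambda>u v. inner (?D u) (?D v))"
    unfolding bilinear_def by (auto intro!: linearI simp: linear_add[OF lin] linear_scale[OF lin] inner_add_left inner_add_right)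
  obtain E where E: "orthonormal_frame (\<lambda>u v. inner (?D u) (?D v)) E"
    using orthonormal_frame_exists[OF bilD] pos by (auto simp: inner inner_commute)
  have linJ: "linear (\<lambda>u::complex^'m. \<i> *s u)"
    by (rule linearI) (simp_all add: vec_eq_iff algebra_simps)
  have "mean_curvature ?G ?f ?p = 0 \<longleftrightarrow> (\<forall>t. (\<Sum>b\<in>Basis. inner (?DD (E b) (E b)) (\<i> *s ?D t)) = 0)"
    using mean_curvature_lagrangian_eq_0_iff[of ?f ?p ?G "\<lambda>u. \<i> *s u" E, OF lin inj dim bil _ _ linJ J lagr _ _]
      smooth_on_bilinear_second_derivative[OF W sm p] E
    unfolding cov pullback_metric_def by (simp add: inner_commute)
  then show ?thesis
    using mc iso pos E unfolding isotropic_minimal_at_def Let_def inner by blast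
qed

lemma sum_Basis_Pair: "(\<Sum>b\<in>Basis. f b) = (\<Sum>i\<in>Basis. f (i, 0)) + (\<Sum>j\<in>Basis. f (0, j))"
  for f :: "'a::euclidean_space \<times> 'b::euclidean_space \<Rightarrow> real"
  unfolding Basis_prod_def by (subst sum.union_disjoint) (auto simp: sum.reindex inj_on_def)

lemma anti_de_sitter_None: "z \<in> anti_de_sitter \<Longrightarrow> z $ None \<noteq> 0"
proof
  assume z: "z \<in> anti_de_sitter" "z $ None = 0"
  then have "(\<Sum>i\<in>UNIV. (cmod (z $ Some i))\<^sup>2) = -1"
    unfolding anti_de_sitter_def herm_lor_def
    by (simp add: complex_norm_square[symmetric] del: of_real_power)
      (metis of_real_1 of_real_eq_iff of_real_minus of_real_sum)
  then show False using sum_nonneg[of UNIV "\<lambda>i. (cmod (z $ Some i))\<^sup>2"] by simp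
qed

text \<open>Smoothness of the warped product is obtained together with pointwise facts at some
  point; this covers a domain without points.\<close>

lemma Ck_on_empty: "Ck_on k {} f"
  by (induction k arbitrary: f) auto

subsection \<open>Warped products\<close>

text \<open>The assumptions \<open>quadric\<close> and \<open>horizontal\<close> make the
  pulled-back Hermitian form equal to \<open>ds\<^sup>2\<close> plus \<open>(l s)\<^sup>2\<close>
  times that of \<open>\<Theta>\<close>. Isotropy and positivity are inherited from
  \<open>\<Theta>\<close>, and only the trace condition needs second derivatives.\<close>

lemma warped_product_minimal_lagrangian:
  fixes A :: "('p::{t2_space,second_countable_topology}, 'e::euclidean_space) chart set"
    and \<Theta> :: "'p \<Rightarrow> complex^('k::finite option)" and l l' :: "real \<Rightarrow> real"
    and c c' :: "real \<Rightarrow> complex^('k option)"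
  assumes N: "smooth_manifold N A" and S: "open S" and dim: "CARD('k) = DIM('e) + 1"
    and smooth_l: "\<And>k. Ck_on k UNIV l" and smooth_c: "\<And>k. Ck_on k UNIV c"
    and dl: "\<And>s. (l has_derivative (\<lambda>t. t * l' s)) (at s)" "\<And>s. (l' has_derivative (\<lambda>t. t * l s)) (at s)"
    and dc: "\<And>s. (c has_derivative (\<lambda>t. t *\<^sub>R c' s)) (at s)" "\<And>s. (c' has_derivative (\<lambda>t. t *\<^sub>R c s)) (at s)"
    and l: "\<And>s. s \<in> S \<Longrightarrow> l s \<noteq> 0"
    and smooth_\<Theta>: "\<And>\<kappa>. \<kappa> \<in> A \<Longrightarrow> smooth_on (snd \<kappa> ` fst \<kappa>) (\<lambda>q. \<Theta> (coord_inv \<kappa> q))"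
    and minimal: "\<And>\<kappa> x. \<lbrakk>\<kappa> \<in> A; x \<in> fst \<kappa>\<rbrakk> \<Longrightarrow> isotropic_minimal_at herm_lor (\<lambda>q. \<Theta> (coord_inv \<kappa> q)) (snd \<kappa> x)"
    and quadric: "\<And>s x. \<lbrakk>s \<in> S; x \<in> N\<rbrakk> \<Longrightarrow> herm_lor (l s *\<^sub>R \<Theta> x + c s) (l s *\<^sub>R \<Theta> x + c s) = -1"
      "\<And>s x. \<lbrakk>s \<in> S; x \<in> N\<rbrakk> \<Longrightarrow> herm_lor (l' s *\<^sub>R \<Theta> x + c' s) (l s *\<^sub>R \<Theta> x + c s) = 0"
      "\<And>s x. \<lbrakk>s \<in> S; x \<in> N\<rbrakk> \<Longrightarrow> herm_lor (l' s *\<^sub>R \<Theta> x + c' s) (l' s *\<^sub>R \<Theta> x + c' s) = 1"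
    and horizontal: "\<And>\<kappa> s x v. \<lbrakk>\<kappa> \<in> A; s \<in> S; x \<in> fst \<kappa>\<rbrakk> \<Longrightarrow>
        herm_lor (frechet_derivative (\<lambda>q. \<Theta> (coord_inv \<kappa> q)) (at (snd \<kappa> x)) v) (l s *\<^sub>R \<Theta> x + c s) = 0"
      "\<And>\<kappa> s x v. \<lbrakk>\<kappa> \<in> A; s \<in> S; x \<in> fst \<kappa>\<rbrakk> \<Longrightarrow>
        herm_lor (frechet_derivative (\<lambda>q. \<Theta> (coord_inv \<kappa> q)) (at (snd \<kappa> x)) v) (l' s *\<^sub>R \<Theta> x + c' s) = 0"
  shows "minimal_lagrangian_immersion (prod_atlas (open_atlas S) A)
    (complex_hyperbolic :: ((complex^('k option)) set, complex^'k) hermitian_manifold)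
    (\<lambda>(s, x). hopf (l s *\<^sub>R \<Theta> x + c s))"
proof -
  let ?B = "prod_atlas (open_atlas S) A"
  let ?K = "complex_hyperbolic :: ((complex^('k option)) set, complex^'k) hermitian_manifold"
  let ?\<mu> = "affine_chart anti_de_sitter id :: ((complex^('k option)) set, complex^'k) chart"
  let ?F = "\<lambda>(s, x). hopf (l s *\<^sub>R \<Theta> x + c s)"
  interpret lor: hermitian_quadric herm_lor "anti_de_sitter :: (complex^('k option)) set" "-1" id
    by (rule hermitian_quadric_lor) simp
  have UN: "x \<in> N" if "\<kappa> \<in> A" "x \<in> fst \<kappa>" for \<kappa> x
    using N that unfolding smooth_manifold_def by auto
  have in_Q: "l s *\<^sub>R \<Theta> x + c s \<in> anti_de_sitter" if "s \<in> S" "x \<in> N" for s x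
    using quadric(1)[OF that] by (simp add: anti_de_sitter_def)
  have in_\<mu>: "?F (s, x) \<in> fst ?\<mu>" if "s \<in> S" "x \<in> N" for s x
    using lor.hopf_in_chart[OF in_Q[OF that]] anti_de_sitter_None[OF in_Q[OF that]] by simp
  \<comment> \<open>Stated for any \<open>f\<close> with the right values on
    \<open>S \<times> V\<close>, since the inverse of the product chart is controlled only on the
    image of that chart.\<close>
  have core: "smooth_on (S \<times> V) f \<and> inj (frechet_derivative f (at q)) \<and>
      (\<forall>u v. kahler_form ?K ?\<mu> (f q) (frechet_derivative f (at q) u) (frechet_derivative f (at q) v) = 0) \<and>
      mean_curvature (metric ?K ?\<mu>) f q = 0"
    if \<kappa>: "\<kappa> \<in> A" and V: "V = snd \<kappa> ` fst \<kappa>" and q: "q \<in> S \<times> V"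
      and f: "\<And>q. q \<in> S \<times> V \<Longrightarrow> f q = snd ?\<mu> (?F (fst q, coord_inv \<kappa> (snd q)))" for \<kappa> V f q
  proof -
    let ?\<theta> = "\<lambda>p. \<Theta> (coord_inv \<kappa> p)"
    let ?D = "\<lambda>p. frechet_derivative ?\<theta> (at p)"
    let ?DD = "\<lambda>p u v. frechet_derivative (\<lambda>p. ?D p v) (at p) u"
    define g where "g = (\<lambda>q. l (fst q) *\<^sub>R ?\<theta> (snd q) + c (fst q))"
    \<comment> \<open>The unit field \<open>n\<close> is the derivative of \<open>g\<close> in the
      direction of \<open>s\<close>; its own \<open>s\<close>-derivative is \<open>g\<close>
      again.\<close>
    define n where "n = (\<lambda>q. l' (fst q) *\<^sub>R ?\<theta> (snd q) + c' (fst q))"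
    let ?W = "S \<times> V"
    have oV: "open V" unfolding V by (rule open_chart_image[OF N \<kappa>])
    have W: "open ?W" using S oV by (rule open_Times)
    note sm = smooth_\<Theta>[OF \<kappa>, folded V]
    have pt: "coord_inv \<kappa> p \<in> fst \<kappa> \<and> snd \<kappa> (coord_inv \<kappa> p) = p \<and> coord_inv \<kappa> p \<in> N" if "p \<in> V" for p
      using that coord_inv_chart[OF N \<kappa>] UN[OF \<kappa>] unfolding V by auto
    have gg: "herm_lor (g q) (g q) = -1" "herm_lor (n q) (g q) = 0" "herm_lor (n q) (n q) = 1" if "q \<in> ?W" for q
      using quadric pt that unfolding g_def n_def by auto
    have Dg0: "herm_lor (?D (snd q) v) (g q) = 0" "herm_lor (?D (snd q) v) (n q) = 0" if "q \<in> ?W" for q v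
      using horizontal(1)[OF \<kappa>, of "fst q" "coord_inv \<kappa> (snd q)" v] horizontal(2)[OF \<kappa>, of "fst q" "coord_inv \<kappa> (snd q)" v]
        pt[of "snd q"] that unfolding g_def n_def by auto
    have nD0: "herm_lor (n q) (?D (snd q) v) = 0" if "q \<in> ?W" for q v
      using Dg0(2)[OF that] by (subst lor.h_commute) simp
    note d\<theta> = smooth_on_has_derivative[OF sm] smooth_on_has_derivative2[OF sm]
    have lin: "linear (?D p)" if "p \<in> V" for p using has_derivative_linear[OF d\<theta>(1)[OF that]] .
    have fst_d: "((\<lambda>q. F (fst q)) has_derivative (\<lambda>t. F' (fst t))) (at q)" if "(F has_derivative F') (at (fst q))"
      for F :: "real \<Rightarrow> 'z::real_normed_vector" and F' and q :: "real \<times> 'e"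
      by (rule has_derivative_compose[OF has_derivative_fst[OF has_derivative_ident] that])
    have snd_d: "((\<lambda>q. F (snd q)) has_derivative (\<lambda>t. F' (snd t))) (at q)" if "(F has_derivative F') (at (snd q))"
      for F :: "'e \<Rightarrow> complex^('k option)" and F' and q :: "real \<times> 'e"
      by (rule has_derivative_compose[OF has_derivative_snd[OF has_derivative_ident] that])
    have Dg: "frechet_derivative g (at q) t = l (fst q) *\<^sub>R ?D (snd q) (snd t) + fst t *\<^sub>R n q" if "q \<in> ?W" for q t
    proof -
      have "(g has_derivative (\<lambda>t. l (fst q) *\<^sub>R ?D (snd q) (snd t) + (fst t * l' (fst q)) *\<^sub>R ?\<theta> (snd q) + fst t *\<^sub>R c' (fst q))) (at q)"
        unfolding g_def
        by (rule has_derivative_add[OF has_derivative_scaleR[OF fst_d[OF dl(1)] snd_d[OF d\<theta>(1)]] fst_d[OF dc(1)]])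
          (use that in auto)
      from fun_cong[OF frechet_derivative_at[OF this, symmetric], of t] show ?thesis
        unfolding n_def by (simp add: scaleR_right_distrib)
    qed
    \<comment> \<open>The adapted frame splits along the two factors, so its trace involves only
      these pure second derivatives.\<close>
    have DDg: "frechet_derivative (\<lambda>q. frechet_derivative g (at q) (1, 0)) (at q) (1, 0) = g q"
      "frechet_derivative (\<lambda>q. frechet_derivative g (at q) (0, u)) (at q) (0, u) = l (fst q) *\<^sub>R ?DD (snd q) u u"
      if q: "q \<in> ?W" for q u
    proof -
      have p: "snd q \<in> V" using q by auto
      have "(n has_derivative (\<lambda>t. l' (fst q) *\<^sub>R ?D (snd q) (snd t) + (fst t * l (fst q)) *\<^sub>R ?\<theta> (snd q) + fst t *\<^sub>R c (fst q))) (at q)"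
        unfolding n_def
        by (rule has_derivative_add[OF has_derivative_scaleR[OF fst_d[OF dl(2)] snd_d[OF d\<theta>(1)[OF p]]] fst_d[OF dc(2)]])
      from has_derivative_transform_within_open[OF this W q, of "\<lambda>q. frechet_derivative g (at q) (1, 0)"]
      have "((\<lambda>q. frechet_derivative g (at q) (1, 0)) has_derivative
         (\<lambda>t. l' (fst q) *\<^sub>R ?D (snd q) (snd t) + (fst t * l (fst q)) *\<^sub>R ?\<theta> (snd q) + fst t *\<^sub>R c (fst q))) (at q)"
        using lin by (simp add: Dg linear_0 split_beta mem_Times_iff)
      from fun_cong[OF frechet_derivative_at[OF this, symmetric], of "(1, 0)"]
      show "frechet_derivative (\<lambda>q. frechet_derivative g (at q) (1, 0)) (at q) (1, 0) = g q"
        using lin[OF p] by (simp add: g_def linear_0)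
      have "((\<lambda>q. l (fst q) *\<^sub>R ?D (snd q) u) has_derivative
         (\<lambda>t. l (fst q) *\<^sub>R ?DD (snd q) (snd t) u + (fst t * l' (fst q)) *\<^sub>R ?D (snd q) u)) (at q)"
        by (rule has_derivative_scaleR[OF fst_d[OF dl(1)] snd_d[OF d\<theta>(2)[OF p]]])
      from has_derivative_transform_within_open[OF this W q, of "\<lambda>q. frechet_derivative g (at q) (0, u)"]
      have "((\<lambda>q. frechet_derivative g (at q) (0, u)) has_derivative
         (\<lambda>t. l (fst q) *\<^sub>R ?DD (snd q) (snd t) u + (fst t * l' (fst q)) *\<^sub>R ?D (snd q) u)) (at q)"
        by (simp add: Dg)
      from fun_cong[OF frechet_derivative_at[OF this, symmetric], of "(0, u)"]
      show "frechet_derivative (\<lambda>q. frechet_derivative g (at q) (0, u)) (at q) (0, u) = l (fst q) *\<^sub>R ?DD (snd q) u u"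
        by simp
    qed
    have "smooth_on ?W g"
      unfolding smooth_on_def g_def
    proof
      fix k
      have \<theta>k: "Ck_on k V ?\<theta>" using sm by (simp add: smooth_on_def)
      have 1: "Ck_on k ?W (\<lambda>q. l (fst q))" "Ck_on k ?W (\<lambda>q. c (fst q))" "Ck_on k ?W (\<lambda>q. ?\<theta> (snd q))"
        by (rule Ck_on_compose_linear[OF bounded_linear_fst W _ smooth_l]
            Ck_on_compose_linear[OF bounded_linear_fst W _ smooth_c]
            Ck_on_compose_linear[OF bounded_linear_snd W _ \<theta>k], force)+
      show "Ck_on k ?W (\<lambda>q. l (fst q) *\<^sub>R ?\<theta> (snd q) + c (fst q))"
        by (rule Ck_on_add[OF W Ck_on_bilinear[OF bounded_bilinear_scaleR W 1(1,3)] 1(2)])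
    qed
    interpret horizontal_map herm_lor anti_de_sitter "-1" id ?W g f
    proof
      fix q assume q: "q \<in> ?W"
      show "g q \<in> anti_de_sitter" using gg(1)[OF q] by (simp add: anti_de_sitter_def)
      then show "g q $ id None \<noteq> 0" using anti_de_sitter_None by simp
      show "herm_lor (frechet_derivative g (at q) v) (g q) = 0" for v
        unfolding Dg[OF q] lor.h_simps Dg0[OF q] gg(2)[OF q] by simp
      show "f q = snd ?\<mu> (hopf (g q))" using f[OF q] by (simp add: g_def)
    qed (use W \<open>smooth_on ?W g\<close> in auto)
    obtain s p where sp: "q = (s, p)" "s \<in> S" "p \<in> V" using q by auto
    have h_Dg: "herm_lor (frechet_derivative g (at q) t) (frechet_derivative g (at q) t') =
       (l s * l s) *\<^sub>R herm_lor (?D p (snd t)) (?D p (snd t')) + of_real (fst t * fst t')" for t t'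
      using Dg0(2)[OF q] nD0[OF q] gg(3)[OF q] unfolding Dg[OF q] lor.h_simps
      by (simp add: sp(1) scaleR_conv_of_real)
    have min: "isotropic_minimal_at herm_lor ?\<theta> p" using minimal[OF \<kappa>, of "coord_inv \<kappa> p"] pt[OF sp(3)] by simp
    have iso: "Im (herm_lor (?D p u) (?D p v)) = 0" for u v
      using min unfolding isotropic_minimal_at_def Let_def by blast
    have pos: "u \<noteq> 0 \<Longrightarrow> Re (herm_lor (?D p u) (?D p u)) > 0" for u
      using min unfolding isotropic_minimal_at_def Let_def by blast
    obtain E where E: "orthonormal_frame (\<lambda>u v. Re (herm_lor (?D p u) (?D p v))) E"
      and trace: "\<And>t. (\<Sum>b\<in>Basis. Im (herm_lor (?DD p (E b) (E b)) (?D p t))) = 0"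
      using min unfolding isotropic_minimal_at_def Let_def by blast
    have ls: "l s \<noteq> 0" using l[OF sp(2)] .
    have iso_g: "Im (herm_lor (frechet_derivative g (at q) u) (frechet_derivative g (at q) v)) = 0" for u v
      unfolding h_Dg using iso by simp
    have inj: "inj (frechet_derivative f (at q))"
      unfolding inj_Df_iff[OF q] h_Dg
    proof (intro allI impI)
      fix u :: "real \<times> 'e" assume u: "u \<noteq> 0"
      have D0: "?D p 0 = 0" using lin[OF sp(3)] by (rule linear_0)
      show "0 < Re ((l s * l s) *\<^sub>R herm_lor (?D p (snd u)) (?D p (snd u)) + complex_of_real (fst u * fst u))"
      proof (cases "snd u = 0")
        case True
        then have "fst u \<noteq> 0" using u by (metis prod.collapse zero_prod_def)
        then have "0 < fst u * fst u" by (metis mult_neg_neg mult_pos_pos linorder_neqE)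
        then show ?thesis unfolding True D0 lor.h_zero by simp
      next
        case False
        have "0 < l s * l s" using ls by (metis mult_neg_neg mult_pos_pos linorder_neqE)
        then show ?thesis using pos[OF False] by (simp add: add_pos_nonneg)
      qed
    qed
    \<comment> \<open>The metric on the \<open>N\<close> factor is scaled by
      \<open>(l s)\<^sup>2\<close>, hence the division. The test \<open>snd b = 0\<close> singles
      out the basis vector of the real factor.\<close>
    define E' where "E' = (\<lambda>b :: real \<times> 'e. if snd b = 0 then (1 :: real, 0) else (0, E (snd b) /\<^sub>R l s))"
    have E'_simps: "E' (1, 0) = (1, 0)" "b \<in> Basis \<Longrightarrow> E' (0, b) = (0, E b /\<^sub>R l s)" for b
      by (auto simp: E'_def)
    have ls_inv: "l s * (l s * (inverse (l s) * inverse (l s))) = 1" using ls by (simp add: field_simps)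
    have frame: "orthonormal_frame (\<lambda>u v. Re (herm_lor (frechet_derivative g (at q) u) (frechet_derivative g (at q) v))) E'"
      using E ls lin[OF sp(3)]
      unfolding orthonormal_frame_def h_Dg
      by (auto simp: Basis_prod_def E'_simps linear_0 linear_scale lor.h_scaleR lor.h_zero ls_inv)
    have tr: "(\<Sum>b\<in>Basis. Im (herm_lor (frechet_derivative (\<lambda>q. frechet_derivative g (at q) (E' b)) (at q) (E' b))
        (frechet_derivative g (at q) t))) = 0" for t
    proof -
      have 1: "Im (herm_lor (g q) (frechet_derivative g (at q) t)) = 0"
        using horizontal_g[OF q, of t] by (subst lor.h_commute) simp
      \<comment> \<open>Differentiating the orthogonality of \<open>?D p u\<close> to
        \<open>n\<close> gives minus \<open>l' s\<close> times the square length of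
        \<open>?D p u\<close>. This need not be zero, but it is real.\<close>
      have 2: "Im (herm_lor (?DD p u u) (n q)) = 0" for u
      proof -
        have "((\<lambda>p. herm_lor (?D p u) (n (s, p))) has_derivative
            (\<lambda>v. herm_lor (?D p u) (l' s *\<^sub>R ?D p v) + herm_lor (?DD p v u) (n (s, p)))) (at p)"
          unfolding n_def fst_conv snd_conv
          by (rule bounded_bilinear.FDERIV[OF lor.bounded_bilinear_h d\<theta>(2)[OF sp(3)]
            has_derivative_eq_rhs[OF has_derivative_add[OF has_derivative_scaleR_right[OF d\<theta>(1)[OF sp(3)]] has_derivative_const]]])
            simp
        moreover have "((\<lambda>p. herm_lor (?D p u) (n (s, p))) has_derivative (\<lambda>v. 0)) (at p)"
          by (rule has_derivative_transform_within_open[OF has_derivative_const oV sp(3)])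
            (use Dg0(2) sp(2) in force)
        ultimately have "herm_lor (?D p u) (l' s *\<^sub>R ?D p v) + herm_lor (?DD p v u) (n (s, p)) = 0" for v
          by (rule fun_cong[OF has_derivative_unique])
        from arg_cong[OF this[of u], of Im] show ?thesis
          using iso[of u u] unfolding sp(1) by (simp add: lor.h_scaleR)
      qed
      \<comment> \<open>The two factors \<open>1 / l s\<close> from the frame cancel the
        \<open>l s\<close> of the second derivative and the \<open>l s\<close> of the tangent
        vector; the component along \<open>n\<close> drops out by \<open>2\<close>.\<close>
      have 3: "Im (herm_lor (frechet_derivative (\<lambda>q. frechet_derivative g (at q) (0, E b /\<^sub>R l s)) (at q) (0, E b /\<^sub>R l s))
         (frechet_derivative g (at q) t)) = Im (herm_lor (?DD p (E b) (E b)) (?D p (snd t)))" for b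
      proof -
        note bil = smooth_on_bilinear_second_derivative[OF oV sm sp(3)]
        have "l s *\<^sub>R ?DD p (E b /\<^sub>R l s) (E b /\<^sub>R l s) = ?DD p (E b) (E b) /\<^sub>R l s"
          using ls by (simp add: bilinear_lmul[OF bil] bilinear_rmul[OF bil])
        then show ?thesis unfolding DDg(2)[OF q] Dg[OF q] using 2 ls
          by (simp add: sp(1) lor.h_simps)
      qed
      show ?thesis
        unfolding sum_Basis_Pair by (simp add: E'_simps DDg(1)[OF q] 1 3 trace)
    qed
    have "mean_curvature (quotient_metric anti_de_sitter herm_lor ?\<mu>) f q = 0"
      using mean_curvature_eq_0_iff[OF q inj _ iso_g frame] tr dim by simp
    moreover have "kahler_form ?K ?\<mu> (f q) (frechet_derivative f (at q) u) (frechet_derivative f (at q) v) = 0" for u v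
      using iso_g by (simp add: kahler_form_def complex_hyperbolic_def cstruct_Df[OF q] metric_i_Df[OF q])
    ultimately show ?thesis using smooth_f inj by (simp add: complex_hyperbolic_def)
  qed
  have ch: "charts ?K = {?\<mu>}" by (simp add: complex_hyperbolic_def)
  have atlas: "\<exists>\<kappa>. \<kappa> \<in> A \<and> \<kappa>' = (S \<times> fst \<kappa>, map_prod id (snd \<kappa>))" if "\<kappa>' \<in> ?B" for \<kappa>'
    using that unfolding prod_atlas_def open_atlas_def by fastforce
  have facts: "fst \<kappa>' \<inter> ?F -` fst ?\<mu> = fst \<kappa>' \<and> open (snd \<kappa>' ` fst \<kappa>') \<and>
      smooth_on (snd \<kappa>' ` fst \<kappa>') (coord_rep \<kappa>' ?\<mu> ?F) \<and>
      (\<forall>x\<in>fst \<kappa>'. inj (frechet_derivative (coord_rep \<kappa>' ?\<mu> ?F) (at (snd \<kappa>' x))) \<and>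
        (\<forall>u v. kahler_form ?K ?\<mu> (snd ?\<mu> (?F x)) (frechet_derivative (coord_rep \<kappa>' ?\<mu> ?F) (at (snd \<kappa>' x)) u)
           (frechet_derivative (coord_rep \<kappa>' ?\<mu> ?F) (at (snd \<kappa>' x)) v) = 0) \<and>
        mean_curvature (metric ?K ?\<mu>) (coord_rep \<kappa>' ?\<mu> ?F) (snd \<kappa>' x) = 0)" if \<kappa>': "\<kappa>' \<in> ?B" for \<kappa>'
  proof -
    obtain \<kappa> where \<kappa>: "\<kappa> \<in> A" and k: "\<kappa>' = (S \<times> fst \<kappa>, map_prod id (snd \<kappa>))"
      using atlas[OF \<kappa>'] by blast
    let ?V = "snd \<kappa> ` fst \<kappa>" and ?f = "coord_rep \<kappa>' ?\<mu> ?F"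
    have im: "snd \<kappa>' ` fst \<kappa>' = S \<times> ?V" unfolding k by force
    have inj: "inj_on (snd \<kappa>') (fst \<kappa>')"
      unfolding k using inj_on_chart[OF N \<kappa>] by (auto simp: inj_on_def)
    have inv: "coord_inv \<kappa>' q = (fst q, coord_inv \<kappa> (snd q))" if qV: "q \<in> S \<times> ?V" for q
    proof -
      obtain s x where q: "q = (s, snd \<kappa> x)" "s \<in> S" "x \<in> fst \<kappa>" using qV by auto
      have "coord_inv \<kappa>' (snd \<kappa>' (s, x)) = (s, x)"
        unfolding coord_inv_def by (rule the_inv_into_f_f[OF inj]) (use q in \<open>simp add: k\<close>)
      then show ?thesis using q coord_inv_chart[OF N \<kappa>] by (simp add: k)
    qed
    have f: "?f q = snd ?\<mu> (?F (fst q, coord_inv \<kappa> (snd q)))" if "q \<in> S \<times> ?V" for q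
      by (simp add: coord_rep_def inv[OF that])
    have fx: "?f (snd \<kappa>' x) = snd ?\<mu> (?F x)" if "x \<in> fst \<kappa>'" for x
      unfolding coord_rep_def coord_inv_def using the_inv_into_f_f[OF inj that] by simp
    have sub: "fst \<kappa>' \<inter> ?F -` fst ?\<mu> = fst \<kappa>'"
      using in_\<mu> UN[OF \<kappa>] unfolding k by auto
    note core' = core[OF \<kappa> refl _ f]
    have "smooth_on (S \<times> ?V) ?f"
    proof (cases "S \<times> ?V = {}")
      case True
      show ?thesis unfolding True smooth_on_def by (simp add: Ck_on_empty)
    next
      case False
      then show ?thesis using core' by blast
    qed
    moreover have "open (S \<times> ?V)" using S open_chart_image[OF N \<kappa>] by (rule open_Times)
    moreover have "snd \<kappa>' x \<in> S \<times> ?V" if "x \<in> fst \<kappa>'" for x using that im by blast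
    ultimately show ?thesis
      using sub core' unfolding im by (metis (no_types, lifting) fx)
  qed
  define F where "F = ?F"
  note facts = facts[folded F_def]
  have "smooth_map ?B (charts ?K) F"
    unfolding smooth_map_def ch
  proof (intro conjI ballI)
    fix y assume "y \<in> \<Union> (fst ` ?B)"
    then obtain \<kappa>' where "\<kappa>' \<in> ?B" "y \<in> fst \<kappa>'" by blast
    then have "y \<in> fst \<kappa>' \<inter> F -` fst ?\<mu>" using facts by blast
    then show "F y \<in> \<Union> (fst ` {?\<mu>})" by blast
  next
    fix \<kappa>' \<mu> assume "\<kappa>' \<in> ?B" "\<mu> \<in> {?\<mu>}"
    then show "open (snd \<kappa>' ` (fst \<kappa>' \<inter> F -` fst \<mu>))"
      "smooth_on (snd \<kappa>' ` (fst \<kappa>' \<inter> F -` fst \<mu>)) (coord_rep \<kappa>' \<mu> F)"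
      using facts[of \<kappa>'] by simp_all
  qed
  then have imm: "immersion ?B (charts ?K) F"
    unfolding immersion_def ch using facts by blast
  have "DIM(complex^'k) = 2 * DIM(real \<times> 'e)" using dim by simp
  then show ?thesis
    unfolding minimal_lagrangian_immersion_def lagrangian_immersion_def minimal_immersion_def F_def[symmetric]
    using imm facts unfolding ch by blast
qed

subsection \<open>The three families\<close>

lemma sum_UNIV_option: "(\<Sum>i\<in>UNIV. F i) = F None + (\<Sum>i\<in>UNIV. F (Some i))"
  for F :: "'k::finite option \<Rightarrow> complex"
  unfolding UNIV_option_conv by (simp add: sum.reindex)

lemma herm_pos_append_coord:
  "herm_pos (append_coord x a) (append_coord y b) = herm_pos x y + a * cnj b"
  by (simp add: herm_pos_def append_coord_def sum_UNIV_option)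

lemma herm_lor_append_coord:
  "herm_lor (append_coord x a) (append_coord y b) = herm_pos x y - a * cnj b"
  by (simp add: herm_pos_def herm_lor_def append_coord_def)

lemma herm_lor_cons_coord:
  "herm_lor (cons_coord a x) (cons_coord b y) = a * cnj b + herm_lor x y"
  by (simp add: herm_lor_def cons_coord_def sum_UNIV_option)

lemma append_coord_linear:
  "append_coord x a + append_coord y b = append_coord (x + y) (a + b)"
  "r *\<^sub>R append_coord x a = append_coord (r *\<^sub>R x) (r *\<^sub>R a)"
  by (simp_all add: append_coord_def vec_eq_iff split: option.splits)

lemma cons_coord_linear:
  "cons_coord a x + cons_coord b y = cons_coord (a + b) (x + y)"
  "r *\<^sub>R cons_coord a x = cons_coord (r *\<^sub>R a) (r *\<^sub>R x)"
  by (simp_all add: cons_coord_def vec_eq_iff split: option.splits)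

lemma bounded_bilinear_herm_pos: "bounded_bilinear (herm_pos :: complex^'k \<Rightarrow> complex^'k \<Rightarrow> complex)"
  unfolding bilinear_conv_bounded_bilinear[symmetric] bilinear_def
  by (auto intro!: linearI simp: herm_pos_def algebra_simps sum.distrib scaleR_sum_right)

lemma herm_pos_zero [simp]: "herm_pos 0 y = 0" "herm_pos x 0 = 0"
  by (simp_all add: herm_pos_def)

lemma herm_pos_self: "herm_pos x x = complex_of_real ((norm x)\<^sup>2)"
  by (simp add: herm_pos_def norm_vec_def L2_set_def sum_nonneg complex_norm_square[symmetric] del: of_real_power)

lemma herm_scaleR:
  "herm_pos (r *\<^sub>R x) y = of_real r * herm_pos x y" "herm_pos x (r *\<^sub>R y) = of_real r * herm_pos x y"
  "herm_lor (r *\<^sub>R z) w = of_real r * herm_lor z w" "herm_lor z (r *\<^sub>R w) = of_real r * herm_lor z w"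
  unfolding herm_pos_def herm_lor_def vector_smult_of_real[symmetric]
  by (simp_all add: sum_distrib_left algebra_simps)

lemma has_derivative_sinh_cosh:
  "(sinh has_derivative (\<lambda>t. t * cosh s)) (at s)" "(cosh has_derivative (\<lambda>t. t * sinh s)) (at s)" for s :: real
  by (auto intro!: derivative_eq_intros)

lemma cosh_sinh_of_real:
  "complex_of_real (cosh s) * complex_of_real (cosh s) = 1 + complex_of_real (sinh s) * complex_of_real (sinh s)"
proof -
  have "cosh s * cosh s = 1 + sinh s * sinh s"
    using hyperbolic_pythagoras[of s] by (simp add: power2_eq_square)
  from arg_cong[OF this, of complex_of_real] show ?thesis by simp
qed

lemma horizontal_liftD:
  assumes N: "smooth_manifold N A" and "horizontal_lift A Q h \<phi> \<phi>'" "\<kappa> \<in> A"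
  shows "smooth_on (snd \<kappa> ` fst \<kappa>) (\<lambda>q. \<phi>' (coord_inv \<kappa> q))"
    and "x \<in> fst \<kappa> \<Longrightarrow> horizontal h (\<phi>' x) (frechet_derivative (\<lambda>q. \<phi>' (coord_inv \<kappa> q)) (at (snd \<kappa> x)) v)"
    and "x \<in> N \<Longrightarrow> \<phi>' x \<in> Q"
proof -
  show "smooth_on (snd \<kappa> ` fst \<kappa>) (\<lambda>q. \<phi>' (coord_inv \<kappa> q))"
    using assms(2,3) smooth_map_euclidean unfolding horizontal_lift_def by blast
  show "x \<in> fst \<kappa> \<Longrightarrow> horizontal h (\<phi>' x) (frechet_derivative (\<lambda>q. \<phi>' (coord_inv \<kappa> q)) (at (snd \<kappa> x)) v)"
    using assms(2,3) unfolding horizontal_lift_def by (auto simp: o_def)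
  show "x \<in> N \<Longrightarrow> \<phi>' x \<in> Q"
    using assms(1,2) unfolding horizontal_lift_def smooth_manifold_def by auto
qed

lemma bounded_linear_append: "bounded_linear (\<lambda>x. append_coord x 0)"
  unfolding linear_conv_bounded_linear[symmetric] by (rule linearI) (simp_all add: append_coord_linear)

lemma bounded_linear_cons: "bounded_linear (\<lambda>x. cons_coord 0 x)"
  unfolding linear_conv_bounded_linear[symmetric] by (rule linearI) (simp_all add: cons_coord_linear)

lemma frechet_derivative_chart_linear:
  assumes "smooth_manifold N A" "\<kappa> \<in> A" "x \<in> fst \<kappa>" "bounded_linear L"
    "smooth_on (snd \<kappa> ` fst \<kappa>) (\<lambda>q. F (coord_inv \<kappa> q))"
  shows "frechet_derivative (\<lambda>q. L (F (coord_inv \<kappa> q))) (at (snd \<kappa> x)) v =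
    L (frechet_derivative (\<lambda>q. F (coord_inv \<kappa> q)) (at (snd \<kappa> x)) v)"
  by (rule frechet_derivative_linear_compose[OF assms(4) open_chart_image[OF assms(1,2)] assms(5)]) (use assms(3) in simp)

text \<open>Here \<open>\<Theta> = (\<phi>', 0)\<close> is orthogonal to the fixed timelike vector,
  and the Lorentzian form on vectors with last coordinate zero is \<open>herm_pos\<close>. The
  warping factor \<open>sinh\<close> is nonzero on the positive reals.\<close>

lemma spherical_case:
  fixes A :: "('p::{t2_space,second_countable_topology}, real^'m) chart set"
    and \<phi> :: "'p \<Rightarrow> (complex^('m option)) set"
  assumes N: "smooth_manifold N A" and \<phi>: "minimal_lagrangian_immersion A complex_projective \<phi>"
    "horizontal_lift A unit_sphere herm_pos \<phi> \<phi>'"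
  shows "minimal_lagrangian_immersion (prod_atlas (open_atlas {0<..}) A)
    (complex_hyperbolic :: ((complex^('m option option)) set, complex^('m option)) hermitian_manifold)
    (\<lambda>(s::real, x). hopf (append_coord (complex_of_real (sinh s) *s \<phi>' x) (complex_of_real (cosh s))))"
proof -
  note lift = horizontal_liftD[OF N \<phi>(2)]
  have NU: "\<exists>\<kappa>\<in>A. x \<in> fst \<kappa>" if "x \<in> N" for x using that N unfolding smooth_manifold_def by auto
  have sphere: "herm_pos (\<phi>' x) (\<phi>' x) = 1" if "x \<in> N" for x
    using lift(3) NU[OF that] that unfolding unit_sphere_def by blast
  have UN: "x \<in> N" if "\<kappa> \<in> A" "x \<in> fst \<kappa>" for \<kappa> x using N that unfolding smooth_manifold_def by auto
  let ?D = "\<lambda>\<kappa> x. frechet_derivative (\<lambda>q. \<phi>' (coord_inv \<kappa> q)) (at (snd \<kappa> x))"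
  interpret pos: hermitian_quadric herm_pos "unit_sphere :: (complex^('m option)) set" 1 id
    by (rule hermitian_quadric_pos) simp
  have hor: "herm_pos (?D \<kappa> x v) (\<phi>' x) = 0" if "\<kappa> \<in> A" "x \<in> fst \<kappa>" for \<kappa> x v
    using lift(2)[OF that, of v] unfolding pos.horizontal_iff .
  have min: "isotropic_minimal_at herm_pos (\<lambda>q. \<phi>' (coord_inv \<kappa> q)) (snd \<kappa> x)" if \<kappa>: "\<kappa> \<in> A" "x \<in> fst \<kappa>" for \<kappa> x
  proof -
    \<comment> \<open>No single affine chart covers projective space, so one is chosen at each point
      by swapping \<open>None\<close> with the index of a nonvanishing coordinate.\<close>
    have "\<phi>' x \<noteq> 0" using sphere[OF UN[OF \<kappa>]] by auto
    then obtain i where i: "\<phi>' x $ i \<noteq> 0" by (auto simp: vec_eq_iff)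
    let ?\<sigma> = "Transposition.transpose None i"
    have bij: "bij ?\<sigma>" by simp
    show ?thesis
      by (rule hermitian_quadric.isotropic_minimal_lift[OF hermitian_quadric_pos[OF bij] N \<phi> _ _ _ \<kappa>])
        (use i bij in \<open>auto simp: complex_projective_def\<close>)
  qed
  have eq: "append_coord (complex_of_real (sinh s) *s \<phi>' x) (complex_of_real (cosh s)) =
      sinh s *\<^sub>R append_coord (\<phi>' x) 0 + cosh s *\<^sub>R append_coord 0 1" for s x
    by (simp add: append_coord_linear vector_smult_of_real scaleR_conv_of_real[where 'a = complex])
  note fd = frechet_derivative_chart_linear[OF N _ _ bounded_linear_append lift(1)]
  show ?thesis
    unfolding eq
  proof (rule warped_product_minimal_lagrangian[OF N, where l' = cosh and c' = "\<lambda>s. sinh s *\<^sub>R append_coord 0 1"])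
    show "Ck_on k UNIV (sinh :: real \<Rightarrow> real)" for k using Ck_on_sinh_cosh by blast
    show "Ck_on k UNIV (\<lambda>s::real. cosh s *\<^sub>R append_coord 0 1 :: complex^('m option option))" for k
      using Ck_on_linear_compose[OF bounded_linear_scaleR_left open_UNIV] Ck_on_sinh_cosh by blast
    show "((\<lambda>s. cosh s *\<^sub>R append_coord 0 1) has_derivative (\<lambda>t. t *\<^sub>R (sinh s *\<^sub>R append_coord 0 1))) (at s)"
      "((\<lambda>s. sinh s *\<^sub>R append_coord 0 1) has_derivative (\<lambda>t. t *\<^sub>R (cosh s *\<^sub>R append_coord 0 1))) (at s)" for s :: real
      using has_derivative_scaleR_left[OF has_derivative_sinh_cosh(2)] has_derivative_scaleR_left[OF has_derivative_sinh_cosh(1)]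
      by simp_all
    show "smooth_on (snd \<kappa> ` fst \<kappa>) (\<lambda>q. append_coord (\<phi>' (coord_inv \<kappa> q)) 0)" if "\<kappa> \<in> A" for \<kappa>
      unfolding smooth_on_def
      using Ck_on_linear_compose[OF bounded_linear_append open_chart_image[OF N that]] lift(1)[OF that]
      unfolding smooth_on_def by blast
    show "isotropic_minimal_at herm_lor (\<lambda>q. append_coord (\<phi>' (coord_inv \<kappa> q)) 0) (snd \<kappa> x)"
      if \<kappa>: "\<kappa> \<in> A" "x \<in> fst \<kappa>" for \<kappa> x
      by (rule isotropic_minimal_at_linear_image[OF open_chart_image[OF N \<kappa>(1)] lift(1)[OF \<kappa>(1)] _
            bounded_linear_ident bounded_linear_append _ min[OF \<kappa>]])
        (use \<kappa> in \<open>auto simp: herm_lor_append_coord\<close>)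
  qed (use sphere hor UN in \<open>auto simp: has_derivative_sinh_cosh append_coord_linear herm_lor_append_coord herm_scaleR
         fd scaleR_conv_of_real[where 'a = complex] cosh_sinh_of_real\<close>)
qed

text \<open>Now \<open>\<Theta> = (0, \<psi>')\<close> is orthogonal to a fixed spacelike vector,
  and \<open>cosh\<close> vanishes nowhere, so \<open>s\<close> ranges over all reals.\<close>

lemma hyperbolic_case:
  fixes A :: "('p::{t2_space,second_countable_topology}, real^'m) chart set"
    and \<psi> :: "'p \<Rightarrow> (complex^('m option)) set"
  assumes N: "smooth_manifold N A" and \<psi>: "minimal_lagrangian_immersion A complex_hyperbolic \<psi>"
    "horizontal_lift A anti_de_sitter herm_lor \<psi> \<psi>'"
  shows "minimal_lagrangian_immersion (prod_atlas (open_atlas UNIV) A)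
    (complex_hyperbolic :: ((complex^('m option option)) set, complex^('m option)) hermitian_manifold)
    (\<lambda>(s::real, x). hopf (cons_coord (complex_of_real (sinh s)) (complex_of_real (cosh s) *s \<psi>' x)))"
proof -
  note lift = horizontal_liftD[OF N \<psi>(2)]
  have NU: "\<exists>\<kappa>\<in>A. x \<in> fst \<kappa>" if "x \<in> N" for x using that N unfolding smooth_manifold_def by auto
  have \<psi>_Q: "\<psi>' x \<in> anti_de_sitter" if "x \<in> N" for x
    using lift(3) NU[OF that] that by blast
  then have quadric: "herm_lor (\<psi>' x) (\<psi>' x) = -1" if "x \<in> N" for x
    using that unfolding anti_de_sitter_def by blast
  have UN: "x \<in> N" if "\<kappa> \<in> A" "x \<in> fst \<kappa>" for \<kappa> x using N that unfolding smooth_manifold_def by auto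
  let ?D = "\<lambda>\<kappa> x. frechet_derivative (\<lambda>q. \<psi>' (coord_inv \<kappa> q)) (at (snd \<kappa> x))"
  interpret lor: hermitian_quadric herm_lor "anti_de_sitter :: (complex^('m option)) set" "-1" id
    by (rule hermitian_quadric_lor) simp
  have hor: "herm_lor (?D \<kappa> x v) (\<psi>' x) = 0" if "\<kappa> \<in> A" "x \<in> fst \<kappa>" for \<kappa> x v
    using lift(2)[OF that, of v] unfolding lor.horizontal_iff .
  have min: "isotropic_minimal_at herm_lor (\<lambda>q. \<psi>' (coord_inv \<kappa> q)) (snd \<kappa> x)" if \<kappa>: "\<kappa> \<in> A" "x \<in> fst \<kappa>" for \<kappa> x
    by (rule lor.isotropic_minimal_lift[OF N \<psi> _ _ _ \<kappa>])
      (use anti_de_sitter_None[OF \<psi>_Q[OF UN[OF \<kappa>]]] in \<open>auto simp: complex_hyperbolic_def\<close>)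
  have eq: "cons_coord (complex_of_real (sinh s)) (complex_of_real (cosh s) *s \<psi>' x) =
      cosh s *\<^sub>R cons_coord 0 (\<psi>' x) + sinh s *\<^sub>R cons_coord 1 0" for s x
    by (simp add: cons_coord_linear vector_smult_of_real scaleR_conv_of_real[where 'a = complex])
  note fd = frechet_derivative_chart_linear[OF N _ _ bounded_linear_cons lift(1)]
  show ?thesis
    unfolding eq
  proof (rule warped_product_minimal_lagrangian[OF N, where l' = sinh and c' = "\<lambda>s. cosh s *\<^sub>R cons_coord 1 0"])
    show "Ck_on k UNIV (cosh :: real \<Rightarrow> real)" for k using Ck_on_sinh_cosh by blast
    show "Ck_on k UNIV (\<lambda>s::real. sinh s *\<^sub>R cons_coord 1 0 :: complex^('m option option))" for k
      using Ck_on_linear_compose[OF bounded_linear_scaleR_left open_UNIV] Ck_on_sinh_cosh by blast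
    show "((\<lambda>s. cosh s *\<^sub>R cons_coord 1 0) has_derivative (\<lambda>t. t *\<^sub>R (sinh s *\<^sub>R cons_coord 1 0))) (at s)"
      "((\<lambda>s. sinh s *\<^sub>R cons_coord 1 0) has_derivative (\<lambda>t. t *\<^sub>R (cosh s *\<^sub>R cons_coord 1 0))) (at s)" for s :: real
      using has_derivative_scaleR_left[OF has_derivative_sinh_cosh(2)] has_derivative_scaleR_left[OF has_derivative_sinh_cosh(1)]
      by simp_all
    show "smooth_on (snd \<kappa> ` fst \<kappa>) (\<lambda>q. cons_coord 0 (\<psi>' (coord_inv \<kappa> q)))" if "\<kappa> \<in> A" for \<kappa>
      unfolding smooth_on_def
      using Ck_on_linear_compose[OF bounded_linear_cons open_chart_image[OF N that]] lift(1)[OF that]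
      unfolding smooth_on_def by blast
    show "isotropic_minimal_at herm_lor (\<lambda>q. cons_coord 0 (\<psi>' (coord_inv \<kappa> q))) (snd \<kappa> x)"
      if \<kappa>: "\<kappa> \<in> A" "x \<in> fst \<kappa>" for \<kappa> x
      by (rule isotropic_minimal_at_linear_image[OF open_chart_image[OF N \<kappa>(1)] lift(1)[OF \<kappa>(1)] _
            bounded_linear_ident bounded_linear_cons _ min[OF \<kappa>]])
        (use \<kappa> in \<open>auto simp: herm_lor_cons_coord\<close>)
  qed (use quadric hor UN in \<open>auto simp: has_derivative_sinh_cosh cons_coord_linear herm_lor_cons_coord herm_scaleR
         fd scaleR_conv_of_real[where 'a = complex] cosh_sinh_of_real\<close>)
qed

text \<open>The terms quadratic in \<open>f\<close> cancel because \<open>f / 2\<close> occurs in a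
  spacelike and in the timelike slot. The mixed terms sum to
  \<open>- exp s * Re f * (cosh s + sinh s)\<close>, which offsets the first summand; what remains
  comes from \<open>cosh\<close> and \<open>sinh\<close> alone.\<close>

lemma parabolic_identities:
  fixes f :: complex and r s :: real
  assumes "Re f = r"
  shows "of_real (exp s * (exp s * r)) + (of_real (exp s) * (f / 2) - of_real (sinh s)) * cnj (of_real (exp s) * (f / 2) - of_real (sinh s))
      - (of_real (exp s) * (f / 2) + of_real (cosh s)) * cnj (of_real (exp s) * (f / 2) + of_real (cosh s)) = -1"
    and "of_real (exp s * (exp s * r)) + (of_real (exp s) * (f / 2) - of_real (cosh s)) * cnj (of_real (exp s) * (f / 2) - of_real (sinh s))
      - (of_real (exp s) * (f / 2) + of_real (sinh s)) * cnj (of_real (exp s) * (f / 2) + of_real (cosh s)) = 0"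
    and "of_real (exp s * (exp s * r)) + (of_real (exp s) * (f / 2) - of_real (cosh s)) * cnj (of_real (exp s) * (f / 2) - of_real (cosh s))
      - (of_real (exp s) * (f / 2) + of_real (sinh s)) * cnj (of_real (exp s) * (f / 2) + of_real (sinh s)) = 1"
proof -
  define E where "E = exp s"
  have E: "exp (- s) = 1 / E" "E \<noteq> 0" by (simp_all add: E_def exp_minus inverse_eq_divide)
  have sc: "sinh s = (E - 1 / E) / 2" "cosh s = (E + 1 / E) / 2"
    by (simp_all add: sinh_def cosh_def E E_def[symmetric])
  show "of_real (exp s * (exp s * r)) + (of_real (exp s) * (f / 2) - of_real (sinh s)) * cnj (of_real (exp s) * (f / 2) - of_real (sinh s))
      - (of_real (exp s) * (f / 2) + of_real (cosh s)) * cnj (of_real (exp s) * (f / 2) + of_real (cosh s)) = -1"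
    and "of_real (exp s * (exp s * r)) + (of_real (exp s) * (f / 2) - of_real (cosh s)) * cnj (of_real (exp s) * (f / 2) - of_real (sinh s))
      - (of_real (exp s) * (f / 2) + of_real (sinh s)) * cnj (of_real (exp s) * (f / 2) + of_real (cosh s)) = 0"
    and "of_real (exp s * (exp s * r)) + (of_real (exp s) * (f / 2) - of_real (cosh s)) * cnj (of_real (exp s) * (f / 2) - of_real (cosh s))
      - (of_real (exp s) * (f / 2) + of_real (sinh s)) * cnj (of_real (exp s) * (f / 2) + of_real (sinh s)) = 1"
    unfolding sc E_def[symmetric] complex_eq_iff assms[symmetric] using E(2)
    by (simp_all add: field_simps power2_eq_square)
qed

text \<open>The two real conditions on \<open>f\<close> are the real and imaginary parts of one
  complex equation for its derivative; the real part follows by differentiating the square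
  norm.\<close>

lemma parabolic_potential_has_derivative:
  fixes H :: "'e::euclidean_space \<Rightarrow> complex^'m" and f :: "'e \<Rightarrow> complex"
  assumes W: "open W" "p \<in> W" and H: "(H has_derivative D) (at p)"
    and re: "\<And>q. q \<in> W \<Longrightarrow> Re (f q) = (norm (H q))\<^sup>2"
    and im: "((\<lambda>q. Im (f q)) has_derivative (\<lambda>v. 2 * inner (D v) (\<i> *s H p))) (at p)"
  shows "(f has_derivative (\<lambda>v. 2 * herm_pos (D v) (H p))) (at p)"
proof -
  have "((\<lambda>q. inner (H q) (H q)) has_derivative (\<lambda>v. 2 * inner (D v) (H p))) (at p)"
    using has_derivative_inner[OF H H] by (simp add: inner_commute)
  then have dre: "((\<lambda>q. Re (f q)) has_derivative (\<lambda>v. 2 * inner (D v) (H p))) (at p)"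
    by (rule has_derivative_transform_within_open[OF _ W]) (simp add: re power2_norm_eq_inner)
  have "((\<lambda>q. of_real (Re (f q)) + \<i> * of_real (Im (f q))) has_derivative
      (\<lambda>v. of_real (2 * inner (D v) (H p)) + \<i> * of_real (2 * inner (D v) (\<i> *s H p)))) (at p)"
    by (intro has_derivative_add has_derivative_mult_right has_derivative_of_real dre im)
  moreover have "of_real (2 * inner (D v) (H p)) + \<i> * of_real (2 * inner (D v) (\<i> *s H p)) = 2 * herm_pos (D v) (H p)" for v
    by (simp add: complex_eq_iff herm_pos_def inner_vec_def inner_complex_def algebra_simps)
  moreover have "of_real (Re (f q)) + \<i> * of_real (Im (f q)) = f q" for q by (simp add: complex_eq_iff)
  ultimately show ?thesis by simp
qed

text \<open>The vector \<open>L (0, 1)\<close> is null and orthogonal to the range of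
  \<open>L\<close>, so adding \<open>f\<close> to \<open>\<eta>\<close> leaves all products of
  derivatives unchanged. Its product with \<open>c s\<close> and \<open>c' s\<close> is
  \<open>- exp s\<close>, which makes \<open>df = 2 (d\<eta>, \<eta>)\<close> precisely the
  condition of horizontality.\<close>

lemma parabolic_case:
  fixes A :: "('p::{t2_space,second_countable_topology}, real^'m) chart set"
    and \<eta> :: "'p \<Rightarrow> complex^'m" and f :: "'p \<Rightarrow> complex"
  assumes N: "smooth_manifold N A" and \<eta>: "minimal_lagrangian_immersion A complex_euclidean \<eta>"
    and re: "\<forall>x\<in>N. Re (f x) = (norm (\<eta> x))\<^sup>2"
    and im: "\<forall>\<kappa>\<in>A. \<forall>x\<in>fst \<kappa>. ((\<lambda>p. Im (f (coord_inv \<kappa> p))) has_derivative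
        (\<lambda>v. 2 * inner (frechet_derivative (\<eta> \<circ> coord_inv \<kappa>) (at (snd \<kappa> x)) v) (\<i> *s \<eta> x))) (at (snd \<kappa> x))"
  shows "minimal_lagrangian_immersion (prod_atlas (open_atlas UNIV) A)
    (complex_hyperbolic :: ((complex^('m option option)) set, complex^('m option)) hermitian_manifold)
    (\<lambda>(s::real, x). hopf
       (complex_of_real (exp s) *s append_coord (append_coord (\<eta> x) (f x / 2)) (f x / 2)
        + append_coord (append_coord 0 (- complex_of_real (sinh s))) (complex_of_real (cosh s))))"
proof -
  have UN: "x \<in> N" if "\<kappa> \<in> A" "x \<in> fst \<kappa>" for \<kappa> x using N that unfolding smooth_manifold_def by auto
  define \<zeta> where "\<zeta> = (\<lambda>x. (\<eta> x, f x))"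
  define L :: "(complex^'m) \<times> complex \<Rightarrow> complex^('m option option)"
    where "L = (\<lambda>(x, a). append_coord (append_coord x (a / 2)) (a / 2))"
  have bL: "bounded_linear L"
    unfolding linear_conv_bounded_linear[symmetric] L_def
    by (rule linearI) (auto simp: append_coord_linear add_divide_distrib scaleR_conv_of_real[where 'a = complex])
  have L_herm: "herm_lor (L x) (L y) = herm_pos (fst x) (fst y)" for x y
    by (simp add: L_def split_beta herm_lor_append_coord herm_pos_append_coord)
  have sm\<eta>: "smooth_on (snd \<kappa> ` fst \<kappa>) (\<lambda>q. \<eta> (coord_inv \<kappa> q))" if "\<kappa> \<in> A" for \<kappa>
    using \<eta> that smooth_map_euclidean[of A \<eta>]
    unfolding minimal_lagrangian_immersion_def minimal_immersion_def immersion_def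
    by (simp add: complex_euclidean_def)
  have df: "((\<lambda>q. f (coord_inv \<kappa> q)) has_derivative
      (\<lambda>v. 2 * herm_pos (frechet_derivative (\<lambda>q. \<eta> (coord_inv \<kappa> q)) (at p) v) (\<eta> (coord_inv \<kappa> p)))) (at p)"
    if \<kappa>: "\<kappa> \<in> A" and p: "p \<in> snd \<kappa> ` fst \<kappa>" for \<kappa> p
  proof (rule parabolic_potential_has_derivative[OF open_chart_image[OF N \<kappa>] p smooth_on_has_derivative[OF sm\<eta>[OF \<kappa>] p]])
    show "Re (f (coord_inv \<kappa> q)) = (norm (\<eta> (coord_inv \<kappa> q)))\<^sup>2" if "q \<in> snd \<kappa> ` fst \<kappa>" for q
      using that re UN[OF \<kappa>] coord_inv_chart[OF N \<kappa>] by auto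
    obtain x where x: "x \<in> fst \<kappa>" "p = snd \<kappa> x" using p by blast
    show "((\<lambda>q. Im (f (coord_inv \<kappa> q))) has_derivative
       (\<lambda>v. 2 * inner (frechet_derivative (\<lambda>q. \<eta> (coord_inv \<kappa> q)) (at p) v) (\<i> *s \<eta> (coord_inv \<kappa> p)))) (at p)"
      using im \<kappa> x coord_inv_chart[OF N \<kappa> x(1)] by (simp add: o_def)
  qed
  have sm\<zeta>: "smooth_on (snd \<kappa> ` fst \<kappa>) (\<lambda>q. \<zeta> (coord_inv \<kappa> q))" if \<kappa>: "\<kappa> \<in> A" for \<kappa>
    unfolding smooth_on_def
  proof
    fix k
    note W = open_chart_image[OF N \<kappa>]
    have \<eta>k: "Ck_on k (snd \<kappa> ` fst \<kappa>) (\<lambda>q. \<eta> (coord_inv \<kappa> q))" for k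
      using sm\<eta>[OF \<kappa>] unfolding smooth_on_def by blast
    \<comment> \<open>The hypotheses provide just a first derivative of \<open>f\<close>, but it is
      a smooth expression in \<open>\<eta>\<close> and its derivative; hence \<open>f\<close> is
      smooth too.\<close>
    have "Ck_on k (snd \<kappa> ` fst \<kappa>) (\<lambda>q. 2 * herm_pos (frechet_derivative (\<lambda>q. \<eta> (coord_inv \<kappa> q)) (at q) v) (\<eta> (coord_inv \<kappa> q)))" for v
      by (rule Ck_on_linear_compose[OF bounded_linear_mult_right W
            Ck_on_bilinear[OF bounded_bilinear_herm_pos W Ck_on_SucD(2)[OF \<eta>k] \<eta>k]])
    from Ck_on_lower[OF Ck_on_SucI[OF W df[OF \<kappa>] this]]
    have fk: "Ck_on k (snd \<kappa> ` fst \<kappa>) (\<lambda>q. f (coord_inv \<kappa> q))" .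
    have "bounded_linear (\<lambda>x::complex^'m. (x, 0::complex))" "bounded_linear (\<lambda>a::complex. (0::complex^'m, a))"
      by (auto intro!: bounded_linear_Pair bounded_linear_ident bounded_linear_zero)
    from Ck_on_add[OF W Ck_on_linear_compose[OF this(1) W \<eta>k] Ck_on_linear_compose[OF this(2) W fk]]
    show "Ck_on k (snd \<kappa> ` fst \<kappa>) (\<lambda>q. \<zeta> (coord_inv \<kappa> q))" by (simp add: \<zeta>_def)
  qed
  have D\<zeta>: "frechet_derivative (\<lambda>q. \<zeta> (coord_inv \<kappa> q)) (at p) v =
     (frechet_derivative (\<lambda>q. \<eta> (coord_inv \<kappa> q)) (at p) v,
      2 * herm_pos (frechet_derivative (\<lambda>q. \<eta> (coord_inv \<kappa> q)) (at p) v) (\<eta> (coord_inv \<kappa> p)))"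
    if \<kappa>: "\<kappa> \<in> A" and p: "p \<in> snd \<kappa> ` fst \<kappa>" for \<kappa> p v
    unfolding \<zeta>_def
    by (rule fun_cong[OF frechet_derivative_at[symmetric]],
        rule has_derivative_Pair[OF smooth_on_has_derivative[OF sm\<eta>[OF \<kappa>] p] df[OF \<kappa> p]])
  define c where "c = (\<lambda>s::real. sinh s *\<^sub>R append_coord (append_coord (0::complex^'m) (-1)) 0 + cosh s *\<^sub>R append_coord 0 1)"
  define c' where "c' = (\<lambda>s::real. cosh s *\<^sub>R append_coord (append_coord (0::complex^'m) (-1)) 0 + sinh s *\<^sub>R append_coord 0 1)"
  have z: "append_coord 0 0 = 0" by (simp add: append_coord_def vec_eq_iff split: option.splits)
  have c: "c s = append_coord (append_coord 0 (- of_real (sinh s))) (of_real (cosh s))"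
    "c' s = append_coord (append_coord 0 (- of_real (cosh s))) (of_real (sinh s))" for s
    by (simp_all add: c_def c'_def append_coord_linear scaleR_conv_of_real[where 'a = complex])
  have eq: "complex_of_real (exp s) *s append_coord (append_coord (\<eta> x) (f x / 2)) (f x / 2)
        + append_coord (append_coord 0 (- complex_of_real (sinh s))) (complex_of_real (cosh s)) =
      exp s *\<^sub>R L (\<zeta> x) + c s" for s x
    by (simp add: c vector_smult_of_real L_def \<zeta>_def)
  have pt: "exp s *\<^sub>R L (\<zeta> x) + c s = append_coord (append_coord (exp s *\<^sub>R \<eta> x) (of_real (exp s) * (f x / 2) - of_real (sinh s)))
        (of_real (exp s) * (f x / 2) + of_real (cosh s))"
    "exp s *\<^sub>R L (\<zeta> x) + c' s = append_coord (append_coord (exp s *\<^sub>R \<eta> x) (of_real (exp s) * (f x / 2) - of_real (cosh s)))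
        (of_real (exp s) * (f x / 2) + of_real (sinh s))" for s x
    by (simp_all add: L_def \<zeta>_def c append_coord_linear scaleR_conv_of_real[where 'a = complex])
  have pos_\<eta>: "herm_pos (exp s *\<^sub>R \<eta> x) (exp s *\<^sub>R \<eta> x) = of_real (exp s * (exp s * (norm (\<eta> x))\<^sup>2))" for s x
    by (simp add: herm_scaleR herm_pos_self power2_eq_square)
  show ?thesis
    unfolding eq
  proof (rule warped_product_minimal_lagrangian[OF N, where l' = exp and c' = c'])
    show "Ck_on k UNIV (exp :: real \<Rightarrow> real)" for k by (rule Ck_on_exp)
    show "Ck_on k UNIV c" for k
      unfolding c_def
      using Ck_on_sinh_cosh
      by (intro Ck_on_add Ck_on_linear_compose[OF bounded_linear_scaleR_left]) auto
    show "(exp has_derivative (\<lambda>t. t * exp s)) (at s)" "(exp has_derivative (\<lambda>t. t * exp s)) (at s)" for s :: real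
      by (auto intro!: derivative_eq_intros)
    show "(c has_derivative (\<lambda>t. t *\<^sub>R c' s)) (at s)" "(c' has_derivative (\<lambda>t. t *\<^sub>R c s)) (at s)" for s
      unfolding c_def c'_def
      using has_derivative_add[OF has_derivative_scaleR_left[OF has_derivative_sinh_cosh(1)] has_derivative_scaleR_left[OF has_derivative_sinh_cosh(2)]]
        has_derivative_add[OF has_derivative_scaleR_left[OF has_derivative_sinh_cosh(2)] has_derivative_scaleR_left[OF has_derivative_sinh_cosh(1)]]
      by (simp_all add: scaleR_right_distrib)
    show "smooth_on (snd \<kappa> ` fst \<kappa>) (\<lambda>q. L (\<zeta> (coord_inv \<kappa> q)))" if "\<kappa> \<in> A" for \<kappa>
      unfolding smooth_on_def
      using Ck_on_linear_compose[OF bL open_chart_image[OF N that]] sm\<zeta>[OF that]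
      unfolding smooth_on_def by blast
    show "isotropic_minimal_at herm_lor (\<lambda>q. L (\<zeta> (coord_inv \<kappa> q))) (snd \<kappa> x)"
      if \<kappa>: "\<kappa> \<in> A" "x \<in> fst \<kappa>" for \<kappa> x
      by (rule isotropic_minimal_at_linear_image[where \<zeta> = "\<lambda>q. \<zeta> (coord_inv \<kappa> q)" and L = fst and L' = L
            and h = herm_pos and h' = herm_lor, OF open_chart_image[OF N \<kappa>(1)] sm\<zeta>[OF \<kappa>(1)] _
            bounded_linear_fst bL L_herm])
        (use \<kappa> isotropic_minimal_flat[OF N \<eta> \<kappa>] in \<open>auto simp: \<zeta>_def\<close>)
    show "herm_lor (exp s *\<^sub>R L (\<zeta> x) + c s) (exp s *\<^sub>R L (\<zeta> x) + c s) = -1"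
      "herm_lor (exp s *\<^sub>R L (\<zeta> x) + c' s) (exp s *\<^sub>R L (\<zeta> x) + c s) = 0"
      "herm_lor (exp s *\<^sub>R L (\<zeta> x) + c' s) (exp s *\<^sub>R L (\<zeta> x) + c' s) = 1" if "x \<in> N" for s x
      unfolding pt herm_lor_append_coord herm_pos_append_coord pos_\<eta>
      by (rule parabolic_identities; use re that in blast)+
    fix \<kappa> s x v assume \<kappa>: "\<kappa> \<in> A" "x \<in> fst \<kappa>"
    have D: "frechet_derivative (\<lambda>q. L (\<zeta> (coord_inv \<kappa> q))) (at (snd \<kappa> x)) v =
      L (frechet_derivative (\<lambda>q. \<eta> (coord_inv \<kappa> q)) (at (snd \<kappa> x)) v,
        2 * herm_pos (frechet_derivative (\<lambda>q. \<eta> (coord_inv \<kappa> q)) (at (snd \<kappa> x)) v) (\<eta> x))"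
      using frechet_derivative_chart_linear[OF N \<kappa> bL sm\<zeta>[OF \<kappa>(1)]] D\<zeta>[OF \<kappa>(1)] \<kappa>(2) coord_inv_chart[OF N \<kappa>] by simp
    have es: "complex_of_real (exp s) = of_real (cosh s) + of_real (sinh s)"
      by (metis cosh_plus_sinh of_real_add)
    show "herm_lor (frechet_derivative (\<lambda>q. L (\<zeta> (coord_inv \<kappa> q))) (at (snd \<kappa> x)) v) (exp s *\<^sub>R L (\<zeta> x) + c s) = 0"
      "herm_lor (frechet_derivative (\<lambda>q. L (\<zeta> (coord_inv \<kappa> q))) (at (snd \<kappa> x)) v) (exp s *\<^sub>R L (\<zeta> x) + c' s) = 0"
      unfolding D pt by (simp_all add: L_def herm_lor_append_coord herm_pos_append_coord herm_scaleR es algebra_simps)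
  qed simp_all
qed

theorem proposition4:
  fixes n :: nat
    and N :: "'p::{t2_space,second_countable_topology} set"
    and A :: "('p, real^'m) chart set"
  assumes "n \<ge> 2" and "CARD('m) = n - 1"
    and "smooth_manifold N A" and "simply_connected N"
  shows "(\<forall>(\<phi> :: 'p \<Rightarrow> (complex^('m option)) set) \<phi>'.
            minimal_lagrangian_immersion A complex_projective \<phi> \<and>
            horizontal_lift A unit_sphere herm_pos \<phi> \<phi>' \<longrightarrow>
            minimal_lagrangian_immersion (prod_atlas (open_atlas {0<..}) A)
              (complex_hyperbolic :: ((complex^('m option option)) set, complex^('m option)) hermitian_manifold)
              (\<lambda>(s::real, x). hopf (append_coord (complex_of_real (sinh s) *s \<phi>' x) (complex_of_real (cosh s)))))
       \<and> (\<forall>(\<psi> :: 'p \<Rightarrow> (complex^('m option)) set) \<psi>'.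
            minimal_lagrangian_immersion A complex_hyperbolic \<psi> \<and>
            horizontal_lift A anti_de_sitter herm_lor \<psi> \<psi>' \<longrightarrow>
            minimal_lagrangian_immersion (prod_atlas (open_atlas UNIV) A)
              (complex_hyperbolic :: ((complex^('m option option)) set, complex^('m option)) hermitian_manifold)
              (\<lambda>(s::real, x). hopf (cons_coord (complex_of_real (sinh s)) (complex_of_real (cosh s) *s \<psi>' x))))
       \<and> (\<forall>(\<eta> :: 'p \<Rightarrow> complex^'m) (f :: 'p \<Rightarrow> complex).
            minimal_lagrangian_immersion A complex_euclidean \<eta> \<and>
            (\<forall>x\<in>N. Re (f x) = (norm (\<eta> x))\<^sup>2) \<and>
            (\<forall>\<kappa>\<in>A. \<forall>x\<in>fst \<kappa>.
               ((\<lambda>p. Im (f (coord_inv \<kappa> p))) has_derivative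
                (\<lambda>v. 2 * inner (frechet_derivative (\<eta> \<circ> coord_inv \<kappa>) (at (snd \<kappa> x)) v) (\<i> *s \<eta> x)))
                 (at (snd \<kappa> x))) \<longrightarrow>
            minimal_lagrangian_immersion (prod_atlas (open_atlas UNIV) A)
              (complex_hyperbolic :: ((complex^('m option option)) set, complex^('m option)) hermitian_manifold)
              (\<lambda>(s::real, x). hopf
                 (complex_of_real (exp s) *s append_coord (append_coord (\<eta> x) (f x / 2)) (f x / 2)
                  + append_coord (append_coord 0 (- complex_of_real (sinh s))) (complex_of_real (cosh s)))))"
  by (intro conjI allI impI; elim conjE)
    (rule spherical_case[OF assms(3)] hyperbolic_case[OF assms(3)] parabolic_case[OF assms(3)]; assumption)+

end
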